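(* Let $d\ge 2$, and let $h$ be the log-correlated Gaussian field on $\mathbb{R}^d$. Let $\rho$ and $\sigma$ be admissible mollifiers on $\mathbb{R}^d$. Suppose that there exists $p\in(0,1]$ such that $\rho$ and $\sigma$ both satisfy Condition $(A_p)$. Then almost surely, $$\mathcal T_{\alpha,\star}^\rho=\mathcal T_{\alpha,\star}^\sigma\qquad\text{for every }\alpha\in\mathbb R\text{ and every }\star\in\{\liminf,\limsup,\lim\}.$$
   Context: Let $\mathcal S(\mathbb R^d)$ be the Schwartz space and $\mathcal S_0(\mathbb R^d)=\{f\in\mathcal S(\mathbb R^d):\int f\,dx=0\}$. The log-correlated Gaussian field (LGF) $h$ on $\mathbb R^d$ is the centered Gaussian random tempered distribution modulo additive constants with $$\operatorname{Cov}[(h,f_1),(h,f_2)]=\iint_{\mathbb R^d\times\mathbb R^d}\log\frac1{|x-y|}f_1(x)f_2(y)\,dx\,dy,\qquad f_1,f_2\in\mathcal S_0(\mathbb R^d).$$ The additive constant is fixed by requiring that the average of $h$ over the unit sphere is $0$ (i.e. $h$ is replaced by $h-h_1(0)$, with $h_1(0)$ the average of $h$ over the unit sphere centered at $0$), so that $(h,f)$ is defined for smooth compactly supported $f$ with $\int f=1$. An admissible mollifier is a nonnegative Radon measure $\rho$ on $\mathbb R^d$ such that (i) $\operatorname{supp}(\rho)\subseteq\overline{B(0,1)}$; (ii) $\rho(\mathbb R^d)=1$; (iii) $\iint\left|\log\frac1{|x-y|}\right|\rho(dx)\rho(dy)<\infty$. For a nonnegative Radon measure $\mu$ with total mass $1$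 and $\iint|\log\frac{1}{|x-y|}|\mu(dx)\mu(dy)<\infty$, the pairing $(h,\mu)$ is the $L^2(\mathbb P)$-limit of $(h,\mu*\psi_n)$, where $\psi_n(x)=n^d\psi(nx)$ and $\psi$ is smooth, nonnegative, symmetric, supported in $B(0,1)$, with integral $1$ (the limit exists and does not depend on $\psi$). For $\epsilon>0$, $z\in\mathbb R^d$, $\rho_{z,\epsilon}$ denotes the pushforward of $\rho$ under $y\mapsto z+\epsilon y$, and the mollified field is $h_\epsilon^\rho(z):=(h,\rho_{z,\epsilon})$. Condition $(A_p)$, for $p\in(0,1]$: there is a constant $C$ (which may depend on $\rho,p,d$) such that $$\mathbb E\big[(h_\epsilon^\rho(z)-h_r^\rho(w))^2\big]\le C\left(\frac{|(z,\epsilon)-(w,r)|}{\epsilon\wedge r}\right)^p$$ for all $z,w\in\mathbb R^d$ and all $\epsilon,r\in(0,1]$ with $\frac12\le\epsilon/r\le2$. Whenever $\rho$ satisfies Condition $(A_p)$, the process $(z,\epsilon)\mapsto h^\rho_\epsilon(z)$ on $\mathbb R^d\times(0,1]$ has a jointly continuous modification, and $h^\rho_\epsilon(z)$ denotes such a modification. Thick points: for $\alpha\in\mathbb R$ and $\star\in\{\liminf,\limsup,\lim\}$, $\mathcal T^\rho_{\alpha,\star}$ is the set of $z\in\mathbb R^d$ such that, respectively, $\liminf_{\epsilon\to0}\frac{h^\rho_\epsilon(z)}{\log(1/\epsilon)}=\alpha$, $\limsup_{\epsilon\to0}\frac{h^\rho_\epsilon(z)}{\log(1/\epsilon)}=\alpha$,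 or $\lim_{\epsilon\to0}\frac{h^\rho_\epsilon(z)}{\log(1/\epsilon)}$ exists and equals $\alpha$. *)

theory Defs
  imports "HOL-Probability.Probability"
begin

section \<open>Schwartz functions and tempered distributions\<close>

text \<open>The dimension \<open>d\<close> is \<open>DIM('a)\<close>. Iterated partial derivatives are indexed by lists of
  coordinate directions.\<close>

primrec partials :: "'a::euclidean_space list \<Rightarrow> ('a \<Rightarrow> real) \<Rightarrow> 'a \<Rightarrow> real" where
  "partials [] f = f"
| "partials (b # bs) f = (\<lambda>x. frechet_derivative (partials bs f) (at x) b)"

definition smooth :: "('a::euclidean_space \<Rightarrow> real) \<Rightarrow> bool" where
  "smooth f \<longleftrightarrow> (\<forall>bs \<in> lists Basis. \<forall>x. partials bs f differentiable (at x))"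

definition schwartz :: "('a::euclidean_space \<Rightarrow> real) set" where
  "schwartz = {f. smooth f \<and>
     (\<forall>bs \<in> lists Basis. \<forall>k::nat. bounded (range (\<lambda>x. (1 + norm x) ^ k * partials bs f x)))}"

definition schwartz0 :: "('a::euclidean_space \<Rightarrow> real) set" where
  "schwartz0 = {f \<in> schwartz. integral\<^sup>L lborel f = 0}"

definition schwartz_seminorm :: "nat \<Rightarrow> 'a::euclidean_space list \<Rightarrow> ('a \<Rightarrow> real) \<Rightarrow> real" where
  "schwartz_seminorm k bs f = (SUP x. (1 + norm x) ^ k * \<bar>partials bs f x\<bar>)"

text \<open>The Schwartz space is metrizable, so a linear functional on it is continuous iff it is
  sequentially continuous at \<open>0\<close>. Values outside \<open>schwartz\<close> are irrelevant.\<close>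

definition tempered_distribution :: "(('a::euclidean_space \<Rightarrow> real) \<Rightarrow> real) \<Rightarrow> bool" where
  "tempered_distribution T \<longleftrightarrow>
     (\<forall>f \<in> schwartz. \<forall>g \<in> schwartz. \<forall>a b. T (\<lambda>x. a * f x + b * g x) = a * T f + b * T g) \<and>
     (\<forall>F :: nat \<Rightarrow> 'a \<Rightarrow> real. (\<forall>n. F n \<in> schwartz) \<and>
        (\<forall>k. \<forall>bs \<in> lists Basis. (\<lambda>n. schwartz_seminorm k bs (F n)) \<longlonglongrightarrow> 0) \<longrightarrow>
        (\<lambda>n. T (F n)) \<longlonglongrightarrow> 0)"


section \<open>The log-correlated Gaussian field\<close>

text \<open>The degenerate case (variance \<open>0\<close>) counts as Gaussian.\<close>

definition centered_gaussian :: "'w measure \<Rightarrow> ('w \<Rightarrow> real) \<Rightarrow> bool" where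
  "centered_gaussian M X \<longleftrightarrow> X \<in> borel_measurable M \<and>
     ((AE \<omega> in M. X \<omega> = 0) \<or>
      (\<exists>s>0. distributed M lborel X (\<lambda>x. ennreal (normal_density 0 s x))))"

text \<open>A tempered distribution modulo additive constants is a tempered distribution considered only
  through its action on \<open>schwartz0\<close>, where constants act trivially. Accordingly \<open>h \<omega>\<close> is a
  representative of the class, and its law is prescribed on \<open>schwartz0\<close> only. Since \<open>h \<omega>\<close> is linear,
  Gaussianity of every single pairing is joint Gaussianity, and centeredness makes the expectation
  of the product the covariance. In the double integral the value of \<open>ln (1 / dist x y)\<close> on the
  (null) diagonal does not matter.\<close>

definition LGF :: "'w measure \<Rightarrow> ('w \<Rightarrow> ('a::euclidean_space \<Rightarrow> real) \<Rightarrow> real) \<Rightarrow> bool" where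
  "LGF M h \<longleftrightarrow>
     (\<forall>\<omega> \<in> space M. tempered_distribution (h \<omega>)) \<and>
     (\<forall>f \<in> schwartz0. centered_gaussian M (\<lambda>\<omega>. h \<omega> f)) \<and>
     (\<forall>f1 \<in> schwartz0. \<forall>f2 \<in> schwartz0.
        (\<integral>\<omega>. h \<omega> f1 * h \<omega> f2 \<partial>M) =
        (\<integral>(x, y). ln (1 / dist x y) * f1 x * f2 y \<partial>(lborel \<Otimes>\<^sub>M lborel)))"


section \<open>Pairing the field with measures\<close>

definition smoothing_kernel :: "('a::euclidean_space \<Rightarrow> real) \<Rightarrow> bool" where
  "smoothing_kernel \<psi> \<longleftrightarrow> smooth \<psi> \<and> (\<forall>x. 0 \<le> \<psi> x) \<and> (\<forall>x. \<psi> (- x) = \<psi> x) \<and>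
     (\<forall>x. x \<notin> ball 0 1 \<longrightarrow> \<psi> x = 0) \<and> integral\<^sup>L lborel \<psi> = 1"

definition scaled_kernel :: "('a::euclidean_space \<Rightarrow> real) \<Rightarrow> nat \<Rightarrow> 'a \<Rightarrow> real" where
  "scaled_kernel \<psi> n x = real n ^ DIM('a) * \<psi> (real n *\<^sub>R x)"

definition convolve :: "'a::euclidean_space measure \<Rightarrow> ('a \<Rightarrow> real) \<Rightarrow> 'a \<Rightarrow> real" where
  "convolve \<mu> f x = (\<integral>y. f (x - y) \<partial>\<mu>)"

definition L2_rv :: "'w measure \<Rightarrow> ('w \<Rightarrow> real) \<Rightarrow> bool" where
  "L2_rv M X \<longleftrightarrow> X \<in> borel_measurable M \<and> integrable M (\<lambda>\<omega>. (X \<omega>)\<^sup>2)"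

definition L2_limit :: "'w measure \<Rightarrow> (nat \<Rightarrow> 'w \<Rightarrow> real) \<Rightarrow> ('w \<Rightarrow> real) \<Rightarrow> bool" where
  "L2_limit M X Y \<longleftrightarrow> (\<forall>n. L2_rv M (X n)) \<and> L2_rv M Y \<and>
     (\<lambda>n. \<integral>\<omega>. (X n \<omega> - Y \<omega>)\<^sup>2 \<partial>M) \<longlonglongrightarrow> 0"

text \<open>\<open>(h, \<mu>)\<close> is an \<open>L\<^sup>2\<close>-limit, hence only determined almost surely: \<open>is_pairing M \<psi> h \<mu> X\<close> says
  that the random variable \<open>X\<close> is a version of it, and \<open>pairing\<close> picks one version. The sequence
  starts at \<open>n = 1\<close>.\<close>

definition is_pairing ::
  "'w measure \<Rightarrow> ('a::euclidean_space \<Rightarrow> real) \<Rightarrow> ('w \<Rightarrow> ('a \<Rightarrow> real) \<Rightarrow> real) \<Rightarrow>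
   'a measure \<Rightarrow> ('w \<Rightarrow> real) \<Rightarrow> bool" where
  "is_pairing M \<psi> h \<mu> X \<longleftrightarrow>
     L2_limit M (\<lambda>n \<omega>. h \<omega> (convolve \<mu> (scaled_kernel \<psi> (Suc n)))) X"

definition pairing ::
  "'w measure \<Rightarrow> ('a::euclidean_space \<Rightarrow> real) \<Rightarrow> ('w \<Rightarrow> ('a \<Rightarrow> real) \<Rightarrow> real) \<Rightarrow>
   'a measure \<Rightarrow> 'w \<Rightarrow> real" where
  "pairing M \<psi> h \<mu> = (SOME X. is_pairing M \<psi> h \<mu> X)"

text \<open>The uniform probability measure on the unit sphere is the image of the uniform measure on the
  unit ball under the radial projection \<open>sgn x = x / norm x\<close>.\<close>

definition unit_sphere_measure :: "'a::euclidean_space measure" where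
  "unit_sphere_measure = distr (uniform_measure lborel (ball 0 1)) borel sgn"

text \<open>The representative \<open>h - h\<^sub>1(0)\<close> is the one whose average over the unit sphere is \<open>0\<close>.\<close>

definition normalized_LGF ::
  "'w measure \<Rightarrow> ('a::euclidean_space \<Rightarrow> real) \<Rightarrow> ('w \<Rightarrow> ('a \<Rightarrow> real) \<Rightarrow> real) \<Rightarrow> bool" where
  "normalized_LGF M \<psi> h \<longleftrightarrow> LGF M h \<and> is_pairing M \<psi> h unit_sphere_measure (\<lambda>_. 0)"


section \<open>Mollifiers, mollified fields and thick points\<close>

definition measure_support :: "'a::topological_space measure \<Rightarrow> 'a set" where
  "measure_support \<mu> = {x. \<forall>U. open U \<and> x \<in> U \<longrightarrow> emeasure \<mu> U > 0}"

text \<open>The kernel is infinite on the diagonal; the convention \<open>ln 0 = 0\<close> would hide atoms.\<close>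

definition abs_log_kernel :: "'a::euclidean_space \<Rightarrow> 'a \<Rightarrow> ennreal" where
  "abs_log_kernel x y = (if x = y then \<infinity> else ennreal \<bar>ln (1 / dist x y)\<bar>)"

text \<open>Finite Borel measures on a Euclidean space are automatically Radon.\<close>

definition admissible_mollifier :: "'a::euclidean_space measure \<Rightarrow> bool" where
  "admissible_mollifier \<rho> \<longleftrightarrow> sets \<rho> = sets borel \<and>
     measure_support \<rho> \<subseteq> cball 0 1 \<and> emeasure \<rho> UNIV = 1 \<and>
     (\<integral>\<^sup>+x. (\<integral>\<^sup>+y. abs_log_kernel x y \<partial>\<rho>) \<partial>\<rho>) < \<infinity>"

definition rescale :: "'a::euclidean_space measure \<Rightarrow> 'a \<Rightarrow> real \<Rightarrow> 'a measure" where
  "rescale \<rho> z \<epsilon> = distr \<rho> borel (\<lambda>y. z + \<epsilon> *\<^sub>R y)"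

definition condition_A ::
  "'w measure \<Rightarrow> ('a::euclidean_space \<Rightarrow> real) \<Rightarrow> ('w \<Rightarrow> ('a \<Rightarrow> real) \<Rightarrow> real) \<Rightarrow>
   real \<Rightarrow> 'a measure \<Rightarrow> bool" where
  "condition_A M \<psi> h p \<rho> \<longleftrightarrow>
     (\<exists>C. \<forall>z w. \<forall>\<epsilon> \<in> {0<..1}. \<forall>r \<in> {0<..1}. 1/2 \<le> \<epsilon> / r \<and> \<epsilon> / r \<le> 2 \<longrightarrow>
        (\<integral>\<omega>. (pairing M \<psi> h (rescale \<rho> z \<epsilon>) \<omega> - pairing M \<psi> h (rescale \<rho> w r) \<omega>)\<^sup>2 \<partial>M)
          \<le> C * (norm ((z, \<epsilon>) - (w, r)) / min \<epsilon> r) powr p)"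

text \<open>\<open>H \<epsilon> z \<omega>\<close> is a jointly continuous modification of the mollified field.\<close>

definition continuous_mollified_field ::
  "'w measure \<Rightarrow> ('a::euclidean_space \<Rightarrow> real) \<Rightarrow> ('w \<Rightarrow> ('a \<Rightarrow> real) \<Rightarrow> real) \<Rightarrow>
   'a measure \<Rightarrow> (real \<Rightarrow> 'a \<Rightarrow> 'w \<Rightarrow> real) \<Rightarrow> bool" where
  "continuous_mollified_field M \<psi> h \<rho> H \<longleftrightarrow>
     (\<forall>z. \<forall>\<epsilon> \<in> {0<..1}. is_pairing M \<psi> h (rescale \<rho> z \<epsilon>) (H \<epsilon> z)) \<and>
     (AE \<omega> in M. continuous_on (UNIV \<times> {0<..1}) (\<lambda>(z, \<epsilon>). H \<epsilon> z \<omega>))"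

datatype limit_mode = Lim_inf | Lim_sup | Lim_full

fun thick_points :: "limit_mode \<Rightarrow> real \<Rightarrow> (real \<Rightarrow> 'a \<Rightarrow> real) \<Rightarrow> 'a set" where
  "thick_points Lim_inf \<alpha> u =
     {z. Liminf (at_right 0) (\<lambda>\<epsilon>. ereal (u \<epsilon> z / ln (1 / \<epsilon>))) = ereal \<alpha>}"
| "thick_points Lim_sup \<alpha> u =
     {z. Limsup (at_right 0) (\<lambda>\<epsilon>. ereal (u \<epsilon> z / ln (1 / \<epsilon>))) = ereal \<alpha>}"
| "thick_points Lim_full \<alpha> u =
     {z. ((\<lambda>\<epsilon>. u \<epsilon> z / ln (1 / \<epsilon>)) \<longlongrightarrow> \<alpha>) (at_right 0)}"

end

theory Submission
  imports Defs "HOL-Real_Asymp.Real_Asymp"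
begin

text \<open>Let \<open>D \<epsilon> z\<close> be the difference of the two mollified fields. Both measures have mass one,
  so the logarithmic kernel enters its variance only up to constants, and by scaling this variance
  is bounded uniformly in \<open>z\<close> and \<open>\<epsilon>\<close>. As an \<open>L\<^sup>2\<close> limit of centered Gaussians, \<open>D \<epsilon> z\<close> has a
  Gaussian tail, and so have its increments, whose variance Condition \<open>(A\<^sub>p)\<close> controls. Chaining over
  a cell of size \<open>2\<^sup>-\<^sup>n\<close> in \<open>(z, \<epsilon>)\<close> turns this into a Gaussian tail for the supremum over the cell.
  At height \<open>n\<^bsup>3/4\<^esup>\<close> this tail is superexponentially small in \<open>n\<close>, which beats the exponential number of
  cells that meet a ball of radius \<open>n\<close>. Borel-Cantelli then gives \<open>D \<epsilon> z = o (ln (1 / \<epsilon>))\<close> for all \<open>z\<close>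
  simultaneously, almost surely.\<close>

section \<open>Test functions\<close>

text \<open>The law of \<open>h\<close> is prescribed only on mean-zero functions, and a pairing
  with a measure exists only as an \<open>L\<^sup>2\<close> limit. Every estimate is therefore made
  for a difference of two mollified probability measures, whose densities are test functions of mass
  one, and then passed to the limit in the mollification index. Tail bounds survive this passage
  with a worse constant, so the limits are never shown to be Gaussian themselves.

  The obstacle in the variance bound is the mixed logarithmic energy of \<rho> and \<sigma>:
  admissibility controls only the energy of each measure with itself. Both fields are therefore
  compared with a third one, a point mass smoothed at a scale comparable to \<epsilon>. Smoothing at
  that scale tames the logarithm against any measure carried by the ball of radius \<epsilon>.

  In the chaining, \<epsilon> is one more coordinate besides z. A cell lets \<epsilon> vary by a
  factor of at most 2, as the ratio condition in (A_p) demands, and after an affine change of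
  variables all cells satisfy the same bounds. One set of chaining constants thus serves all of
  them.\<close>

definition test_function :: "('a::euclidean_space \<Rightarrow> real) \<Rightarrow> bool" where
  "test_function f \<longleftrightarrow> smooth f \<and> (\<exists>R. \<forall>x. norm x > R \<longrightarrow> f x = 0)"

lemma partials_append: "partials (bs @ cs) f = partials bs (partials cs f)"
  by (induction bs) simp_all

lemma smooth_partials: "smooth f \<Longrightarrow> cs \<in> lists Basis \<Longrightarrow> smooth (partials cs f)"
  unfolding smooth_def by (metis append_in_lists_conv partials_append)

lemma smooth_differentiable: "smooth f \<Longrightarrow> f differentiable (at x)"
  unfolding smooth_def by (metis lists.Nil partials.simps(1))

text \<open>Induction on the list of directions, with \<open>P\<close> as an invariant under partial
  derivatives. In the applications \<open>P\<close> says that a function has a given shape (a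
  difference, a dilate, a convolution), and the work is to see that a partial derivative has that
  shape again.\<close>

lemma smooth_coinduct:
  assumes "P f"
    and "\<And>g x. P g \<Longrightarrow> g differentiable (at x)"
    and "\<And>g b. P g \<Longrightarrow> b \<in> Basis \<Longrightarrow> P (\<lambda>x. frechet_derivative g (at x) b)"
  shows "smooth f"
proof -
  have "P (partials bs f)" if "bs \<in> lists Basis" for bs
    using that by (induction bs) (auto simp: assms)
  then show ?thesis
    unfolding smooth_def using assms(2) by blast
qed

lemma smooth_has_derivative:
  assumes "smooth f"
  shows "(f has_derivative (\<lambda>h. \<Sum>b\<in>Basis. (h \<bullet> b) * partials [b] f x)) (at x)"
proof -
  let ?D = "frechet_derivative f (at x)"
  have D: "(f has_derivative ?D) (at x)"
    using smooth_differentiable[OF assms] frechet_derivative_works by blast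
  then have lin: "linear ?D"
    using has_derivative_linear by blast
  have "?D h = (\<Sum>b\<in>Basis. (h \<bullet> b) * partials [b] f x)" for h
  proof -
    have "?D h = ?D (\<Sum>b\<in>Basis. (h \<bullet> b) *\<^sub>R b)"
      by (simp add: euclidean_representation)
    also have "\<dots> = (\<Sum>b\<in>Basis. (h \<bullet> b) * ?D b)"
      by (simp add: linear_sum[OF lin] linear_scale[OF lin])
    finally show ?thesis by simp
  qed
  then have "?D = (\<lambda>h. \<Sum>b\<in>Basis. (h \<bullet> b) * partials [b] f x)" by (rule ext)
  with D show ?thesis by (rule has_derivative_eq_rhs)
qed

lemma smooth_continuous_on: "smooth f \<Longrightarrow> continuous_on S f"
  by (intro continuous_at_imp_continuous_on ballI differentiable_imp_continuous_within smooth_differentiable)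

lemma smooth_borel_measurable: "smooth f \<Longrightarrow> f \<in> borel_measurable borel"
  by (simp add: borel_measurable_continuous_onI smooth_continuous_on)

lemma partials_eq_0:
  assumes "\<And>x. norm x > R \<Longrightarrow> f x = 0" and "norm x > R"
  shows "partials bs f x = 0"
  using assms(2)
proof (induction bs arbitrary: x)
  case Nil
  then show ?case by (simp add: assms(1))
next
  case (Cons b bs)
  \<comment> \<open>The derivative at \<open>x\<close> sees a whole neighbourhood of
    \<open>x\<close>, so the induction hypothesis has to be used on an open set.\<close>
  have "open {y::'a. R < norm y}"
    by (intro open_Collect_less continuous_intros)
  then have "(partials bs f has_derivative (\<lambda>_. 0)) (at x)"
    by (rule has_derivative_transform_within_open[where f="\<lambda>_. 0", rotated])
      (use Cons in auto)
  then show ?case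
    by (simp flip: frechet_derivative_at)
qed

lemma test_function_partials:
  "test_function f \<Longrightarrow> bs \<in> lists Basis \<Longrightarrow> test_function (partials bs f)"
  unfolding test_function_def by (metis partials_eq_0 smooth_partials)

lemma test_function_smooth: "test_function f \<Longrightarrow> smooth f"
  by (simp add: test_function_def)

lemma test_function_bounded_weighted:
  assumes "test_function f"
  shows "bounded (range (\<lambda>x. (1 + norm x) ^ k * f x))"
proof -
  obtain R where R: "\<And>x. norm x > R \<Longrightarrow> f x = 0"
    using assms unfolding test_function_def by blast
  let ?g = "\<lambda>x. (1 + norm x) ^ k * f x"
  have "continuous_on (cball 0 R) ?g"
    by (intro continuous_intros smooth_continuous_on test_function_smooth assms)
  then have "bounded (?g ` cball 0 R)"
    by (intro compact_imp_bounded compact_continuous_image compact_cball)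
  then have "bounded (insert 0 (?g ` cball 0 R))" by simp
  moreover have "range ?g \<subseteq> insert 0 (?g ` cball 0 R)"
  proof
    fix y assume "y \<in> range ?g"
    then obtain x where x: "y = ?g x" by blast
    show "y \<in> insert 0 (?g ` cball 0 R)"
      by (cases "norm x \<le> R") (use R x in \<open>auto simp: dist_norm not_le\<close>)
  qed
  ultimately show ?thesis
    using bounded_subset by blast
qed

lemma test_function_bounded:
  assumes "test_function f"
  obtains B where "B > 0" and "\<And>x. \<bar>f x\<bar> \<le> B"
  using test_function_bounded_weighted[OF assms, of 0]
  unfolding bounded_pos by auto

lemma test_function_schwartz: "test_function f \<Longrightarrow> f \<in> schwartz"
  unfolding schwartz_def
  using test_function_bounded_weighted test_function_partials test_function_smooth by blast

lemma test_function_integrable: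
  fixes f :: "'a::euclidean_space \<Rightarrow> real"
  assumes "test_function f"
  shows "integrable lborel f"
proof -
  obtain R where R: "\<And>x. norm x > R \<Longrightarrow> f x = 0"
    using assms unfolding test_function_def by blast
  obtain B where B: "\<And>x. \<bar>f x\<bar> \<le> B"
    using test_function_bounded[OF assms] by metis
  have "integrable lborel (\<lambda>x::'a. B * indicator (cball 0 R) x :: real)"
    using emeasure_lborel_cball_finite[of "0::'a" R] by (intro integrable_mult_right integrable_real_indicator) auto
  then show ?thesis
  proof (rule Bochner_Integration.integrable_bound)
    show "f \<in> borel_measurable lborel"
      using smooth_borel_measurable[OF test_function_smooth[OF assms]] by simp
    show "AE x in lborel. norm (f x) \<le> norm (B * indicator (cball 0 R) x)"
    proof (rule AE_I2)
      fix x show "norm (f x) \<le> norm (B * indicator (cball 0 R) x)"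
        using R[of x] B[of x] by (cases "norm x \<le> R") auto
    qed
  qed
qed

section \<open>Closure under differences and dilations\<close>

lemma test_function_diff:
  assumes "test_function f" "test_function g"
  shows "test_function (\<lambda>x. f x - g x)"
proof -
  define P where "P u \<longleftrightarrow> (\<exists>f g. smooth f \<and> smooth g \<and> u = (\<lambda>x. f x - g x))"
    for u :: "'a \<Rightarrow> real"
  have "P (\<lambda>x. f x - g x)"
    unfolding P_def using assms test_function_smooth by blast
  then have "smooth (\<lambda>x. f x - g x)"
  proof (rule smooth_coinduct[where P=P])
    fix u x assume "P u"
    then show "u differentiable (at x)"
      unfolding P_def using smooth_differentiable by (auto intro!: derivative_intros)
  next
    fix u and b :: 'a assume "P u" and b: "b \<in> Basis"
    then obtain f g where fg: "smooth f" "smooth g" "u = (\<lambda>x. f x - g x)"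
      unfolding P_def by blast
    have "(u has_derivative
      (\<lambda>h. frechet_derivative f (at x) h - frechet_derivative g (at x) h)) (at x)" for x
      unfolding fg
      by (intro derivative_intros) (use fg smooth_differentiable frechet_derivative_works in blast)+
    from frechet_derivative_at[OF this, symmetric]
    have "frechet_derivative u (at x) b = partials [b] f x - partials [b] g x" for x
      by simp
    moreover have "smooth (partials [b] f)" "smooth (partials [b] g)"
      using fg b smooth_partials by (metis lists.simps)+
    ultimately show "P (\<lambda>x. frechet_derivative u (at x) b)"
      unfolding P_def by auto
  qed
  moreover obtain R S where "\<And>x. norm x > R \<Longrightarrow> f x = 0" "\<And>x. norm x > S \<Longrightarrow> g x = 0"
    using assms unfolding test_function_def by blast
  then have "\<forall>x. norm x > max R S \<longrightarrow> f x - g x = 0" by simp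
  ultimately show ?thesis
    unfolding test_function_def by blast
qed

lemma test_function_dilate:
  fixes f :: "'a::euclidean_space \<Rightarrow> real"
  assumes "test_function f" and "k > 0"
  shows "test_function (\<lambda>x. c * f (k *\<^sub>R x))"
proof -
  \<comment> \<open>The prefactor is quantified as well, since every derivative contributes another
    factor \<open>k\<close>.\<close>
  define P where "P u \<longleftrightarrow> (\<exists>c f. smooth f \<and> u = (\<lambda>x. c * f (k *\<^sub>R x)))"
    for u :: "'a \<Rightarrow> real"
  have D: "((\<lambda>x. c * f (k *\<^sub>R x)) has_derivative
      (\<lambda>h. c * frechet_derivative f (at (k *\<^sub>R x)) (k *\<^sub>R h))) (at x)"
    if "smooth f" for c and f :: "'a \<Rightarrow> real" and x
  proof -
    have "(f has_derivative frechet_derivative f (at (k *\<^sub>R x))) (at (k *\<^sub>R x))"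
      using smooth_differentiable[OF that] frechet_derivative_works by blast
    from has_derivative_compose[OF has_derivative_scaleR_right[OF has_derivative_ident] this]
    show ?thesis
      by (rule has_derivative_mult_right)
  qed
  have "P (\<lambda>x. c * f (k *\<^sub>R x))"
    unfolding P_def using assms test_function_smooth by blast
  then have "smooth (\<lambda>x. c * f (k *\<^sub>R x))"
  proof (rule smooth_coinduct[where P=P])
    fix u x assume "P u"
    then show "u differentiable (at x)"
      unfolding P_def using D differentiable_def by blast
  next
    fix u and b :: 'a assume "P u" and b: "b \<in> Basis"
    then obtain c f where f: "smooth f" "u = (\<lambda>x. c * f (k *\<^sub>R x))"
      unfolding P_def by blast
    have "frechet_derivative u (at x) b = c * k * partials [b] f (k *\<^sub>R x)" for x
    proof -
      have "linear (frechet_derivative f (at (k *\<^sub>R x)))"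
        using smooth_differentiable[OF f(1)] linear_frechet_derivative by blast
      then show ?thesis
        using frechet_derivative_at[OF D[OF f(1), of c x], symmetric] f(2)
        by (simp add: linear_scale)
    qed
    moreover have "smooth (partials [b] f)"
      using f b smooth_partials by (metis lists.simps)
    ultimately show "P (\<lambda>x. frechet_derivative u (at x) b)"
      unfolding P_def by (intro exI[of _ "c * k"] exI[of _ "partials [b] f"]) auto
  qed
  moreover obtain R where R: "\<And>x. norm x > R \<Longrightarrow> f x = 0"
    using assms unfolding test_function_def by blast
  have "c * f (k *\<^sub>R x) = 0" if "norm x > R / k" for x
    using that assms(2) R[of "k *\<^sub>R x"] by (simp add: field_simps)
  ultimately show ?thesis
    unfolding test_function_def by blast
qed

lemma test_function_scaled_kernel:
  assumes "smoothing_kernel \<psi>" and "n > 0"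
  shows "test_function (scaled_kernel \<psi> n)"
proof -
  have "test_function \<psi>"
    using assms(1) unfolding smoothing_kernel_def test_function_def
    by (intro conjI exI[of _ 1]) auto
  then show ?thesis
    unfolding scaled_kernel_def[abs_def] using assms(2) by (intro test_function_dilate) auto
qed

section \<open>Lipschitz and Taylor bounds\<close>

lemma test_function_lipschitz:
  assumes "test_function f"
  obtains L where "L > 0" and "\<And>x y. \<bar>f x - f y\<bar> \<le> L * norm (x - y)"
proof -
  have "\<exists>B. \<forall>b\<in>Basis. \<forall>x. \<bar>partials [b] f x\<bar> \<le> B b"
  proof (intro bchoice ballI)
    fix b :: 'a assume "b \<in> Basis"
    then have "test_function (partials [b] f)"
      by (intro test_function_partials assms) auto
    then show "\<exists>B. \<forall>x. \<bar>partials [b] f x\<bar> \<le> B"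
      using test_function_bounded by metis
  qed
  then obtain B where B: "\<And>b x. b \<in> Basis \<Longrightarrow> \<bar>partials [b] f x\<bar> \<le> B b" by blast
  \<comment> \<open>The summand 1 makes the constant positive even if all the bounds vanish.\<close>
  define L where "L = 1 + (\<Sum>b\<in>(Basis::'a set). \<bar>B b\<bar>)"
  have L: "L > 0" unfolding L_def by (simp add: add_pos_nonneg sum_nonneg)
  have "\<bar>f x - f y\<bar> \<le> L * norm (x - y)" for x y
  proof -
    have "norm (f x - f y) \<le> L * norm (x - y)"
    proof (rule differentiable_bound[of UNIV f])
      fix z :: 'a
      show "(f has_derivative (\<lambda>h. \<Sum>b\<in>Basis. (h \<bullet> b) * partials [b] f z)) (at z within UNIV)"
        using smooth_has_derivative[OF test_function_smooth[OF assms]] by blast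
      show "onorm (\<lambda>h. \<Sum>b\<in>Basis. (h \<bullet> b) * partials [b] f z) \<le> L"
      proof (rule onorm_bound)
        fix h :: 'a
        have "norm (\<Sum>b\<in>Basis. (h \<bullet> b) * partials [b] f z) \<le> (\<Sum>b\<in>(Basis::'a set). norm h * \<bar>B b\<bar>)"
        proof (rule sum_norm_le)
          fix b :: 'a assume b: "b \<in> Basis"
          have "\<bar>partials [b] f z\<bar> \<le> \<bar>B b\<bar>" using B[OF b, of z] by linarith
          then show "norm ((h \<bullet> b) * partials [b] f z) \<le> norm h * \<bar>B b\<bar>"
            using Basis_le_norm[OF b, of h] unfolding real_norm_def abs_mult
            by (intro mult_mono) auto
        qed
        also have "\<dots> \<le> L * norm h"
          by (simp add: L_def algebra_simps sum_distrib_left)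
        finally show "norm (\<Sum>b\<in>Basis. (h \<bullet> b) * partials [b] f z) \<le> L * norm h" .
      qed (use L in simp)
    qed auto
    then show ?thesis by simp
  qed
  with L show ?thesis using that by blast
qed

text \<open>The partial derivatives are Lipschitz, so on the ball of radius \<open>norm h\<close>
  around \<open>x\<close> the derivative stays within a multiple of \<open>norm h\<close> of its
  value at \<open>x\<close>; the mean value inequality supplies the second factor
  \<open>norm h\<close>. What matters later is that \<open>K\<close> does not depend on
  \<open>x\<close>.\<close>

lemma test_function_taylor:
  assumes "test_function f"
  obtains K where "K > 0" and
    "\<And>x h. \<bar>f (x + h) - f x - (\<Sum>b\<in>Basis. (h \<bullet> b) * partials [b] f x)\<bar> \<le> K * (norm h)\<^sup>2"
proof -
  have "\<exists>L. \<forall>x y. \<bar>partials [b] f x - partials [b] f y\<bar> \<le> L * norm (x - y)"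
    if b: "b \<in> Basis" for b
  proof -
    have "test_function (partials [b] f)"
      using b by (intro test_function_partials assms) auto
    then show ?thesis
      by (rule test_function_lipschitz) blast
  qed
  then obtain L where L: "\<And>b x y. b \<in> Basis \<Longrightarrow> \<bar>partials [b] f x - partials [b] f y\<bar> \<le> L b * norm (x - y)"
    by metis
  define K where "K = 1 + (\<Sum>b\<in>(Basis::'a set). \<bar>L b\<bar>)"
  have K: "K > 0" unfolding K_def by (simp add: add_pos_nonneg sum_nonneg)
  define D where "D = (\<lambda>z h. \<Sum>b\<in>Basis. (h \<bullet> b) * partials [b] f z)"
  have "\<bar>f (x + h) - f x - D x h\<bar> \<le> K * (norm h)\<^sup>2" for x h
  proof -
    have "norm (f (x + h) - f x - D x (x + h - x)) \<le> norm (x + h - x) * (K * norm h)"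
    proof (rule differentiable_bound_linearization[of _ _ "cball x (norm h)"])
      show "x + t *\<^sub>R (x + h - x) \<in> cball x (norm h)" if "t \<in> {0..1}" for t
        using that by (auto simp: dist_norm mult_left_le_one_le)
      show "(f has_derivative D z) (at z within cball x (norm h))" for z
        unfolding D_def using smooth_has_derivative[OF test_function_smooth[OF assms]]
        by (rule has_derivative_at_withinI)
      show "x \<in> cball x (norm h)" by simp
      fix z assume z: "z \<in> cball x (norm h)"
      show "onorm (D z - D x) \<le> K * norm h"
      proof (rule onorm_bound)
        fix k :: 'a
        have "norm (\<Sum>b\<in>Basis. (k \<bullet> b) * (partials [b] f z - partials [b] f x))
          \<le> (\<Sum>b\<in>(Basis::'a set). norm k * (\<bar>L b\<bar> * norm h))"
        proof (rule sum_norm_le)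
          fix b :: 'a assume b: "b \<in> Basis"
          have "\<bar>partials [b] f z - partials [b] f x\<bar> \<le> \<bar>L b\<bar> * norm (z - x)"
            using L[OF b, of z x] by (smt (verit) mult_right_mono norm_ge_zero)
          also have "\<dots> \<le> \<bar>L b\<bar> * norm h"
            using z by (intro mult_left_mono) (auto simp: dist_norm norm_minus_commute)
          finally show "norm ((k \<bullet> b) * (partials [b] f z - partials [b] f x)) \<le> norm k * (\<bar>L b\<bar> * norm h)"
            using Basis_le_norm[OF b, of k] unfolding real_norm_def abs_mult
            by (intro mult_mono) auto
        qed
        also have "\<dots> = (\<Sum>b\<in>(Basis::'a set). \<bar>L b\<bar>) * (norm h * norm k)"
          by (simp add: sum_distrib_left sum_distrib_right mult_ac)
        also have "\<dots> \<le> K * (norm h * norm k)"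
          unfolding K_def by (intro mult_right_mono) auto
        finally show "norm ((D z - D x) k) \<le> K * norm h * norm k"
          by (simp add: D_def algebra_simps sum_subtractf)
      qed (use K in simp)
    qed
    then show ?thesis by (simp add: power2_eq_square mult_ac)
  qed
  with K show ?thesis using that unfolding D_def by blast
qed

section \<open>Convolution with probability measures\<close>

lemma test_function_convolve_integrable:
  assumes "test_function f" and "prob_space \<mu>" and "sets \<mu> = sets borel"
  shows "integrable \<mu> (\<lambda>y. f (x - y))"
proof -
  interpret prob_space \<mu> by fact
  obtain B where B: "\<And>x. \<bar>f x\<bar> \<le> B"
    using test_function_bounded[OF assms(1)] by metis
  have [measurable]: "f \<in> borel_measurable borel"
    using assms(1) smooth_borel_measurable test_function_smooth by blast
  note [measurable_cong] = assms(3)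
  show ?thesis
    by (rule integrable_const_bound[where B=B]) (use B in auto)
qed

text \<open>The Taylor remainder is at most \<open>K * (norm h)\<^sup>2\<close> at every base point,
  so integrating it over the base points \<open>x - y\<close> against a probability measure leaves
  the same bound. This justifies differentiating under the integral.\<close>

lemma convolve_has_derivative:
  assumes f: "test_function f" and "prob_space \<mu>" and [measurable_cong]: "sets \<mu> = sets borel"
  shows "(convolve \<mu> f has_derivative (\<lambda>h. \<Sum>b\<in>Basis. (h \<bullet> b) * convolve \<mu> (partials [b] f) x)) (at x)"
proof -
  interpret prob_space \<mu> by fact
  define D where "D = (\<lambda>z h. \<Sum>b\<in>Basis. (h \<bullet> b) * partials [b] f z)"
  obtain K where K: "K > 0" "\<And>x h. \<bar>f (x + h) - f x - D x h\<bar> \<le> K * (norm h)\<^sup>2"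
    using test_function_taylor[OF f] unfolding D_def by metis
  have int: "integrable \<mu> (\<lambda>y. f (x - y))" for x
    using test_function_convolve_integrable assms by blast
  have int_p: "integrable \<mu> (\<lambda>y. partials [b] f (x - y))" if "b \<in> Basis" for b x
    using that by (intro test_function_convolve_integrable test_function_partials assms) auto
  have int_D: "integrable \<mu> (\<lambda>y. D (x - y) h)" for x h
    unfolding D_def by (intro Bochner_Integration.integrable_sum integrable_mult_right int_p)
  define F where "F = (\<lambda>h. \<Sum>b\<in>Basis. (h \<bullet> b) * convolve \<mu> (partials [b] f) x)"
  have F: "F h = (\<integral>y. D (x - y) h \<partial>\<mu>)" for h
    unfolding D_def F_def convolve_def
    by (subst Bochner_Integration.integral_sum) (auto intro!: int_p simp del: partials.simps)
  have main: "\<bar>convolve \<mu> f (x + h) - convolve \<mu> f x - F h\<bar> \<le> K * (norm h)\<^sup>2" for h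
  proof -
    have "convolve \<mu> f (x + h) - convolve \<mu> f x - F h =
      (\<integral>y. f (x + h - y) - f (x - y) - D (x - y) h \<partial>\<mu>)"
      unfolding F convolve_def by (simp add: int int_D)
    also have "\<bar>\<dots>\<bar> \<le> (\<integral>y. \<bar>f (x + h - y) - f (x - y) - D (x - y) h\<bar> \<partial>\<mu>)"
      by (rule integral_abs_bound)
    also have "\<dots> \<le> (\<integral>y. K * (norm h)\<^sup>2 \<partial>\<mu>)"
      by (intro integral_mono integrable_abs Bochner_Integration.integrable_diff int int_D integrable_const)
        (use K(2)[of "x - _" h] in \<open>simp add: algebra_simps\<close>)
    finally show ?thesis by (simp add: prob_space)
  qed
  show ?thesis
    unfolding F_def[symmetric]
  proof (rule has_derivativeI_sandwich[of 1])
    show "bounded_linear F"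
      unfolding F_def by (intro bounded_linear_sum bounded_linear_mult_const bounded_linear_inner_left)
    show "((\<lambda>y. K * norm (y - x)) \<longlongrightarrow> 0) (at x)"
      by (auto intro!: tendsto_eq_intros)
    fix y assume "y \<noteq> x"
    then show "norm (convolve \<mu> f y - convolve \<mu> f x - F (y - x)) / norm (y - x) \<le> K * norm (y - x)"
      using main[of "y - x"] by (simp add: field_simps power2_eq_square)
  qed simp
qed

lemma test_function_convolve:
  assumes f: "test_function f" and \<mu>: "prob_space \<mu>" "sets \<mu> = sets borel"
    and supp: "AE y in \<mu>. norm y \<le> r"
  shows "test_function (convolve \<mu> f)"
proof -
  define P where "P u \<longleftrightarrow> (\<exists>f. test_function f \<and> u = convolve \<mu> f)" for u
  have "P (convolve \<mu> f)" unfolding P_def using f by blast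
  then have "smooth (convolve \<mu> f)"
  proof (rule smooth_coinduct[where P=P])
    fix u x assume "P u"
    then show "u differentiable (at x)"
      unfolding P_def using convolve_has_derivative[OF _ \<mu>] differentiable_def by blast
  next
    fix u and b :: 'a assume "P u" and b: "b \<in> Basis"
    then obtain f where f: "test_function f" "u = convolve \<mu> f"
      unfolding P_def by blast
    have "frechet_derivative u (at x) b = convolve \<mu> (partials [b] f) x" for x
    proof -
      have "frechet_derivative u (at x) b =
          (\<Sum>c\<in>Basis. (b \<bullet> c) * convolve \<mu> (partials [c] f) x)"
        using frechet_derivative_at[OF convolve_has_derivative[OF f(1) \<mu>], symmetric] f(2) by metis
      also have "\<dots> = (\<Sum>c\<in>Basis. if c = b then convolve \<mu> (partials [c] f) x else 0)"
        using b by (intro sum.cong refl) (auto simp: inner_Basis)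
      also have "\<dots> = convolve \<mu> (partials [b] f) x"
        using b by (subst sum.delta) auto
      finally show ?thesis .
    qed
    moreover have "test_function (partials [b] f)"
      using b by (intro test_function_partials f) auto
    ultimately show "P (\<lambda>x. frechet_derivative u (at x) b)"
      unfolding P_def by (auto intro!: exI[of _ "partials [b] f"])
  qed
  moreover obtain R where R: "\<And>x. norm x > R \<Longrightarrow> f x = 0"
    using f unfolding test_function_def by blast
  have "convolve \<mu> f x = 0" if x: "norm x > R + r" for x
  proof -
    have "AE y in \<mu>. f (x - y) = 0"
      using supp
    proof eventually_elim
      case (elim y)
      have "norm x - norm y \<le> norm (x - y)" by (rule norm_triangle_ineq2)
      then show ?case using R[of "x - y"] x elim by linarith
    qed
    then show ?thesis
      unfolding convolve_def by (simp add: integral_eq_zero_AE)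
  qed
  ultimately show ?thesis
    unfolding test_function_def by blast
qed

section \<open>Gaussian tails of mean-square limits\<close>

text \<open>Half of the exponent \<open>x\<^sup>2 / (2 * s\<^sup>2)\<close> is spent on the tail
  factor, using \<open>t \<le> \<bar>x\<bar>\<close>. The other half is the exponent of a Gaussian
  of variance \<open>2 * s\<^sup>2\<close>, whose density integrates to 1.\<close>

lemma centered_gaussian_tail:
  assumes "prob_space M" and X: "centered_gaussian M X"
    and V: "(\<integral>\<omega>. (X \<omega>)\<^sup>2 \<partial>M) \<le> V" and "V > 0" and t: "t > 0"
  shows "measure M {\<omega> \<in> space M. t \<le> \<bar>X \<omega>\<bar>} \<le> 2 * exp (- t\<^sup>2 / (4 * V))"
proof -
  interpret prob_space M by fact
  have [measurable]: "X \<in> borel_measurable M"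
    using X unfolding centered_gaussian_def by blast
  consider "AE \<omega> in M. X \<omega> = 0"
    | s where "s > 0" "distributed M lborel X (\<lambda>x. ennreal (normal_density 0 s x))"
    using X unfolding centered_gaussian_def by blast
  then show ?thesis
  proof cases
    case 1
    then have "AE \<omega> in M. \<not> t \<le> \<bar>X \<omega>\<bar>"
      by eventually_elim (use t in auto)
    then have "measure M {\<omega> \<in> space M. t \<le> \<bar>X \<omega>\<bar>} = 0"
      by (subst prob_eq_0) auto
    then show ?thesis by simp
  next
    case (2 s)
    have "(\<integral>\<omega>. (X \<omega>)\<^sup>2 \<partial>M) = (\<integral>x. normal_density 0 s x * x\<^sup>2 \<partial>lborel)"
      by (rule distributed_integral[OF 2(2), symmetric]) auto
    also have "\<dots> = s\<^sup>2"
      using integral_normal_moment_even[OF 2(1), of 0 1] by simp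
    finally have s2: "s\<^sup>2 \<le> V" using V by simp
    \<comment> \<open>The normalizing constants of the two Gaussians differ by the factor
      \<open>sqrt 2\<close>, which is rounded up to 2 at the end.\<close>
    define s' where "s' = sqrt 2 * s"
    have s': "s' > 0" "s'\<^sup>2 = 2 * s\<^sup>2" using 2(1) by (simp_all add: s'_def power_mult_distrib)
    have density: "normal_density 0 s x \<le> sqrt 2 * exp (- t\<^sup>2 / (4 * s\<^sup>2)) * normal_density 0 s' x"
      if "t \<le> \<bar>x\<bar>" for x
    proof -
      have "t\<^sup>2 \<le> x\<^sup>2" using that t by (metis abs_le_square_iff abs_of_pos)
      then have "t\<^sup>2 / (4 * s\<^sup>2) \<le> x\<^sup>2 / (4 * s\<^sup>2)"
        by (simp add: divide_right_mono)
      then have "exp (- x\<^sup>2 / (2 * s\<^sup>2)) \<le> exp (- t\<^sup>2 / (4 * s\<^sup>2) + (- x\<^sup>2 / (2 * s'\<^sup>2)))"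
        using 2(1) by (simp add: s'(2) field_simps)
      then have "exp (- x\<^sup>2 / (2 * s\<^sup>2)) \<le> exp (- t\<^sup>2 / (4 * s\<^sup>2)) * exp (- x\<^sup>2 / (2 * s'\<^sup>2))"
        by (simp only: exp_add)
      moreover have "1 / sqrt (2 * pi * s\<^sup>2) = sqrt 2 * (1 / sqrt (2 * pi * s'\<^sup>2))"
      proof -
        have "sqrt (2 * pi * s'\<^sup>2) = sqrt 2 * sqrt (2 * pi * s\<^sup>2)"
          unfolding s'(2) by (simp only: real_sqrt_mult mult_ac)
        then show ?thesis by (simp only:) simp
      qed
      ultimately show ?thesis
        unfolding normal_density_def by (simp add: mult_ac divide_right_mono mult_left_mono)
    qed
    have "emeasure M (X -` {x. t \<le> \<bar>x\<bar>} \<inter> space M)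
        = (\<integral>\<^sup>+x. ennreal (normal_density 0 s x) * indicator {x. t \<le> \<bar>x\<bar>} x \<partial>lborel)"
      by (rule distributed_emeasure[OF 2(2)]) measurable
    also have "\<dots> \<le> (\<integral>\<^sup>+x. ennreal (sqrt 2 * exp (- t\<^sup>2 / (4 * s\<^sup>2)) * normal_density 0 s' x) \<partial>lborel)"
      by (intro nn_integral_mono) (use density in \<open>auto split: split_indicator intro!: ennreal_leI\<close>)
    also have "\<dots> = ennreal (sqrt 2 * exp (- t\<^sup>2 / (4 * s\<^sup>2)) * 1)"
      using s'(1) by (subst nn_integral_eq_integral) auto
    also have "X -` {x. t \<le> \<bar>x\<bar>} \<inter> space M = {\<omega> \<in> space M. t \<le> \<bar>X \<omega>\<bar>}"
      by auto
    finally have "measure M {\<omega> \<in> space M. t \<le> \<bar>X \<omega>\<bar>} \<le> sqrt 2 * exp (- t\<^sup>2 / (4 * s\<^sup>2))"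
      by (simp add: emeasure_eq_measure)
    also have "\<dots> \<le> 2 * exp (- t\<^sup>2 / (4 * V))"
    proof (rule mult_mono)
      show "sqrt 2 \<le> (2::real)" using real_sqrt_le_mono[of 2 4] by simp
      show "exp (- t\<^sup>2 / (4 * s\<^sup>2)) \<le> exp (- t\<^sup>2 / (4 * V))"
        using s2 2(1) \<open>V > 0\<close> by (simp add: frac_le)
    qed auto
    finally show ?thesis .
  qed
qed

section \<open>Calculus of mean-square limits\<close>

lemma square_sum_le: "((x::real) + y)\<^sup>2 \<le> 2 * x\<^sup>2 + 2 * y\<^sup>2"
  using zero_le_power2[of "x - y"] by (simp add: power2_eq_square algebra_simps)

lemma square_diff_le: "((x::real) - y)\<^sup>2 \<le> 2 * x\<^sup>2 + 2 * y\<^sup>2"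
  using square_sum_le[of x "- y"] by simp

lemma L2_rv_diff:
  assumes "L2_rv M X" "L2_rv M Y"
  shows "L2_rv M (\<lambda>\<omega>. X \<omega> - Y \<omega>)"
proof -
  have [measurable]: "X \<in> borel_measurable M" "Y \<in> borel_measurable M"
    and "integrable M (\<lambda>\<omega>. (X \<omega>)\<^sup>2)" "integrable M (\<lambda>\<omega>. (Y \<omega>)\<^sup>2)"
    using assms unfolding L2_rv_def by auto
  then have "integrable M (\<lambda>\<omega>. 2 * (X \<omega>)\<^sup>2 + 2 * (Y \<omega>)\<^sup>2)" by simp
  then have "integrable M (\<lambda>\<omega>. (X \<omega> - Y \<omega>)\<^sup>2)"
    by (rule Bochner_Integration.integrable_bound) (use square_diff_le in \<open>auto intro!: AE_I2\<close>)
  then show ?thesis unfolding L2_rv_def by simp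
qed

lemma L2_norm_diff_le:
  assumes "L2_rv M X" "L2_rv M Y"
  shows "(\<integral>\<omega>. (X \<omega> - Y \<omega>)\<^sup>2 \<partial>M) \<le> 2 * (\<integral>\<omega>. (X \<omega>)\<^sup>2 \<partial>M) + 2 * (\<integral>\<omega>. (Y \<omega>)\<^sup>2 \<partial>M)"
proof -
  have i: "integrable M (\<lambda>\<omega>. (X \<omega>)\<^sup>2)" "integrable M (\<lambda>\<omega>. (Y \<omega>)\<^sup>2)"
    "integrable M (\<lambda>\<omega>. (X \<omega> - Y \<omega>)\<^sup>2)"
    using assms L2_rv_diff[OF assms] unfolding L2_rv_def by auto
  have "(\<integral>\<omega>. (X \<omega> - Y \<omega>)\<^sup>2 \<partial>M) \<le> (\<integral>\<omega>. 2 * (X \<omega>)\<^sup>2 + 2 * (Y \<omega>)\<^sup>2 \<partial>M)"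
    by (intro integral_mono) (use i square_diff_le in auto)
  then show ?thesis using i by simp
qed

lemma L2_limit_diff:
  assumes "L2_limit M X Y" "L2_limit M X' Y'"
  shows "L2_limit M (\<lambda>n \<omega>. X n \<omega> - X' n \<omega>) (\<lambda>\<omega>. Y \<omega> - Y' \<omega>)"
  unfolding L2_limit_def
proof (intro conjI allI)
  have a: "L2_rv M (X n)" "L2_rv M (X' n)" "L2_rv M Y" "L2_rv M Y'" for n
    using assms unfolding L2_limit_def by auto
  show "L2_rv M (\<lambda>\<omega>. X n \<omega> - X' n \<omega>)" "L2_rv M (\<lambda>\<omega>. Y \<omega> - Y' \<omega>)" for n
    by (intro L2_rv_diff a)+
  have "(\<lambda>n. 2 * (\<integral>\<omega>. (X n \<omega> - Y \<omega>)\<^sup>2 \<partial>M) + 2 * (\<integral>\<omega>. (X' n \<omega> - Y' \<omega>)\<^sup>2 \<partial>M)) \<longlonglongrightarrow> 2 * 0 + 2 * 0"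
    using assms unfolding L2_limit_def by (intro tendsto_intros) auto
  then have lim: "(\<lambda>n. 2 * (\<integral>\<omega>. (X n \<omega> - Y \<omega>)\<^sup>2 \<partial>M) + 2 * (\<integral>\<omega>. (X' n \<omega> - Y' \<omega>)\<^sup>2 \<partial>M)) \<longlonglongrightarrow> 0"
    by simp
  show "(\<lambda>n. \<integral>\<omega>. (X n \<omega> - X' n \<omega> - (Y \<omega> - Y' \<omega>))\<^sup>2 \<partial>M) \<longlonglongrightarrow> 0"
  proof (rule tendsto_sandwich[OF _ _ tendsto_const lim])
    have "(\<integral>\<omega>. (X n \<omega> - X' n \<omega> - (Y \<omega> - Y' \<omega>))\<^sup>2 \<partial>M)
      \<le> 2 * (\<integral>\<omega>. (X n \<omega> - Y \<omega>)\<^sup>2 \<partial>M) + 2 * (\<integral>\<omega>. (X' n \<omega> - Y' \<omega>)\<^sup>2 \<partial>M)" for n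
      using L2_norm_diff_le[OF L2_rv_diff[OF a(1) a(3)] L2_rv_diff[OF a(2) a(4)], of n n]
      by (simp add: algebra_simps)
    then show "\<forall>\<^sub>F n in sequentially. (\<integral>\<omega>. (X n \<omega> - X' n \<omega> - (Y \<omega> - Y' \<omega>))\<^sup>2 \<partial>M)
      \<le> 2 * (\<integral>\<omega>. (X n \<omega> - Y \<omega>)\<^sup>2 \<partial>M) + 2 * (\<integral>\<omega>. (X' n \<omega> - Y' \<omega>)\<^sup>2 \<partial>M)"
      by simp
  qed simp
qed

text \<open>The factor 2 is the price of splitting \<open>Y\<close> as
  \<open>X n - (X n - Y)\<close> and bounding the square of a difference crudely; the second term
  tends to 0.\<close>

lemma L2_limit_norm_le:
  assumes "L2_limit M X Y" and "\<forall>\<^sub>F n in sequentially. (\<integral>\<omega>. (X n \<omega>)\<^sup>2 \<partial>M) \<le> V"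
  shows "(\<integral>\<omega>. (Y \<omega>)\<^sup>2 \<partial>M) \<le> 2 * V"
proof -
  have a: "L2_rv M (X n)" "L2_rv M Y" for n
    using assms unfolding L2_limit_def by auto
  have "(\<lambda>n. 2 * V + 2 * (\<integral>\<omega>. (X n \<omega> - Y \<omega>)\<^sup>2 \<partial>M)) \<longlonglongrightarrow> 2 * V + 2 * 0"
    using assms unfolding L2_limit_def by (intro tendsto_intros) auto
  moreover have "\<forall>\<^sub>F n in sequentially. (\<integral>\<omega>. (Y \<omega>)\<^sup>2 \<partial>M) \<le> 2 * V + 2 * (\<integral>\<omega>. (X n \<omega> - Y \<omega>)\<^sup>2 \<partial>M)"
    using assms(2)
  proof eventually_elim
    case (elim n)
    then show ?case
      using L2_norm_diff_le[OF a(1) L2_rv_diff[OF a(1) a(2)], of n n] by simp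
  qed
  ultimately show ?thesis
    using tendsto_lowerbound by fastforce
qed

lemma L2_limit_unique:
  assumes "L2_limit M X Y" "L2_limit M X Y'"
  shows "AE \<omega> in M. Y \<omega> = Y' \<omega>"
proof -
  \<comment> \<open>The approximating differences vanish identically, so the convergence says that a
    constant sequence tends to 0.\<close>
  have "L2_limit M (\<lambda>n \<omega>. X n \<omega> - X n \<omega>) (\<lambda>\<omega>. Y \<omega> - Y' \<omega>)"
    by (rule L2_limit_diff[OF assms])
  then have "(\<lambda>n. \<integral>\<omega>. (Y \<omega> - Y' \<omega>)\<^sup>2 \<partial>M) \<longlonglongrightarrow> 0" "integrable M (\<lambda>\<omega>. (Y \<omega> - Y' \<omega>)\<^sup>2)"
    unfolding L2_limit_def L2_rv_def by (auto simp: power2_commute)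
  then have "AE \<omega> in M. (Y \<omega> - Y' \<omega>)\<^sup>2 = 0"
    by (subst (asm) LIMSEQ_const_iff) (simp add: integral_nonneg_eq_0_iff_AE)
  then show ?thesis by simp
qed

text \<open>If \<open>Y\<close> is at least \<open>t\<close> in absolute value, then
  \<open>X n\<close> or \<open>X n - Y\<close> is at least \<open>t / 2\<close>. The first event has
  a Gaussian tail, the second a Chebyshev bound that vanishes as n grows. The constant is 64 = 4 * 4
  * 4: one factor from halving \<open>t\<close>, one from the variance bound \<open>4 * V\<close>
  for \<open>X n\<close>, one from \<open>centered_gaussian_tail\<close>.\<close>

lemma L2_limit_gaussian_tail:
  assumes M: "prob_space M" and lim: "L2_limit M X Y" and X: "\<And>n. centered_gaussian M (X n)"
    and V: "(\<integral>\<omega>. (Y \<omega>)\<^sup>2 \<partial>M) \<le> V" "V > 0" and t: "t > 0"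
  shows "measure M {\<omega> \<in> space M. t \<le> \<bar>Y \<omega>\<bar>} \<le> 2 * exp (- t\<^sup>2 / (64 * V))"
proof -
  interpret prob_space M by fact
  have a: "L2_rv M (X n)" "L2_rv M Y" for n
    using lim unfolding L2_limit_def by auto
  have [measurable]: "X n \<in> borel_measurable M" "Y \<in> borel_measurable M" for n
    using a unfolding L2_rv_def by auto
  define e where "e n = (\<integral>\<omega>. (X n \<omega> - Y \<omega>)\<^sup>2 \<partial>M)" for n
  have e: "e \<longlonglongrightarrow> 0"
    using lim unfolding L2_limit_def e_def by auto
  then have ev: "\<forall>\<^sub>F n in sequentially. e n < V"
    using V(2) order_tendstoD(2) by blast
  have "(\<lambda>n. 2 * exp (- t\<^sup>2 / (64 * V)) + e n / (t / 2)\<^sup>2) \<longlonglongrightarrow> 2 * exp (- t\<^sup>2 / (64 * V)) + 0 / (t / 2)\<^sup>2"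
    using t by (intro tendsto_intros e) auto
  moreover have "\<forall>\<^sub>F n in sequentially. measure M {\<omega> \<in> space M. t \<le> \<bar>Y \<omega>\<bar>}
      \<le> 2 * exp (- t\<^sup>2 / (64 * V)) + e n / (t / 2)\<^sup>2"
    using ev
  proof eventually_elim
    case (elim n)
    have "(\<integral>\<omega>. (X n \<omega>)\<^sup>2 \<partial>M) = (\<integral>\<omega>. (X n \<omega> - Y \<omega> - (- Y \<omega>))\<^sup>2 \<partial>M)"
      by simp
    also have "\<dots> \<le> 2 * e n + 2 * (\<integral>\<omega>. (- Y \<omega>)\<^sup>2 \<partial>M)"
      unfolding e_def using a(2)
      by (intro L2_norm_diff_le L2_rv_diff a) (auto simp: L2_rv_def)
    finally have "(\<integral>\<omega>. (X n \<omega>)\<^sup>2 \<partial>M) \<le> 4 * V"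
      using V elim by simp
    then have "measure M {\<omega> \<in> space M. t / 2 \<le> \<bar>X n \<omega>\<bar>} \<le> 2 * exp (- (t / 2)\<^sup>2 / (4 * (4 * V)))"
      using V t by (intro centered_gaussian_tail M X) auto
    also have "- (t / 2)\<^sup>2 / (4 * (4 * V)) = - t\<^sup>2 / (64 * V)"
      by (simp add: power2_eq_square)
    finally have 1: "measure M {\<omega> \<in> space M. t / 2 \<le> \<bar>X n \<omega>\<bar>} \<le> 2 * exp (- t\<^sup>2 / (64 * V))" .
    have "integrable M (\<lambda>\<omega>. (X n \<omega> - Y \<omega>)\<^sup>2)"
      using L2_rv_diff[OF a, of n] unfolding L2_rv_def by blast
    then have "measure M {\<omega> \<in> space M. t / 2 \<le> \<bar>X n \<omega> - Y \<omega>\<bar>} \<le> e n / (t / 2)\<^sup>2"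
      unfolding e_def using t by (intro second_moment_method) auto
    moreover have "measure M {\<omega> \<in> space M. t \<le> \<bar>Y \<omega>\<bar>}
      \<le> measure M ({\<omega> \<in> space M. t / 2 \<le> \<bar>X n \<omega>\<bar>} \<union> {\<omega> \<in> space M. t / 2 \<le> \<bar>X n \<omega> - Y \<omega>\<bar>})"
    proof (intro finite_measure_mono subsetI)
      fix \<omega> assume "\<omega> \<in> {\<omega> \<in> space M. t \<le> \<bar>Y \<omega>\<bar>}"
      moreover from this have "t / 2 \<le> \<bar>X n \<omega>\<bar> \<or> t / 2 \<le> \<bar>X n \<omega> - Y \<omega>\<bar>" by (smt (verit) field_sum_of_halves mem_Collect_eq)
      ultimately show "\<omega> \<in> {\<omega> \<in> space M. t / 2 \<le> \<bar>X n \<omega>\<bar>} \<union> {\<omega> \<in> space M. t / 2 \<le> \<bar>X n \<omega> - Y \<omega>\<bar>}"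
        by simp
    qed measurable
    moreover have "\<dots> \<le> measure M {\<omega> \<in> space M. t / 2 \<le> \<bar>X n \<omega>\<bar>}
        + measure M {\<omega> \<in> space M. t / 2 \<le> \<bar>X n \<omega> - Y \<omega>\<bar>}"
      by (intro measure_Un_le) auto
    ultimately show ?case using 1 by linarith
  qed
  ultimately show ?thesis
    using tendsto_lowerbound by fastforce
qed

section \<open>Chaining on the unit cube\<close>

definition dyadic_floor :: "nat \<Rightarrow> 'e::euclidean_space \<Rightarrow> 'e" where
  "dyadic_floor k x = (\<Sum>b\<in>Basis. (of_int \<lfloor>2 ^ k * (x \<bullet> b)\<rfloor> / 2 ^ k) *\<^sub>R b)"

text \<open>The upper faces of the cube are included, whence \<open>2 ^ k + 1\<close> values per
  coordinate in the count below. Rounding down keeps the net inside the cube, the only place where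
  the process is controlled.\<close>

definition dyadic_net :: "nat \<Rightarrow> 'e::euclidean_space set" where
  "dyadic_net k = dyadic_floor k ` cbox 0 One"

lemma dyadic_floor_inner:
  "b \<in> Basis \<Longrightarrow> dyadic_floor k x \<bullet> b = of_int \<lfloor>2 ^ k * (x \<bullet> b)\<rfloor> / 2 ^ k"
  unfolding dyadic_floor_def by simp

lemma dyadic_floor_in_cbox:
  assumes "x \<in> cbox 0 One"
  shows "dyadic_floor k x \<in> cbox 0 (One::'e::euclidean_space)"
  unfolding mem_box
proof
  fix b :: 'e assume b: "b \<in> Basis"
  then have x: "0 \<le> x \<bullet> b" "x \<bullet> b \<le> 1"
    using assms by (auto simp: mem_box)
  then have "of_int \<lfloor>2 ^ k * (x \<bullet> b)\<rfloor> \<le> (2::real) ^ k * (x \<bullet> b)" by simp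
  also have "\<dots> \<le> 2 ^ k * 1" using x by (intro mult_left_mono) auto
  finally show "0 \<bullet> b \<le> dyadic_floor k x \<bullet> b \<and> dyadic_floor k x \<bullet> b \<le> One \<bullet> b"
    using b x by (simp add: dyadic_floor_inner)
qed

lemma dyadic_net_subset: "dyadic_net k \<subseteq> cbox 0 One"
  unfolding dyadic_net_def using dyadic_floor_in_cbox by blast

lemma dist_dyadic_floor: "dist x (dyadic_floor k x) \<le> DIM('e) / 2 ^ k"
  for x :: "'e::euclidean_space"
proof -
  have "dist x (dyadic_floor k x) \<le> (\<Sum>b\<in>(Basis::'e set). \<bar>(x - dyadic_floor k x) \<bullet> b\<bar>)"
    unfolding dist_norm by (rule norm_le_l1)
  also have "\<dots> \<le> (\<Sum>b\<in>(Basis::'e set). 1 / 2 ^ k)"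
  proof (rule sum_mono)
    fix b :: 'e assume b: "b \<in> Basis"
    have "\<bar>2 ^ k * (x \<bullet> b) - of_int \<lfloor>2 ^ k * (x \<bullet> b)\<rfloor>\<bar> \<le> 1" by linarith
    then have "\<bar>2 ^ k * (x \<bullet> b) - of_int \<lfloor>2 ^ k * (x \<bullet> b)\<rfloor>\<bar> / 2 ^ k \<le> 1 / 2 ^ k"
      by (intro divide_right_mono) auto
    also have "\<bar>2 ^ k * (x \<bullet> b) - of_int \<lfloor>2 ^ k * (x \<bullet> b)\<rfloor>\<bar> / 2 ^ k
        = \<bar>(2 ^ k * (x \<bullet> b) - of_int \<lfloor>2 ^ k * (x \<bullet> b)\<rfloor>) / 2 ^ k\<bar>" by simp
    also have "\<dots> = \<bar>(x - dyadic_floor k x) \<bullet> b\<bar>"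
      using b by (simp add: dyadic_floor_inner inner_diff_left diff_divide_distrib)
    finally show "\<bar>(x - dyadic_floor k x) \<bullet> b\<bar> \<le> 1 / 2 ^ k" .
  qed
  finally show ?thesis by simp
qed

lemma dyadic_floor_tendsto: "(\<lambda>k. dyadic_floor k x) \<longlonglongrightarrow> x" for x :: "'e::euclidean_space"
proof -
  have "(\<lambda>k. real DIM('e) / 2 ^ k) \<longlonglongrightarrow> 0"
    by (intro LIMSEQ_divide_realpow_zero) simp
  then show ?thesis
    by (subst tendsto_dist_iff, elim Lim_null_comparison[rotated])
      (use dist_dyadic_floor[of x] in \<open>auto simp: dist_commute\<close>)
qed

lemma dyadic_net_finite_card:
  "finite (dyadic_net k :: 'e::euclidean_space set) \<and>
   card (dyadic_net k :: 'e set) \<le> (2 ^ k + 1) ^ DIM('e)"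
proof -
  let ?F = "PiE (Basis :: 'e set) (\<lambda>_. {0..2 ^ k :: nat})"
  let ?p = "\<lambda>g. \<Sum>b\<in>(Basis :: 'e set). (real (g b) / 2 ^ k) *\<^sub>R b"
  have "dyadic_net k \<subseteq> ?p ` ?F"
  proof
    fix y :: 'e assume "y \<in> dyadic_net k"
    then obtain x where x: "x \<in> cbox 0 One" "y = dyadic_floor k x"
      unfolding dyadic_net_def by blast
    define g where "g = restrict (\<lambda>b. nat \<lfloor>2 ^ k * (x \<bullet> b)\<rfloor>) Basis"
    have box: "0 \<le> x \<bullet> b" "x \<bullet> b \<le> 1" if "b \<in> Basis" for b
      using x(1) that by (auto simp: mem_box)
    have "nat \<lfloor>2 ^ k * (x \<bullet> b)\<rfloor> \<le> 2 ^ k" if "b \<in> Basis" for b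
    proof -
      have "2 ^ k * (x \<bullet> b) \<le> 2 ^ k * 1" by (intro mult_left_mono box that) auto
      then have "\<lfloor>2 ^ k * (x \<bullet> b)\<rfloor> \<le> \<lfloor>real_of_int (2 ^ k)\<rfloor>"
        by (intro floor_mono) simp
      then have "\<lfloor>2 ^ k * (x \<bullet> b)\<rfloor> \<le> 2 ^ k"
        unfolding floor_of_int .
      then show ?thesis by simp
    qed
    then have "g \<in> ?F" unfolding g_def by auto
    moreover have "y = ?p g"
      unfolding x(2) dyadic_floor_def g_def using box by (intro sum.cong refl) simp
    ultimately show "y \<in> ?p ` ?F" by blast
  qed
  moreover have F: "finite ?F" by (intro finite_PiE) auto
  moreover have "card ?F = (2 ^ k + 1) ^ DIM('e)"
    by (subst card_PiE) auto
  ultimately show ?thesis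
    by (metis (no_types, lifting) card_image_le card_mono finite_imageI finite_subset le_trans)
qed

text \<open>The doubly exponential tail beats the exponential number of pairs in the chaining argument.\<close>

lemma summable_chaining_weights:
  fixes e Q :: real
  assumes "e > 0" "Q > 1"
  shows "summable (\<lambda>k. (2 ^ k + 1) ^ D * (2 ^ Suc k + 1) ^ D * exp (- e * Q ^ k))"
proof -
  \<comment> \<open>A single term of the exponential series, the one of order \<open>m\<close>,
    already decays like the power \<open>- m\<close> of \<open>Q ^ k\<close>; this choice of
    \<open>m\<close> makes it beat the growth \<open>4 ^ D\<close> per level.\<close>
  obtain m where m: "4 ^ D < Q ^ m" using real_arch_pow[OF assms(2)] by blast
  let ?C = "8 ^ D * (fact m / e ^ m) :: real"
  have "summable (\<lambda>k. ?C * (4 ^ D / Q ^ m) ^ k)"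
    using m assms by (intro summable_mult summable_geometric) simp
  then show ?thesis
  proof (rule summable_comparison_test'[where N=0])
    fix k :: nat
    have "1 \<le> (2::real) ^ k" by simp
    then have "(2 ^ k + 1 :: real) ^ D * (2 ^ Suc k + 1) ^ D \<le> (2 * 2 ^ k) ^ D * (4 * 2 ^ k) ^ D"
      unfolding power_Suc by (intro mult_mono power_mono zero_le_power) linarith+
    also have "\<dots> = 8 ^ D * (4 ^ D) ^ k"
    proof -
      have "(2 * 2 ^ k) ^ D * (4 * 2 ^ k) ^ D = ((2 * 2 ^ k) * (4 * 2 ^ k) :: real) ^ D"
        by (simp only: power_mult_distrib)
      also have "(2 * 2 ^ k) * (4 * 2 ^ k) = (8 * 4 ^ k :: real)"
        by (simp flip: power_mult_distrib)
      also have "(8 * 4 ^ k :: real) ^ D = 8 ^ D * (4 ^ D) ^ k"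
        by (simp add: power_mult_distrib mult.commute flip: power_mult)
      finally show ?thesis .
    qed
    finally have 1: "(2 ^ k + 1 :: real) ^ D * (2 ^ Suc k + 1) ^ D \<le> 8 ^ D * (4 ^ D) ^ k" .
    have y: "e * Q ^ k > 0" using assms by simp
    have "(e * Q ^ k) ^ m / fact m \<le> exp (e * Q ^ k)"
    proof -
      have "(e * Q ^ k) ^ m / fact m \<le> (\<Sum>n. inverse (fact n) * (e * Q ^ k) ^ n)"
        using sum_le_suminf[of "\<lambda>n. inverse (fact n) * (e * Q ^ k) ^ n" "{m}"] y
          summable_exp[of "e * Q ^ k"] by (simp add: divide_inverse mult.commute)
      then show ?thesis by (simp add: exp_def)
    qed
    then have "inverse (exp (e * Q ^ k)) \<le> inverse ((e * Q ^ k) ^ m / fact m)"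
      by (rule le_imp_inverse_le) (use y in simp)
    then have "exp (- e * Q ^ k) \<le> fact m / (e * Q ^ k) ^ m"
      by (simp add: exp_minus)
    also have "\<dots> = (fact m / e ^ m) * (1 / Q ^ m) ^ k"
      by (simp add: power_mult_distrib power_divide mult.commute flip: power_mult)
    finally have 2: "exp (- e * Q ^ k) \<le> (fact m / e ^ m) * (1 / Q ^ m) ^ k" .
    have "(2 ^ k + 1) ^ D * (2 ^ Suc k + 1) ^ D * exp (- e * Q ^ k)
        \<le> (8 ^ D * (4 ^ D) ^ k) * ((fact m / e ^ m) * (1 / Q ^ m) ^ k)"
      by (intro mult_mono 1 2) auto
    also have "\<dots> = ?C * (4 ^ D / Q ^ m) ^ k"
      by (simp add: power_divide)
    finally show "norm ((2 ^ k + 1) ^ D * (2 ^ Suc k + 1) ^ D * exp (- e * Q ^ k)) \<le> ?C * (4 ^ D / Q ^ m) ^ k"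
      by (simp add: abs_mult)
  qed
qed

text \<open>The constants are obtained before \<open>Y\<close> and \<open>t\<close> are named,
  because the lemma is applied to infinitely many cells with the same constants. The hypotheses
  speak only of points of the cube, since outside it the scale of a cell would leave its admissible
  range. The increment allowed at level \<open>k\<close> is \<open>t * q ^ k\<close>: summable in
  \<open>k\<close>, yet large compared with the typical increment at distance
  \<open>1 / 2 ^ k\<close>.\<close>

lemma (in prob_space) chaining_tail:
  fixes A c p :: real
  assumes "A \<ge> 0" "c > 0" "p > 0"
  obtains K b S where "K \<ge> 0" "b > 0" "S > 0"
    "\<And>(Y :: 'e::euclidean_space \<Rightarrow> 'a \<Rightarrow> real) t. t \<ge> 1 \<Longrightarrow>
      (\<And>x. x \<in> cbox 0 One \<Longrightarrow> Y x \<in> borel_measurable M) \<Longrightarrow>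
      (\<And>x u. x \<in> cbox 0 One \<Longrightarrow> u > 0 \<Longrightarrow>
         prob {\<omega> \<in> space M. u \<le> \<bar>Y x \<omega>\<bar>} \<le> A * exp (- c * u\<^sup>2)) \<Longrightarrow>
      (\<And>x y u r. x \<in> cbox 0 One \<Longrightarrow> y \<in> cbox 0 One \<Longrightarrow> u > 0 \<Longrightarrow> r > 0 \<Longrightarrow> dist x y \<le> r \<Longrightarrow>
         prob {\<omega> \<in> space M. u \<le> \<bar>Y x \<omega> - Y y \<omega>\<bar>} \<le> A * exp (- c * u\<^sup>2 / r powr p)) \<Longrightarrow>
      \<exists>B\<in>events. prob B \<le> K * exp (- b * t\<^sup>2) \<and>
        (\<forall>\<omega>\<in>space M - B. continuous_on (cbox 0 One) (\<lambda>x. Y x \<omega>) \<longrightarrow>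
           (\<forall>x\<in>cbox 0 One. \<bar>Y x \<omega>\<bar> \<le> S * t))"
proof -
  define D where "D = DIM('e)"
  \<comment> \<open>The approximations of a point at levels \<open>k\<close> and
    \<open>k + 1\<close> are both within \<open>D / 2 ^ k\<close> of it, hence within
    \<open>R / 2 ^ k\<close> of each other.\<close>
  define R where "R = 2 * real D"
  \<comment> \<open>With this choice \<open>(1 / 2 ^ k) powr p = q ^ (4 * k)\<close>, while the
    squared threshold carries only \<open>q ^ (2 * k)\<close>. The quotient is \<open>Q ^ k\<close>,
    which grows.\<close>
  define q where "q = 2 powr (- p / 4)"
  define Q where "Q = 1 / q\<^sup>2"
  define c' where "c' = c / R powr p"
  define a where "a k = (2 ^ k + 1) ^ D * (2 ^ Suc k + 1) ^ D * exp (- (c' / 2) * Q ^ k)" for k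
  define K where "K = A * (2 ^ D + suminf a)"
  define b where "b = min c (c' / 2)"
  \<comment> \<open>One unit of \<open>t\<close> for the coarsest net and the geometric series of
    the \<open>q ^ k\<close> for the increments.\<close>
  define S where "S = 1 + 1 / (1 - q)"
  have "D > 0" unfolding D_def by simp
  then have R: "R > 0" unfolding R_def by simp
  have q: "0 < q" "q < 1"
    using assms(3) unfolding q_def by (auto intro: powr_less_one)
  have Q: "Q > 1"
    using q unfolding Q_def by (simp add: power_less_one_iff)
  have c': "c' > 0" unfolding c'_def using assms R by simp
  have a: "summable a" "\<And>k. a k \<ge> 0"
    using summable_chaining_weights[of "c' / 2" Q D] c' Q unfolding a_def by auto
  have scale: "(R / 2 ^ k) powr p = R powr p * q ^ (4 * k)" for k
  proof -
    have "(1 / 2 ^ k :: real) powr p = q ^ (4 * k)"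
      unfolding q_def by (simp add: powr_realpow[symmetric] powr_powr powr_minus_divide[symmetric] mult.commute)
    then show ?thesis
      using R powr_mult[of R "1 / 2 ^ k" p] by simp
  qed
  have expo: "exp (- c * (t * q ^ k)\<^sup>2 / (R / 2 ^ k) powr p) \<le> exp (- (c' / 2) * t\<^sup>2) * exp (- (c' / 2) * Q ^ k)"
    if "t \<ge> 1" for t k
  proof -
    have "c * (t * q ^ k)\<^sup>2 / (R / 2 ^ k) powr p = c' * (t\<^sup>2 * Q ^ k)"
    proof -
      have "(q ^ k)\<^sup>2 / q ^ (4 * k) = Q ^ k"
      proof -
        have "q ^ (4 * k) = (q ^ k)\<^sup>2 * (q\<^sup>2) ^ k"
          by (simp flip: power_mult power_add add: mult.commute)
        then show ?thesis using q by (simp add: Q_def power_divide)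
      qed
      then have "(q ^ k)\<^sup>2 = Q ^ k * q ^ (4 * k)" using q by (simp add: field_simps)
      then show ?thesis
        unfolding scale c'_def using q R by (simp add: power_mult_distrib)
    qed
    \<comment> \<open>Both \<open>t\<^sup>2\<close> and \<open>Q ^ k\<close> are at least 1, so
      their product dominates their mean. This separates \<open>t\<close> from \<open>k\<close>: one
      half of the exponent pays for the sum over levels, the other half remains as the Gaussian tail
      in \<open>t\<close>.\<close>
    moreover have "t\<^sup>2 / 2 + Q ^ k / 2 \<le> t\<^sup>2 * Q ^ k"
    proof -
      have "0 \<le> (t\<^sup>2 - 1) * Q ^ k" "0 \<le> (Q ^ k - 1) * t\<^sup>2"
        using that Q by (auto intro!: mult_nonneg_nonneg)
      then show ?thesis by (simp add: algebra_simps)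
    qed
    then have "c' * (t\<^sup>2 / 2 + Q ^ k / 2) \<le> c' * (t\<^sup>2 * Q ^ k)"
      using c' by (intro mult_left_mono) auto
    ultimately show ?thesis
      by (simp flip: exp_add add: algebra_simps)
  qed
  have "K \<ge> 0" unfolding K_def using assms a by (intro mult_nonneg_nonneg add_nonneg_nonneg suminf_nonneg) auto
  moreover have "b > 0" unfolding b_def using assms c' by simp
  moreover have "S > 0" unfolding S_def using q by (simp add: add_pos_nonneg)
  moreover
  {
    fix Y :: "'e \<Rightarrow> 'a \<Rightarrow> real" and t :: real
    assume t: "t \<ge> 1"
      and meas: "\<And>x. x \<in> cbox 0 One \<Longrightarrow> Y x \<in> borel_measurable M"
      and tail: "\<And>x u. x \<in> cbox 0 One \<Longrightarrow> u > 0 \<Longrightarrow>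
         prob {\<omega> \<in> space M. u \<le> \<bar>Y x \<omega>\<bar>} \<le> A * exp (- c * u\<^sup>2)"
      and incr: "\<And>x y u r. x \<in> cbox 0 One \<Longrightarrow> y \<in> cbox 0 One \<Longrightarrow> u > 0 \<Longrightarrow> r > 0 \<Longrightarrow> dist x y \<le> r \<Longrightarrow>
         prob {\<omega> \<in> space M. u \<le> \<bar>Y x \<omega> - Y y \<omega>\<bar>} \<le> A * exp (- c * u\<^sup>2 / r powr p)"
    define B0 where "B0 = (\<Union>x\<in>dyadic_net 0. {\<omega> \<in> space M. t \<le> \<bar>Y x \<omega>\<bar>})"
    define P where "P k = {(x :: 'e, y). x \<in> dyadic_net k \<and> y \<in> dyadic_net (Suc k) \<and> dist x y \<le> R / 2 ^ k}" for k
    define E where "E k = (\<lambda>(x, y). {\<omega> \<in> space M. t * q ^ k \<le> \<bar>Y x \<omega> - Y y \<omega>\<bar>})" for k :: nat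
    define B1 where "B1 k = (\<Union>xy\<in>P k. E k xy)" for k
    have net: "x \<in> dyadic_net k \<Longrightarrow> x \<in> cbox 0 One" for x :: 'e and k
      using dyadic_net_subset by blast
    have fin: "finite (dyadic_net k :: 'e set)" "card (dyadic_net k :: 'e set) \<le> (2 ^ k + 1) ^ D" for k
      using dyadic_net_finite_card[of k, where 'e='e] unfolding D_def by auto
    have finP: "finite (P k)" for k
      unfolding P_def by (rule finite_subset[of _ "dyadic_net k \<times> dyadic_net (Suc k)"]) (auto simp: fin)
    have cardP: "real (card (P k)) \<le> (2 ^ k + 1) ^ D * (2 ^ Suc k + 1) ^ D" for k
    proof -
      have "card (P k) \<le> card ((dyadic_net k :: 'e set) \<times> (dyadic_net (Suc k) :: 'e set))"
        unfolding P_def by (intro card_mono) (auto simp: fin)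
      also have "\<dots> \<le> (2 ^ k + 1) ^ D * (2 ^ Suc k + 1) ^ D"
        unfolding card_cartesian_product by (intro mult_mono fin) auto
      finally show ?thesis
        by (metis (mono_tags, lifting) of_nat_1 of_nat_add of_nat_le_iff of_nat_mult of_nat_numeral of_nat_power)
    qed
    have evE: "E k xy \<in> events" if "xy \<in> P k" for k xy
    proof -
      have "fst xy \<in> cbox 0 One" "snd xy \<in> cbox 0 One" using that net unfolding P_def by auto
      note [measurable] = meas[OF this(1)] meas[OF this(2)]
      show ?thesis unfolding E_def split_beta by measurable
    qed
    have ev0: "{\<omega> \<in> space M. t \<le> \<bar>Y x \<omega>\<bar>} \<in> events" if "x \<in> dyadic_net 0" for x
    proof -
      note [measurable] = meas[OF net[OF that]]
      show ?thesis by measurable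
    qed
    have evB1: "B1 k \<in> events" for k
      unfolding B1_def using finP evE by (intro sets.finite_UN) auto
    have evB0: "B0 \<in> events"
      unfolding B0_def using fin ev0 by (intro sets.finite_UN) auto
    have probB0: "prob B0 \<le> 2 ^ D * (A * exp (- c * t\<^sup>2))"
    proof -
      have "prob B0 \<le> (\<Sum>x\<in>dyadic_net 0. prob {\<omega> \<in> space M. t \<le> \<bar>Y x \<omega>\<bar>})"
        unfolding B0_def by (intro finite_measure_subadditive_finite fin) (use ev0 in auto)
      also have "\<dots> \<le> (\<Sum>x\<in>(dyadic_net 0 :: 'e set). A * exp (- c * t\<^sup>2))"
        using t by (intro sum_mono tail net) auto
      also have "\<dots> = real (card (dyadic_net 0 :: 'e set)) * (A * exp (- c * t\<^sup>2))" by simp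
      also have "\<dots> \<le> 2 ^ D * (A * exp (- c * t\<^sup>2))"
      proof (intro mult_right_mono)
        have "card (dyadic_net 0 :: 'e set) \<le> 2 ^ D" using fin(2)[of 0] by (simp add: numeral_2_eq_2)
        then show "real (card (dyadic_net 0 :: 'e set)) \<le> 2 ^ D"
          by (metis of_nat_le_iff of_nat_numeral of_nat_power)
      qed (use assms in simp)
      finally show ?thesis .
    qed
    have probB1: "prob (B1 k) \<le> A * exp (- (c' / 2) * t\<^sup>2) * a k" for k
    proof -
      have "prob (B1 k) \<le> (\<Sum>xy\<in>P k. prob (E k xy))"
        unfolding B1_def by (intro finite_measure_subadditive_finite finP) (use evE in auto)
      also have "\<dots> \<le> (\<Sum>xy\<in>P k. A * (exp (- (c' / 2) * t\<^sup>2) * exp (- (c' / 2) * Q ^ k)))"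
      proof (rule sum_mono)
        fix xy assume xy: "xy \<in> P k"
        have "prob (E k xy) \<le> A * exp (- c * (t * q ^ k)\<^sup>2 / (R / 2 ^ k) powr p)"
          unfolding E_def split_beta using xy t q R
          by (intro incr) (auto simp: P_def intro: net)
        also have "\<dots> \<le> A * (exp (- (c' / 2) * t\<^sup>2) * exp (- (c' / 2) * Q ^ k))"
          by (intro mult_left_mono expo t assms)
        finally show "prob (E k xy) \<le> A * (exp (- (c' / 2) * t\<^sup>2) * exp (- (c' / 2) * Q ^ k))" .
      qed
      also have "\<dots> = real (card (P k)) * (A * (exp (- (c' / 2) * t\<^sup>2) * exp (- (c' / 2) * Q ^ k)))"
        by simp
      also have "\<dots> \<le> ((2 ^ k + 1) ^ D * (2 ^ Suc k + 1) ^ D) * (A * (exp (- (c' / 2) * t\<^sup>2) * exp (- (c' / 2) * Q ^ k)))"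
        using assms by (intro mult_right_mono cardP) auto
      finally show ?thesis unfolding a_def by (simp add: mult_ac)
    qed
    have sumB1: "summable (\<lambda>k. A * exp (- (c' / 2) * t\<^sup>2) * a k)"
      by (intro summable_mult a)
    have sumB1': "summable (\<lambda>k. prob (B1 k))"
      by (rule summable_comparison_test'[OF sumB1]) (use probB1 in auto)
    have "b * t\<^sup>2 \<le> c * t\<^sup>2" "b * t\<^sup>2 \<le> c' / 2 * t\<^sup>2"
      unfolding b_def by (intro mult_right_mono; simp)+
    then have b_le: "exp (- c * t\<^sup>2) \<le> exp (- b * t\<^sup>2)" "exp (- (c' / 2) * t\<^sup>2) \<le> exp (- b * t\<^sup>2)"
      by simp_all
    define B where "B = B0 \<union> (\<Union>k. B1 k)"
    have "B \<in> events" unfolding B_def using evB0 evB1 by auto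
    moreover have "prob B \<le> K * exp (- b * t\<^sup>2)"
    proof -
      have "prob B \<le> prob B0 + prob (\<Union>k. B1 k)"
        unfolding B_def using evB0 evB1 by (intro measure_Un_le) auto
      also have "prob (\<Union>k. B1 k) \<le> (\<Sum>k. prob (B1 k))"
        using evB1 by (intro finite_measure_subadditive_countably sumB1') auto
      also have "\<dots> \<le> (\<Sum>k. A * exp (- (c' / 2) * t\<^sup>2) * a k)"
        by (intro suminf_le sumB1 sumB1' probB1)
      also have "\<dots> = A * exp (- (c' / 2) * t\<^sup>2) * suminf a"
        by (intro suminf_mult a)
      also have "\<dots> \<le> A * exp (- b * t\<^sup>2) * suminf a"
        using assms a by (intro mult_right_mono mult_left_mono suminf_nonneg b_le) auto
      also have "prob B0 \<le> 2 ^ D * (A * exp (- b * t\<^sup>2))"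
        using assms by (intro order.trans[OF probB0] mult_left_mono b_le) auto
      finally show ?thesis unfolding K_def by (simp add: algebra_simps)
    qed
    moreover have "\<bar>Y x \<omega>\<bar> \<le> S * t"
      if \<omega>: "\<omega> \<in> space M - B" and cont: "continuous_on (cbox 0 One) (\<lambda>x. Y x \<omega>)"
        and x: "x \<in> cbox 0 One" for \<omega> x
    proof -
      have innet: "dyadic_floor k x \<in> dyadic_net k" for k
        unfolding dyadic_net_def using x by blast
      have step: "\<bar>Y (dyadic_floor k x) \<omega> - Y (dyadic_floor (Suc k) x) \<omega>\<bar> \<le> t * q ^ k" for k
      proof -
        have "dist (dyadic_floor k x) (dyadic_floor (Suc k) x)
            \<le> dist x (dyadic_floor k x) + dist x (dyadic_floor (Suc k) x)"
          by (metis dist_commute dist_triangle)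
        also have "\<dots> \<le> real D / 2 ^ k + real D / 2 ^ Suc k"
          unfolding D_def by (intro add_mono dist_dyadic_floor)
        also have "\<dots> \<le> R / 2 ^ k" unfolding R_def by (simp add: field_simps)
        finally have "(dyadic_floor k x, dyadic_floor (Suc k) x) \<in> P k"
          unfolding P_def using innet by auto
        moreover have "\<omega> \<notin> B1 k" using \<omega> unfolding B_def by blast
        ultimately have "\<omega> \<notin> E k (dyadic_floor k x, dyadic_floor (Suc k) x)"
          unfolding B1_def by blast
        then show ?thesis using \<omega> unfolding E_def by auto
      qed
      have "\<omega> \<notin> B0" using \<omega> unfolding B_def by blast
      then have base: "\<bar>Y (dyadic_floor 0 x) \<omega>\<bar> \<le> t"
        using innet[of 0] \<omega> unfolding B0_def by auto
      have "\<bar>Y (dyadic_floor m x) \<omega>\<bar> \<le> t + t * (\<Sum>k<m. q ^ k)" for m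
      proof (induction m)
        case 0
        then show ?case using base by simp
      next
        case (Suc m)
        then show ?case using step[of m] by (simp add: algebra_simps)
      qed
      moreover have "t + t * (\<Sum>k<m. q ^ k) \<le> S * t" for m
      proof -
        have "(\<Sum>k<m. q ^ k) \<le> (\<Sum>k. q ^ k)"
          using q by (intro sum_le_suminf summable_geometric) auto
        also have "\<dots> = 1 / (1 - q)" using q by (intro suminf_geometric) auto
        finally have "t * (\<Sum>k<m. q ^ k) \<le> t * (1 / (1 - q))"
          using t by (intro mult_left_mono) auto
        then show ?thesis unfolding S_def by (simp add: algebra_simps)
      qed
      ultimately have bound: "\<bar>Y (dyadic_floor m x) \<omega>\<bar> \<le> S * t" for m
        using order.trans by blast
      \<comment> \<open>Continuity of the path carries the bound from the countably many net points
        to every point of the cube.\<close>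
      have "(\<lambda>m. Y (dyadic_floor m x) \<omega>) \<longlonglongrightarrow> Y x \<omega>"
        by (rule continuous_on_tendsto_compose[OF cont dyadic_floor_tendsto x])
          (use dyadic_floor_in_cbox[OF x] in simp)
      then have "(\<lambda>m. \<bar>Y (dyadic_floor m x) \<omega>\<bar>) \<longlonglongrightarrow> \<bar>Y x \<omega>\<bar>"
        by (rule tendsto_rabs)
      then show ?thesis
        by (rule LIMSEQ_le_const2) (use bound in blast)
    qed
    ultimately have "\<exists>B\<in>events. prob B \<le> K * exp (- b * t\<^sup>2) \<and>
        (\<forall>\<omega>\<in>space M - B. continuous_on (cbox 0 One) (\<lambda>x. Y x \<omega>) \<longrightarrow>
           (\<forall>x\<in>cbox 0 One. \<bar>Y x \<omega>\<bar> \<le> S * t))"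
      by blast
  }
  ultimately show ?thesis by (rule that)
qed

section \<open>Logarithmic potentials of smoothing kernels\<close>

lemma nn_integral_lborel_affine:
  fixes f :: "'a::euclidean_space \<Rightarrow> ennreal"
  assumes [measurable]: "f \<in> borel_measurable borel" and "c \<noteq> 0"
  shows "(\<integral>\<^sup>+x. f x \<partial>lborel) = ennreal (\<bar>c\<bar> ^ DIM('a)) * (\<integral>\<^sup>+x. f (t + c *\<^sub>R x) \<partial>lborel)"
  by (subst lborel_affine[OF assms(2), of t], subst nn_integral_density)
    (auto simp: nn_integral_distr nn_integral_cmult)

text \<open>The first argument only carries the type of the space, which a radius alone does not
  determine.\<close>

definition log_mass :: "'a::euclidean_space itself \<Rightarrow> real \<Rightarrow> ennreal" where
  "log_mass _ R = (\<integral>\<^sup>+u. ennreal \<bar>ln (norm u)\<bar> * indicator (ball (0::'a) R) u \<partial>lborel)"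

text \<open>Layer-cake estimate: on the unit ball, \<open>\<bar>ln r\<bar>\<close> is at most the number of \<open>k\<close> with
  \<open>r \<le> exp (- k)\<close>.\<close>

lemma log_mass_finite: "log_mass TYPE('a::euclidean_space) R < \<infinity>"
proof -
  define C where "C = ln (max R 1)"
  have pw: "ennreal \<bar>ln (norm u)\<bar> * indicator (ball 0 R) u \<le>
      ennreal C * indicator (ball 0 R) u + (\<Sum>k. indicator (cball 0 (exp (- real k))) u)" for u :: 'a
  proof -
    consider "u \<notin> ball 0 R \<or> u = 0" | "norm u < R" "norm u > 1" | "0 < norm u" "norm u \<le> 1"
      by (cases "u = 0 \<or> R \<le> norm u"; cases "norm u \<le> 1") (auto simp: not_le)
    then show ?thesis
    proof cases
      case 1
      then show ?thesis by auto
    next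
      case 2
      then have "ln (norm u) \<le> ln R" by (subst ln_le_cancel_iff) linarith+
      then have "\<bar>ln (norm u)\<bar> \<le> C" unfolding C_def using 2 by simp
      then have "ennreal \<bar>ln (norm u)\<bar> * indicator (ball 0 R) u \<le> ennreal C * indicator (ball 0 R) u"
        by (intro mult_right_mono ennreal_leI) auto
      then show ?thesis by (simp add: add_increasing2)
    next
      case 3
      define m where "m = nat \<lfloor>- ln (norm u)\<rfloor>"
      have ln: "ln (norm u) \<le> 0" using 3 by simp
      then have m: "real m \<le> - ln (norm u)" "- ln (norm u) \<le> real (Suc m)"
        unfolding m_def by linarith+
      have in_ball: "u \<in> cball 0 (exp (- real k))" if "k \<le> m" for k
      proof -
        have "ln (norm u) \<le> - real k" using m(1) that by linarith
        then have "exp (ln (norm u)) \<le> exp (- real k)" by simp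
        also have "exp (ln (norm u)) = norm u" using 3 by simp
        finally show ?thesis by simp
      qed
      have "ennreal \<bar>ln (norm u)\<bar> * indicator (ball 0 R) u \<le> ennreal (real (Suc m))"
        using m ln by (auto split: split_indicator intro!: ennreal_leI simp del: of_nat_Suc)
      \<comment> \<open>The indices run from 0 to \<open>m\<close>, so there are
        \<open>m + 1\<close> of them; the additional one makes up for rounding
        \<open>- ln (norm u)\<close> down to \<open>m\<close>.\<close>
      also have "\<dots> = (\<Sum>k\<le>m. indicator (cball 0 (exp (- real k))) u)"
        using in_ball by (simp add: ennreal_of_nat_eq_real_of_nat)
      also have "\<dots> \<le> (\<Sum>k. indicator (cball 0 (exp (- real k))) u)"
        by (intro sum_le_suminf) auto
      finally show ?thesis by (simp add: add_increasing)
    qed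
  qed
  define v where "v = unit_ball_vol (real DIM('a))"
  have "log_mass TYPE('a) R \<le> (\<integral>\<^sup>+u. ennreal C * indicator (ball (0::'a) R) u
      + (\<Sum>k. indicator (cball 0 (exp (- real k))) u) \<partial>lborel)"
    unfolding log_mass_def by (intro nn_integral_mono pw)
  also have "\<dots> = ennreal C * emeasure lborel (ball (0::'a) R)
      + (\<Sum>k. emeasure lborel (cball (0::'a) (exp (- real k))))"
  proof -
    have [measurable]: "ball (0::'a) R \<in> sets borel" "cball (0::'a) r \<in> sets borel" for r by simp_all
    show ?thesis
      by (subst nn_integral_add, measurable, subst nn_integral_suminf, measurable)
        (simp add: nn_integral_cmult)
  qed
  also have "(\<Sum>k. emeasure lborel (cball (0::'a) (exp (- real k)))) = (\<Sum>k. ennreal (v * (exp (- real DIM('a)) ^ k)))"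
    unfolding v_def by (intro suminf_cong) (simp add: emeasure_cball mult.commute flip: exp_of_nat_mult)
  also have "\<dots> = ennreal (\<Sum>k. v * (exp (- real DIM('a)) ^ k))"
    by (intro suminf_ennreal2 summable_mult summable_geometric) (auto simp: v_def)
  finally show ?thesis
    by (rule le_less_trans)
      (use emeasure_lborel_ball_finite[of "0::'a" R] in \<open>simp add: ennreal_mult_less_top\<close>)
qed

context
  fixes \<psi> :: "'a::euclidean_space \<Rightarrow> real"
  assumes kernel: "smoothing_kernel \<psi>"
begin

lemma kernel_nonneg: "\<psi> x \<ge> 0"
  using kernel unfolding smoothing_kernel_def by blast

lemma kernel_outside: "norm x \<ge> 1 \<Longrightarrow> \<psi> x = 0"
  using kernel unfolding smoothing_kernel_def by (auto simp: dist_norm)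

lemma kernel_test_function: "test_function \<psi>"
  using test_function_scaled_kernel[OF kernel, of 1] by (simp add: scaled_kernel_def[abs_def])

lemma kernel_measurable [measurable]: "\<psi> \<in> borel_measurable borel"
  using kernel_test_function smooth_borel_measurable test_function_smooth by blast

lemma kernel_mass: "(\<integral>\<^sup>+x. ennreal (\<psi> x) \<partial>lborel) = 1"
  using kernel kernel_nonneg kernel_test_function
  by (subst nn_integral_eq_integral) (auto simp: test_function_integrable smoothing_kernel_def)

lemma scaled_kernel_nonneg: "scaled_kernel \<psi> n x \<ge> 0"
  unfolding scaled_kernel_def using kernel_nonneg by simp

text \<open>The convolution is the density of \<open>a + (1 / n) *\<^sub>R s\<close> for independent
  \<open>a\<close> and \<open>s\<close>, with \<open>a\<close> distributed as \<mu> and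
  \<open>s\<close> with density \<psi>. The proof is Tonelli followed by the substitution
  \<open>x = a + (1 / n) *\<^sub>R s\<close>.\<close>

lemma nn_integral_convolve:
  fixes g :: "'a \<Rightarrow> ennreal"
  assumes g [measurable]: "g \<in> borel_measurable borel"
    and \<mu>: "prob_space \<mu>" and sets [measurable_cong]: "sets \<mu> = sets borel" and n: "n > 0"
  shows "(\<integral>\<^sup>+x. g x * ennreal (convolve \<mu> (scaled_kernel \<psi> n) x) \<partial>lborel) =
    (\<integral>\<^sup>+a. (\<integral>\<^sup>+s. ennreal (\<psi> s) * g (a + (1 / real n) *\<^sub>R s) \<partial>lborel) \<partial>\<mu>)"
proof -
  interpret prob_space \<mu> by fact
  interpret pair_sigma_finite lborel \<mu> ..
  let ?k = "scaled_kernel \<psi> n"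
  have k: "test_function ?k" by (rule test_function_scaled_kernel[OF kernel n])
  have [measurable]: "?k \<in> borel_measurable borel"
    using k smooth_borel_measurable test_function_smooth by blast
  have "ennreal (convolve \<mu> ?k x) = (\<integral>\<^sup>+a. ennreal (?k (x - a)) \<partial>\<mu>)" for x
    unfolding convolve_def using scaled_kernel_nonneg
    by (intro nn_integral_eq_integral[symmetric] test_function_convolve_integrable k \<mu> sets) auto
  then have "(\<integral>\<^sup>+x. g x * ennreal (convolve \<mu> ?k x) \<partial>lborel)
      = (\<integral>\<^sup>+x. (\<integral>\<^sup>+a. g x * ennreal (?k (x - a)) \<partial>\<mu>) \<partial>lborel)"
    by (simp add: nn_integral_cmult)
  also have "\<dots> = (\<integral>\<^sup>+a. (\<integral>\<^sup>+x. g x * ennreal (?k (x - a)) \<partial>lborel) \<partial>\<mu>)"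
    by (rule Fubini'[symmetric]) measurable
  also have "\<dots> = (\<integral>\<^sup>+a. (\<integral>\<^sup>+s. ennreal (\<psi> s) * g (a + (1 / real n) *\<^sub>R s) \<partial>lborel) \<partial>\<mu>)"
  proof (rule nn_integral_cong)
    fix a
    have "(\<integral>\<^sup>+x. g x * ennreal (?k (x - a)) \<partial>lborel) = ennreal (\<bar>1 / real n\<bar> ^ DIM('a)) *
        (\<integral>\<^sup>+s. g (a + (1 / real n) *\<^sub>R s) * ennreal (?k (a + (1 / real n) *\<^sub>R s - a)) \<partial>lborel)"
      by (rule nn_integral_lborel_affine) (use n in auto)
    also have "\<dots> = (\<integral>\<^sup>+s. ennreal (\<bar>1 / real n\<bar> ^ DIM('a)) *
        (g (a + (1 / real n) *\<^sub>R s) * ennreal (?k (a + (1 / real n) *\<^sub>R s - a))) \<partial>lborel)"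
      by (rule nn_integral_cmult[symmetric]) measurable
    also have "\<dots> = (\<integral>\<^sup>+s. ennreal (\<psi> s) * g (a + (1 / real n) *\<^sub>R s) \<partial>lborel)"
    proof (rule nn_integral_cong)
      fix s
      have "ennreal (\<bar>1 / real n\<bar> ^ DIM('a)) * ennreal (?k (a + (1 / real n) *\<^sub>R s - a)) = ennreal (\<psi> s)"
        using n by (simp add: scaled_kernel_def power_divide flip: ennreal_mult')
      then show "ennreal (\<bar>1 / real n\<bar> ^ DIM('a)) *
          (g (a + (1 / real n) *\<^sub>R s) * ennreal (?k (a + (1 / real n) *\<^sub>R s - a)))
          = ennreal (\<psi> s) * g (a + (1 / real n) *\<^sub>R s)"
        by (metis mult.assoc mult.commute)
    qed
    finally show "(\<integral>\<^sup>+x. g x * ennreal (?k (x - a)) \<partial>lborel)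
      = (\<integral>\<^sup>+s. ennreal (\<psi> s) * g (a + (1 / real n) *\<^sub>R s) \<partial>lborel)" .
  qed
  finally show ?thesis .
qed

text \<open>After division by \<delta> the logarithmic singularity sits at distance at most 7 from
  the origin and is integrated against a bounded density carried by the unit ball, so its
  contribution is at most a multiple of the logarithmic mass of the ball of radius 7 + 1 = 8. The
  number 7 covers both uses: \<open>norm a\<close> is at most 3 with \<delta> at least 1/2, or at
  most \<open>5 * \<delta>\<close>.\<close>

lemma kernel_log_bound:
  obtains L :: real where "L \<ge> 0" "\<And>a \<delta>. \<delta> > 0 \<Longrightarrow> norm a \<le> 7 * \<delta> \<Longrightarrow>
    (\<integral>\<^sup>+t. ennreal (\<psi> t) * ennreal \<bar>ln (norm (a - \<delta> *\<^sub>R t))\<bar> \<partial>lborel) \<le> ennreal (\<bar>ln \<delta>\<bar> + L)"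
proof -
  obtain B where B: "B > 0" "\<And>x. \<bar>\<psi> x\<bar> \<le> B"
    using test_function_bounded[OF kernel_test_function] by metis
  define L where "L = enn2real (ennreal B * log_mass TYPE('a) 8)"
  have "L \<ge> 0" unfolding L_def by simp
  have L: "ennreal L = ennreal B * log_mass TYPE('a) 8"
    unfolding L_def using log_mass_finite[where 'a='a, of 8]
    by (intro ennreal_enn2real) (simp add: ennreal_mult_less_top)
  have "(\<integral>\<^sup>+t. ennreal (\<psi> t) * ennreal \<bar>ln (norm (a - \<delta> *\<^sub>R t))\<bar> \<partial>lborel) \<le> ennreal (\<bar>ln \<delta>\<bar> + L)"
    if \<delta>: "\<delta> > 0" and a: "norm a \<le> 7 * \<delta>" for a \<delta>
  proof -
    define c where "c = (1 / \<delta>) *\<^sub>R a"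
    have c: "norm c \<le> 7" unfolding c_def using a \<delta> by (simp add: field_simps)
    let ?g = "\<lambda>u::'a. ennreal \<bar>ln (norm u)\<bar> * indicator (ball 0 8) u"
    have [measurable]: "ball (0::'a) 8 \<in> sets borel" by simp
    have g: "?g \<in> borel_measurable borel" by measurable
    have "ennreal (\<psi> t) * ennreal \<bar>ln (norm (a - \<delta> *\<^sub>R t))\<bar>
        \<le> ennreal \<bar>ln \<delta>\<bar> * ennreal (\<psi> t) + ennreal B * ?g (c + (- 1) *\<^sub>R t)" for t
    proof (cases "norm t < 1")
      case False
      then show ?thesis using kernel_outside[of t] by simp
    next
      case True
      have eq: "a - \<delta> *\<^sub>R t = \<delta> *\<^sub>R (c + (- 1) *\<^sub>R t)"
        unfolding c_def using \<delta> by (simp add: algebra_simps)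
      have "norm (c - t) \<le> norm c + norm t" by (rule norm_triangle_ineq4)
      then have ball: "c - t \<in> ball 0 8" using True c by simp
      have "\<bar>ln (norm (a - \<delta> *\<^sub>R t))\<bar> \<le> \<bar>ln \<delta>\<bar> + \<bar>ln (norm (c - t))\<bar>"
      \<comment> \<open>At the singularity the convention \<open>ln 0 = 0\<close> makes the left
        side 0; elsewhere the logarithm of the product splits.\<close>
      proof (cases "c = t")
        case True
        then show ?thesis unfolding eq by simp
      next
        case False
        then show ?thesis unfolding eq using \<delta> by (simp add: ln_mult)
      qed
      then have "\<psi> t * \<bar>ln (norm (a - \<delta> *\<^sub>R t))\<bar> \<le> \<psi> t * (\<bar>ln \<delta>\<bar> + \<bar>ln (norm (c - t))\<bar>)"
        by (intro mult_left_mono kernel_nonneg)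
      also have "\<dots> = \<bar>ln \<delta>\<bar> * \<psi> t + \<psi> t * \<bar>ln (norm (c - t))\<bar>" by (simp add: algebra_simps)
      also have "\<dots> \<le> \<bar>ln \<delta>\<bar> * \<psi> t + B * \<bar>ln (norm (c - t))\<bar>"
        using B(2)[of t] by (intro add_left_mono mult_right_mono) auto
      finally have "ennreal (\<psi> t * \<bar>ln (norm (a - \<delta> *\<^sub>R t))\<bar>)
          \<le> ennreal (\<bar>ln \<delta>\<bar> * \<psi> t + B * \<bar>ln (norm (c - t))\<bar>)"
        by (rule ennreal_leI)
      then show ?thesis
        using ball B(1) kernel_nonneg by (simp add: ennreal_mult)
    qed
    then have "(\<integral>\<^sup>+t. ennreal (\<psi> t) * ennreal \<bar>ln (norm (a - \<delta> *\<^sub>R t))\<bar> \<partial>lborel)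
        \<le> (\<integral>\<^sup>+t. ennreal \<bar>ln \<delta>\<bar> * ennreal (\<psi> t) + ennreal B * ?g (c + (- 1) *\<^sub>R t) \<partial>lborel)"
      by (intro nn_integral_mono)
    also have "\<dots> = ennreal \<bar>ln \<delta>\<bar> * (\<integral>\<^sup>+t. ennreal (\<psi> t) \<partial>lborel)
        + ennreal B * (\<integral>\<^sup>+t. ?g (c + (- 1) *\<^sub>R t) \<partial>lborel)"
    proof -
      have [measurable]: "(\<lambda>t. ?g (c + (- 1) *\<^sub>R t)) \<in> borel_measurable lborel"
        by (rule measurable_compose[OF _ g]) simp
      show ?thesis
        by (subst nn_integral_add; (subst nn_integral_cmult)?; (subst nn_integral_cmult)?) simp_all
    qed
    also have "(\<integral>\<^sup>+t. ?g (c + (- 1) *\<^sub>R t) \<partial>lborel) = log_mass TYPE('a) 8"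
    proof -
      have "nn_integral lborel ?g = ennreal (\<bar>- 1\<bar> ^ DIM('a)) * (\<integral>\<^sup>+t. ?g (c + (- 1) *\<^sub>R t) \<partial>lborel)"
        by (rule nn_integral_lborel_affine[OF g]) simp
      then show ?thesis unfolding log_mass_def by simp
    qed
    finally show ?thesis
      using kernel_mass \<open>L \<ge> 0\<close> by (simp add: L)
  qed
  moreover note \<open>L \<ge> 0\<close>
  ultimately show ?thesis using that by blast
qed

end

section \<open>Logarithmic energies of mollified measures\<close>

context
  fixes \<psi> :: "'a::euclidean_space \<Rightarrow> real"
  assumes kernel: "smoothing_kernel \<psi>"
begin

declare kernel_measurable [OF kernel, measurable]

text \<open>With \<open>\<delta> = 1 / (n * \<epsilon>)\<close>, the point \<open>a + \<delta> *\<^sub>R s\<close> is a point of the mollification of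
  \<open>rescale \<mu> z \<epsilon>\<close> by \<open>scaled_kernel \<psi> n\<close>, seen in the coordinates in which \<open>z\<close> is the origin
  and \<open>\<epsilon>\<close> is the unit length.\<close>

definition mollified_log_energy :: "'a measure \<Rightarrow> real \<Rightarrow> 'a measure \<Rightarrow> real \<Rightarrow> ennreal" where
  "mollified_log_energy \<mu> \<delta> \<nu> \<eta> = (\<integral>\<^sup>+a. (\<integral>\<^sup>+s. ennreal (\<psi> s) *
     (\<integral>\<^sup>+b. (\<integral>\<^sup>+t. ennreal (\<psi> t) * ennreal \<bar>ln (norm (a + \<delta> *\<^sub>R s - b - \<eta> *\<^sub>R t))\<bar> \<partial>lborel) \<partial>\<nu>)
     \<partial>lborel) \<partial>\<mu>)"

lemma convolve_rescale_measurable: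
  assumes "prob_space \<mu>" "sets \<mu> = sets borel" "n > 0"
  shows "convolve (rescale \<mu> z \<epsilon>) (scaled_kernel \<psi> n) \<in> borel_measurable borel"
proof -
  interpret prob_space \<mu> by fact
  note [measurable_cong] = assms(2)
  have "prob_space (rescale \<mu> z \<epsilon>)" unfolding rescale_def by (rule prob_space_distr) measurable
  then have "continuous (at x) (convolve (rescale \<mu> z \<epsilon>) (scaled_kernel \<psi> n))" for x
    using convolve_has_derivative[OF test_function_scaled_kernel[OF kernel assms(3)], of "rescale \<mu> z \<epsilon>" x]
    by (intro has_derivative_continuous) (auto simp: rescale_def)
  then show ?thesis
    by (intro borel_measurable_continuous_onI continuous_at_imp_continuous_on) auto
qed

text \<open>The dilation by \<epsilon> cancels the \<epsilon> inside the logarithm. The energy thus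
  no longer depends on \<open>z\<close>, and on \<epsilon> only through the products
  \<open>n * \<epsilon>\<close> and \<open>m * \<epsilon>\<close>; the uniformity of the later
  variance bounds in \<open>z\<close> and \<epsilon> comes from here.\<close>

lemma mollified_log_energy_eq:
  assumes \<mu>: "prob_space \<mu>" and sets_\<mu> [measurable_cong]: "sets \<mu> = sets borel"
    and \<nu>: "prob_space \<nu>" and sets_\<nu> [measurable_cong]: "sets \<nu> = sets borel"
    and n: "n > 0" and m: "m > 0" and \<epsilon>: "\<epsilon> > 0"
  shows "(\<integral>\<^sup>+x. (\<integral>\<^sup>+y. ennreal \<bar>ln (\<epsilon> / dist x y)\<bar> *
        ennreal (convolve (rescale \<nu> z \<epsilon>) (scaled_kernel \<psi> m) y) \<partial>lborel) *
        ennreal (convolve (rescale \<mu> z \<epsilon>) (scaled_kernel \<psi> n) x) \<partial>lborel)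
    = mollified_log_energy \<mu> (1 / (real n * \<epsilon>)) \<nu> (1 / (real m * \<epsilon>))"
proof -
  interpret \<mu>: prob_space \<mu> by fact
  interpret \<nu>: prob_space \<nu> by fact
  have p: "prob_space (rescale \<mu> z \<epsilon>)" "prob_space (rescale \<nu> z \<epsilon>)"
    unfolding rescale_def by (intro \<mu>.prob_space_distr \<nu>.prob_space_distr; measurable)+
  have s: "sets (rescale \<mu> z \<epsilon>) = sets borel" "sets (rescale \<nu> z \<epsilon>) = sets borel"
    unfolding rescale_def by auto
  have [measurable]: "convolve (rescale \<nu> z \<epsilon>) (scaled_kernel \<psi> m) \<in> borel_measurable borel"
    by (rule convolve_rescale_measurable[OF \<nu> sets_\<nu> m])
  let ?f = "\<lambda>x. \<integral>\<^sup>+y. ennreal \<bar>ln (\<epsilon> / dist x y)\<bar> *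
        ennreal (convolve (rescale \<nu> z \<epsilon>) (scaled_kernel \<psi> m) y) \<partial>lborel"
  have f_eq: "?f x = (\<integral>\<^sup>+b. (\<integral>\<^sup>+t. ennreal (\<psi> t) *
      ennreal \<bar>ln (\<epsilon> / dist x (z + \<epsilon> *\<^sub>R b + (1 / real m) *\<^sub>R t))\<bar> \<partial>lborel) \<partial>\<nu>)" for x
    by (subst nn_integral_convolve[OF kernel _ p(2) s(2) m], measurable)
      (simp add: rescale_def nn_integral_distr)
  have scale: "\<bar>ln (\<epsilon> / dist (z + \<epsilon> *\<^sub>R a + (1 / real n) *\<^sub>R s) (z + \<epsilon> *\<^sub>R b + (1 / real m) *\<^sub>R t))\<bar>
      = \<bar>ln (norm (a + (1 / (real n * \<epsilon>)) *\<^sub>R s - b - (1 / (real m * \<epsilon>)) *\<^sub>R t))\<bar>" for a s b t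
  proof -
    let ?v = "a + (1 / (real n * \<epsilon>)) *\<^sub>R s - b - (1 / (real m * \<epsilon>)) *\<^sub>R t"
    have "z + \<epsilon> *\<^sub>R a + (1 / real n) *\<^sub>R s - (z + \<epsilon> *\<^sub>R b + (1 / real m) *\<^sub>R t) = \<epsilon> *\<^sub>R ?v"
      using \<epsilon> by (simp add: algebra_simps)
    then have "dist (z + \<epsilon> *\<^sub>R a + (1 / real n) *\<^sub>R s) (z + \<epsilon> *\<^sub>R b + (1 / real m) *\<^sub>R t) = \<epsilon> * norm ?v"
      using \<epsilon> by (simp only: dist_norm norm_scaleR)
    moreover have "\<epsilon> / (\<epsilon> * norm ?v) = inverse (norm ?v)"
      using \<epsilon> by (simp add: field_simps)
    ultimately show ?thesis
      by (simp only: ln_inverse abs_minus_cancel)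
  qed
  have "(\<integral>\<^sup>+x. ?f x * ennreal (convolve (rescale \<mu> z \<epsilon>) (scaled_kernel \<psi> n) x) \<partial>lborel)
      = (\<integral>\<^sup>+a. (\<integral>\<^sup>+s. ennreal (\<psi> s) * ?f (a + (1 / real n) *\<^sub>R s) \<partial>lborel) \<partial>rescale \<mu> z \<epsilon>)"
    by (rule nn_integral_convolve[OF kernel _ p(1) s(1) n]) measurable
  also have "\<dots> = (\<integral>\<^sup>+a. (\<integral>\<^sup>+s. ennreal (\<psi> s) * ?f (z + \<epsilon> *\<^sub>R a + (1 / real n) *\<^sub>R s) \<partial>lborel) \<partial>\<mu>)"
    unfolding rescale_def[of \<mu>] by (subst nn_integral_distr) measurable
  also have "\<dots> = mollified_log_energy \<mu> (1 / (real n * \<epsilon>)) \<nu> (1 / (real m * \<epsilon>))"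
    unfolding f_eq scale mollified_log_energy_def ..
  finally show ?thesis .
qed

text \<open>Only the average over \<open>t\<close> has to be estimated, for points of the unit ball.
  The average over \<open>s\<close> then costs nothing, because \<psi> has mass one and
  \<open>G\<close> does not involve \<open>s\<close>.\<close>

lemma mollified_log_energy_le:
  assumes \<mu>: "AE a in \<mu>. norm a \<le> 1" and \<nu>: "AE b in \<nu>. norm b \<le> 1"
    and G: "\<And>a b s. norm a \<le> 1 \<Longrightarrow> norm b \<le> 1 \<Longrightarrow> norm s < 1 \<Longrightarrow>
      (\<integral>\<^sup>+t. ennreal (\<psi> t) * ennreal \<bar>ln (norm (a + \<delta> *\<^sub>R s - b - \<eta> *\<^sub>R t))\<bar> \<partial>lborel) \<le> G a b"
  shows "mollified_log_energy \<mu> \<delta> \<nu> \<eta> \<le> (\<integral>\<^sup>+a. (\<integral>\<^sup>+b. G a b \<partial>\<nu>) \<partial>\<mu>)"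
  unfolding mollified_log_energy_def
proof (rule nn_integral_mono_AE, use \<mu> in eventually_elim)
  fix a :: 'a assume a: "norm a \<le> 1"
  have "(\<integral>\<^sup>+s. ennreal (\<psi> s) * (\<integral>\<^sup>+b. (\<integral>\<^sup>+t. ennreal (\<psi> t) *
      ennreal \<bar>ln (norm (a + \<delta> *\<^sub>R s - b - \<eta> *\<^sub>R t))\<bar> \<partial>lborel) \<partial>\<nu>) \<partial>lborel)
    \<le> (\<integral>\<^sup>+s. ennreal (\<psi> s) * (\<integral>\<^sup>+b. G a b \<partial>\<nu>) \<partial>lborel)"
  proof (rule nn_integral_mono)
    fix s
    show "ennreal (\<psi> s) * (\<integral>\<^sup>+b. (\<integral>\<^sup>+t. ennreal (\<psi> t) *
        ennreal \<bar>ln (norm (a + \<delta> *\<^sub>R s - b - \<eta> *\<^sub>R t))\<bar> \<partial>lborel) \<partial>\<nu>)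
      \<le> ennreal (\<psi> s) * (\<integral>\<^sup>+b. G a b \<partial>\<nu>)"
    proof (cases "norm s < 1")
      case True
      have "AE b in \<nu>. (\<integral>\<^sup>+t. ennreal (\<psi> t) *
          ennreal \<bar>ln (norm (a + \<delta> *\<^sub>R s - b - \<eta> *\<^sub>R t))\<bar> \<partial>lborel) \<le> G a b"
        using \<nu> by eventually_elim (rule G[OF a _ True])
      then show ?thesis by (intro mult_left_mono nn_integral_mono_AE) auto
    next
      case False
      then show ?thesis using kernel_outside[OF kernel, of s] by simp
    qed
  qed
  also have "\<dots> = (\<integral>\<^sup>+b. G a b \<partial>\<nu>)"
    by (subst nn_integral_multc) (simp_all add: kernel_mass[OF kernel])
  finally show "(\<integral>\<^sup>+s. ennreal (\<psi> s) * (\<integral>\<^sup>+b. (\<integral>\<^sup>+t. ennreal (\<psi> t) *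
      ennreal \<bar>ln (norm (a + \<delta> *\<^sub>R s - b - \<eta> *\<^sub>R t))\<bar> \<partial>lborel) \<partial>\<nu>) \<partial>lborel) \<le> (\<integral>\<^sup>+b. G a b \<partial>\<nu>)" .
qed

text \<open>Since \<eta> is at least 1/2, averaging over \<open>t\<close> alone smooths the
  logarithm at unit scale, uniformly in the other points. So the bound is the same for all measures
  on the unit ball, point masses included. The points \<open>a + \<delta> *\<^sub>R s - b\<close>
  have norm at most 3, which is below \<open>7 * \<eta>\<close>.\<close>

lemma mollified_log_energy_macroscopic:
  obtains C :: real where "C \<ge> 0" "\<And>\<mu> \<nu> \<delta> \<eta>. prob_space \<mu> \<Longrightarrow> prob_space \<nu> \<Longrightarrow>
    AE a in \<mu>. norm a \<le> 1 \<Longrightarrow> AE b in \<nu>. norm b \<le> 1 \<Longrightarrow> 0 \<le> \<delta> \<Longrightarrow> \<delta> \<le> 1 \<Longrightarrow> 1 / 2 \<le> \<eta> \<Longrightarrow> \<eta> \<le> 1 \<Longrightarrow>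
    mollified_log_energy \<mu> \<delta> \<nu> \<eta> \<le> ennreal C"
proof -
  obtain L where L: "L \<ge> 0" "\<And>a \<delta>. \<delta> > 0 \<Longrightarrow> norm a \<le> 7 * \<delta> \<Longrightarrow>
    (\<integral>\<^sup>+t. ennreal (\<psi> t) * ennreal \<bar>ln (norm (a - \<delta> *\<^sub>R t))\<bar> \<partial>lborel) \<le> ennreal (\<bar>ln \<delta>\<bar> + L)"
    using kernel_log_bound[OF kernel] by metis
  have "mollified_log_energy \<mu> \<delta> \<nu> \<eta> \<le> ennreal (ln 2 + L)"
    if "prob_space \<mu>" "prob_space \<nu>" and supp: "AE a in \<mu>. norm a \<le> 1" "AE b in \<nu>. norm b \<le> 1"
      and \<delta>: "0 \<le> \<delta>" "\<delta> \<le> 1" and \<eta>: "1 / 2 \<le> \<eta>" "\<eta> \<le> 1" for \<mu> \<nu> \<delta> \<eta>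
  proof -
    interpret \<mu>: prob_space \<mu> by fact
    interpret \<nu>: prob_space \<nu> by fact
    have "ln (1 / 2) \<le> ln \<eta>" using \<eta> by (subst ln_le_cancel_iff) auto
    then have ln: "\<bar>ln \<eta>\<bar> \<le> ln 2" using \<eta> by (simp add: ln_div)
    have "(\<integral>\<^sup>+t. ennreal (\<psi> t) * ennreal \<bar>ln (norm (a + \<delta> *\<^sub>R s - b - \<eta> *\<^sub>R t))\<bar> \<partial>lborel) \<le> ennreal (ln 2 + L)"
      if "norm a \<le> 1" "norm b \<le> 1" "norm s < 1" for a b s
    proof -
      have "norm (a + \<delta> *\<^sub>R s - b) \<le> norm (a + \<delta> *\<^sub>R s) + norm b" by (rule norm_triangle_ineq4)
      also have "\<dots> \<le> norm a + norm (\<delta> *\<^sub>R s) + norm b" by (intro add_right_mono norm_triangle_ineq)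
      also have "norm (\<delta> *\<^sub>R s) \<le> 1 * 1" using \<delta> that by (simp only: norm_scaleR) (intro mult_mono, auto)
      finally have "norm (a + \<delta> *\<^sub>R s - b) \<le> 7 * \<eta>" using that \<eta> by simp
      then show ?thesis
        using \<eta> ln by (intro order.trans[OF L(2)] ennreal_leI) auto
    qed
    from mollified_log_energy_le[OF supp this]
    show ?thesis by (simp add: \<mu>.emeasure_space_1 \<nu>.emeasure_space_1)
  qed
  moreover have "ln 2 + L \<ge> 0" using L(1) by simp
  ultimately show ?thesis using that by blast
qed

lemma abs_log_kernel_measurable [measurable]:
  "(\<lambda>(x, y). abs_log_kernel x (y :: 'a)) \<in> borel_measurable (borel \<Otimes>\<^sub>M borel)"
proof -
  have "(\<lambda>(x, y). abs_log_kernel x (y :: 'a)) =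
      (\<lambda>p. if dist (fst p) (snd p) = 0 then \<infinity> else ennreal \<bar>ln (1 / dist (fst p) (snd p))\<bar>)"
    by (auto simp: abs_log_kernel_def)
  also have "\<dots> \<in> borel_measurable (borel \<Otimes>\<^sub>M borel)" by measurable
  finally show ?thesis .
qed

text \<open>Here \<delta> may be arbitrarily small, so the energy of \<mu> itself has to be used.
  Let \<open>w = a - b\<close>. If \<open>norm w\<close> is at least \<open>4 * \<delta>\<close>,
  the two shifts move \<open>w\<close> by at most half its length and change the logarithm by at
  most \<open>ln 4\<close>. If \<open>norm w\<close> is smaller, \<open>kernel_log_bound\<close>
  gives \<bar>ln \<delta>\<bar> plus a constant, and \<open>norm w < 4 * \<delta> \<le> 4\<close>
  bounds this by the kernel at \<open>w\<close> plus a constant.\<close>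

lemma mollified_log_energy_diagonal:
  assumes \<mu>: "prob_space \<mu>" and [measurable_cong]: "sets \<mu> = sets borel"
    and supp: "AE a in \<mu>. norm a \<le> 1"
    and fin: "(\<integral>\<^sup>+x. (\<integral>\<^sup>+y. abs_log_kernel x y \<partial>\<mu>) \<partial>\<mu>) < \<infinity>"
  obtains C :: real where "C \<ge> 0"
    "\<And>\<delta>. 0 < \<delta> \<Longrightarrow> \<delta> \<le> 1 \<Longrightarrow> mollified_log_energy \<mu> \<delta> \<mu> \<delta> \<le> ennreal C"
proof -
  interpret prob_space \<mu> by fact
  obtain L where L: "L \<ge> 0" "\<And>a \<delta>. \<delta> > 0 \<Longrightarrow> norm a \<le> 7 * \<delta> \<Longrightarrow>
    (\<integral>\<^sup>+t. ennreal (\<psi> t) * ennreal \<bar>ln (norm (a - \<delta> *\<^sub>R t))\<bar> \<partial>lborel) \<le> ennreal (\<bar>ln \<delta>\<bar> + L)"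
    using kernel_log_bound[OF kernel] by metis
  define E where "E = enn2real (\<integral>\<^sup>+x. (\<integral>\<^sup>+y. abs_log_kernel x y \<partial>\<mu>) \<partial>\<mu>)"
  have E: "ennreal E = (\<integral>\<^sup>+x. (\<integral>\<^sup>+y. abs_log_kernel x y \<partial>\<mu>) \<partial>\<mu>)"
    unfolding E_def using fin by (intro ennreal_enn2real) simp
  have "E \<ge> 0" unfolding E_def by simp
  have "mollified_log_energy \<mu> \<delta> \<mu> \<delta> \<le> ennreal (E + (ln 4 + L))" if \<delta>: "0 < \<delta>" "\<delta> \<le> 1" for \<delta>
  proof -
    have "(\<integral>\<^sup>+t. ennreal (\<psi> t) * ennreal \<bar>ln (norm (a + \<delta> *\<^sub>R s - b - \<delta> *\<^sub>R t))\<bar> \<partial>lborel)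
        \<le> abs_log_kernel a b + ennreal (ln 4 + L)"
      if s: "norm s < 1" for a b s :: 'a
    \<comment> \<open>On the diagonal \<open>abs_log_kernel\<close> is infinite, so there is nothing
      to prove.\<close>
    proof (cases "a = b")
      case True
      then show ?thesis by (simp add: abs_log_kernel_def)
    next
      case False
      define w where "w = a - b"
      have w: "norm w > 0" unfolding w_def using False by simp
      have ker: "abs_log_kernel a b = ennreal \<bar>ln (norm w)\<bar>"
        using False w unfolding abs_log_kernel_def w_def dist_norm by (simp add: ln_div)
      have arr: "a + \<delta> *\<^sub>R s - b - \<delta> *\<^sub>R t = w + \<delta> *\<^sub>R s - \<delta> *\<^sub>R t" for t
        unfolding w_def by (simp add: algebra_simps)
      show ?thesis
      proof (cases "4 * \<delta> \<le> norm w")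
        case True
        have "ennreal (\<psi> t) * ennreal \<bar>ln (norm (w + \<delta> *\<^sub>R s - \<delta> *\<^sub>R t))\<bar>
            \<le> ennreal (\<psi> t) * ennreal (\<bar>ln (norm w)\<bar> + ln 4)" for t
        proof (cases "norm t < 1")
          case t: True
          have "norm (\<delta> *\<^sub>R s - \<delta> *\<^sub>R t) \<le> norm (\<delta> *\<^sub>R s) + norm (\<delta> *\<^sub>R t)" by (rule norm_triangle_ineq4)
          also have "\<dots> \<le> \<delta> * 1 + \<delta> * 1"
            unfolding norm_scaleR using \<delta> s t by (intro add_mono mult_mono) auto
          finally have small: "norm (\<delta> *\<^sub>R s - \<delta> *\<^sub>R t) \<le> norm w / 2" using True by simp
          have "norm (w + (\<delta> *\<^sub>R s - \<delta> *\<^sub>R t)) \<le> norm w + norm (\<delta> *\<^sub>R s - \<delta> *\<^sub>R t)"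
            "norm w - norm (\<delta> *\<^sub>R s - \<delta> *\<^sub>R t) \<le> norm (w + (\<delta> *\<^sub>R s - \<delta> *\<^sub>R t))"
            by (rule norm_triangle_ineq, rule norm_diff_ineq)
          then have "norm (w + \<delta> *\<^sub>R s - \<delta> *\<^sub>R t) \<le> norm w * 4" "norm w / 4 \<le> norm (w + \<delta> *\<^sub>R s - \<delta> *\<^sub>R t)"
            using small w by (auto simp: algebra_simps)
          then have "ln (norm (w + \<delta> *\<^sub>R s - \<delta> *\<^sub>R t)) \<le> ln (norm w * 4)"
            "ln (norm w / 4) \<le> ln (norm (w + \<delta> *\<^sub>R s - \<delta> *\<^sub>R t))"
            using w by (auto intro!: ln_mono)
          then have "\<bar>ln (norm (w + \<delta> *\<^sub>R s - \<delta> *\<^sub>R t))\<bar> \<le> \<bar>ln (norm w)\<bar> + ln 4"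
            using w by (auto simp: ln_mult ln_div)
          then show ?thesis by (intro mult_left_mono ennreal_leI) auto
        next
          case False
          then show ?thesis using kernel_outside[OF kernel, of t] by simp
        qed
        then have "(\<integral>\<^sup>+t. ennreal (\<psi> t) * ennreal \<bar>ln (norm (w + \<delta> *\<^sub>R s - \<delta> *\<^sub>R t))\<bar> \<partial>lborel)
            \<le> (\<integral>\<^sup>+t. ennreal (\<psi> t) * ennreal (\<bar>ln (norm w)\<bar> + ln 4) \<partial>lborel)"
          by (intro nn_integral_mono)
        also have "\<dots> = ennreal (\<bar>ln (norm w)\<bar> + ln 4)"
          by (subst nn_integral_multc) (simp_all add: kernel_mass[OF kernel])
        also have "\<dots> \<le> ennreal (\<bar>ln (norm w)\<bar> + (ln 4 + L))"
          using L(1) by (intro ennreal_leI) simp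
        also have "\<dots> = abs_log_kernel a b + ennreal (ln 4 + L)"
          unfolding ker using L(1) by (intro ennreal_plus) auto
        finally show ?thesis unfolding arr .
      next
        case False
        have "norm (w + \<delta> *\<^sub>R s) \<le> norm w + norm (\<delta> *\<^sub>R s)" by (rule norm_triangle_ineq)
        also have "norm (\<delta> *\<^sub>R s) \<le> \<delta> * 1"
          unfolding norm_scaleR using \<delta> s by (intro mult_mono) auto
        finally have "norm (w + \<delta> *\<^sub>R s) \<le> 7 * \<delta>" using False \<delta> by simp
        then have "(\<integral>\<^sup>+t. ennreal (\<psi> t) * ennreal \<bar>ln (norm (w + \<delta> *\<^sub>R s - \<delta> *\<^sub>R t))\<bar> \<partial>lborel)
            \<le> ennreal (\<bar>ln \<delta>\<bar> + L)"
          using \<delta> by (intro L(2))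
        also have "\<dots> \<le> ennreal (\<bar>ln (norm w)\<bar> + (ln 4 + L))"
        proof (rule ennreal_leI)
          have "ln (norm w) \<le> ln (4 * \<delta>)" using False w \<delta> by (intro ln_mono) auto
          then have "- ln \<delta> \<le> ln 4 - ln (norm w)" using \<delta> by (simp add: ln_mult)
          moreover have "ln \<delta> \<le> 0" using \<delta> by simp
          ultimately show "\<bar>ln \<delta>\<bar> + L \<le> \<bar>ln (norm w)\<bar> + (ln 4 + L)" by linarith
        qed
        also have "\<dots> = abs_log_kernel a b + ennreal (ln 4 + L)"
          unfolding ker using L(1) by (intro ennreal_plus) auto
        finally show ?thesis unfolding arr .
      qed
    qed
    from mollified_log_energy_le[OF supp supp this]
    have "mollified_log_energy \<mu> \<delta> \<mu> \<delta> \<le> (\<integral>\<^sup>+a. (\<integral>\<^sup>+b. abs_log_kernel a b + ennreal (ln 4 + L) \<partial>\<mu>) \<partial>\<mu>)" .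
    also have "\<dots> = (\<integral>\<^sup>+a. (\<integral>\<^sup>+b. abs_log_kernel a b \<partial>\<mu>) + ennreal (ln 4 + L) \<partial>\<mu>)"
      by (intro nn_integral_cong, subst nn_integral_add) (simp_all add: emeasure_space_1)
    also have "\<dots> = ennreal E + ennreal (ln 4 + L)"
      unfolding E by (subst nn_integral_add) (simp_all add: emeasure_space_1)
    also have "\<dots> = ennreal (E + (ln 4 + L))"
      using \<open>E \<ge> 0\<close> L(1) by (intro ennreal_plus[symmetric]) auto
    finally show ?thesis .
  qed
  moreover have "E + (ln 4 + L) \<ge> 0" using \<open>E \<ge> 0\<close> L(1) by simp
  ultimately show ?thesis using that by blast
qed

end

section \<open>Variance of the difference of mollified fields\<close>

text \<open>The complement of the support is a union of null open sets, possibly uncountably many;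
  by the Lindelof property countably many of them suffice.\<close>

lemma AE_measure_support:
  fixes \<mu> :: "'a::second_countable_topology measure"
  assumes "sets \<mu> = sets borel" and "measure_support \<mu> \<subseteq> S"
  shows "AE x in \<mu>. x \<in> S"
proof -
  define \<U> where "\<U> = {U. open U \<and> emeasure \<mu> U = 0}"
  have op: "open U" and null: "U \<in> null_sets \<mu>" if "U \<in> \<U>" for U
    using that assms(1) unfolding \<U>_def by (simp_all add: null_sets_def)
  obtain \<V> where V: "\<V> \<subseteq> \<U>" "countable \<V>" "\<Union>\<V> = \<Union>\<U>"
    using Lindelof[OF op] by metis
  have "(\<Union>U\<in>\<V>. U) \<in> null_sets \<mu>"
    using V(1) null by (intro null_sets_UN' V(2)) blast
  then have "\<Union>\<V> \<in> null_sets \<mu>" by simp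
  moreover have "- S \<subseteq> \<Union>\<V>"
  proof
    fix x assume "x \<in> - S"
    then have "x \<notin> measure_support \<mu>" using assms(2) by blast
    then obtain U where "open U" "x \<in> U" "\<not> emeasure \<mu> U > 0"
      unfolding measure_support_def by blast
    then have "U \<in> \<U>" unfolding \<U>_def by (simp add: zero_less_iff_neq_zero)
    then show "x \<in> \<Union>\<V>" unfolding V(3) using \<open>x \<in> U\<close> by blast
  qed
  then have "{x \<in> space \<mu>. x \<notin> S} \<subseteq> \<Union>\<V>" by blast
  ultimately show ?thesis by (rule AE_I')
qed

lemma admissible_mollifierD:
  fixes \<rho> :: "'a::euclidean_space measure"
  assumes "admissible_mollifier \<rho>"
  shows "prob_space \<rho>" "sets \<rho> = sets borel" "AE a in \<rho>. norm a \<le> 1"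
    "(\<integral>\<^sup>+x. (\<integral>\<^sup>+y. abs_log_kernel x y \<partial>\<rho>) \<partial>\<rho>) < \<infinity>"
proof -
  have d: "sets \<rho> = sets borel" "measure_support \<rho> \<subseteq> cball 0 1" "emeasure \<rho> UNIV = 1"
    "(\<integral>\<^sup>+x. (\<integral>\<^sup>+y. abs_log_kernel x y \<partial>\<rho>) \<partial>\<rho>) < \<infinity>"
    using assms unfolding admissible_mollifier_def by blast+
  show "sets \<rho> = sets borel" "(\<integral>\<^sup>+x. (\<integral>\<^sup>+y. abs_log_kernel x y \<partial>\<rho>) \<partial>\<rho>) < \<infinity>"
    by (rule d)+
  have "space \<rho> = UNIV" using sets_eq_imp_space_eq[OF d(1)] by simp
  then show "prob_space \<rho>"
    using d(3) by (intro prob_spaceI) simp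
  show "AE a in \<rho>. norm a \<le> 1"
    using AE_measure_support[OF d(1,2)] by simp
qed

lemma centered_gaussian_L2_rv:
  assumes "centered_gaussian M X"
  shows "L2_rv M X"
proof -
  have X [measurable]: "X \<in> borel_measurable M"
    using assms unfolding centered_gaussian_def by blast
  consider "AE \<omega> in M. X \<omega> = 0"
    | s where "s > 0" "distributed M lborel X (\<lambda>x. ennreal (normal_density 0 s x))"
    using assms unfolding centered_gaussian_def by blast
  then have "integrable M (\<lambda>\<omega>. (X \<omega>)\<^sup>2)"
  proof cases
    case 1
    then have "AE \<omega> in M. (X \<omega>)\<^sup>2 = 0" by eventually_elim simp
    then show ?thesis by (subst integrable_cong_AE[where g="\<lambda>_. 0"]) auto
  next
    case (2 s)
    have "integrable lborel (\<lambda>x. normal_density 0 s x * x\<^sup>2)"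
      using integrable_normal_moment[OF 2(1), of 0 2] by simp
    then show ?thesis
      using distributed_integrable[OF 2(2), of "\<lambda>x. x\<^sup>2"] by simp
  qed
  then show ?thesis unfolding L2_rv_def by simp
qed

text \<open>Equality is asked for on \<open>space M\<close> only, because that is where
  \<open>h \<omega>\<close> is known to be linear.\<close>

lemma L2_limit_cong:
  assumes "L2_limit M X Y" and "\<And>n \<omega>. \<omega> \<in> space M \<Longrightarrow> X n \<omega> = X' n \<omega>"
  shows "L2_limit M X' Y"
proof -
  have "L2_rv M (X' n) \<longleftrightarrow> L2_rv M (X n)" for n
    unfolding L2_rv_def using assms(2)
    by (intro conj_cong measurable_cong Bochner_Integration.integrable_cong) auto
  moreover have "(\<integral>\<omega>. (X' n \<omega> - Y \<omega>)\<^sup>2 \<partial>M) = (\<integral>\<omega>. (X n \<omega> - Y \<omega>)\<^sup>2 \<partial>M)" for n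
    using assms(2) by (intro Bochner_Integration.integral_cong) auto
  ultimately show ?thesis using assms(1) unfolding L2_limit_def by simp
qed

text \<open>On the diagonal, where \<open>ln (1 / 0) = 0\<close>, the splitting \<open>ln (1 / r) = ln (\<epsilon> / r) + ln (1 / \<epsilon>)\<close>
  fails, but the diagonal is a null set. The constant \<open>ln (1 / \<epsilon>)\<close> drops out because \<open>f\<close> has mean zero.\<close>

lemma LGF_variance_le:
  fixes f F :: "'a::euclidean_space \<Rightarrow> real" and M :: "'w measure"
  assumes h: "LGF M h" and f: "test_function f" and f0: "integral\<^sup>L lborel f = 0"
    and F [measurable]: "F \<in> borel_measurable borel" and le: "\<And>x. \<bar>f x\<bar> \<le> F x" and \<epsilon>: "\<epsilon> > 0"
    and V: "(\<integral>\<^sup>+x. (\<integral>\<^sup>+y. ennreal \<bar>ln (\<epsilon> / dist x y)\<bar> * ennreal (F y) \<partial>lborel) * ennreal (F x) \<partial>lborel)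
      \<le> ennreal V" and "V \<ge> 0"
  shows "(\<integral>\<omega>. (h \<omega> f)\<^sup>2 \<partial>M) \<le> V"
proof -
  let ?P = "lborel \<Otimes>\<^sub>M (lborel :: 'a measure)"
  have [measurable]: "f \<in> borel_measurable borel"
    using f smooth_borel_measurable test_function_smooth by blast
  define G where "G = (\<lambda>(x, y). ln (\<epsilon> / dist x y) * f x * f y)"
  define E where "E = (\<lambda>(x, y). f x * f y)"
  have [measurable]: "G \<in> borel_measurable ?P" "E \<in> borel_measurable ?P"
    unfolding G_def E_def by measurable
  have G_bound: "(\<integral>\<^sup>+p. ennreal (norm (G p)) \<partial>?P) \<le> ennreal V"
  proof -
    have "(\<integral>\<^sup>+p. ennreal (norm (G p)) \<partial>?P) = (\<integral>\<^sup>+x. (\<integral>\<^sup>+y. ennreal (norm (G (x, y))) \<partial>lborel) \<partial>lborel)"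
      by (rule lborel.nn_integral_fst[symmetric]) measurable
    also have "\<dots> \<le> (\<integral>\<^sup>+x. (\<integral>\<^sup>+y. ennreal \<bar>ln (\<epsilon> / dist x y)\<bar> * ennreal (F y) * ennreal (F x) \<partial>lborel) \<partial>lborel)"
    proof (intro nn_integral_mono)
      fix x y :: 'a
      have "norm (G (x, y)) = \<bar>ln (\<epsilon> / dist x y)\<bar> * (\<bar>f y\<bar> * \<bar>f x\<bar>)"
        unfolding G_def by (simp add: abs_mult)
      also have "\<dots> \<le> \<bar>ln (\<epsilon> / dist x y)\<bar> * (F y * F x)"
        using le[of x] le[of y] by (intro mult_left_mono mult_mono) auto
      finally have "ennreal (norm (G (x, y))) \<le> ennreal (\<bar>ln (\<epsilon> / dist x y)\<bar> * (F y * F x))"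
        by (rule ennreal_leI)
      moreover have "F x \<ge> 0" "F y \<ge> 0" using le[of x] le[of y] by linarith+
      ultimately show "ennreal (norm (G (x, y))) \<le> ennreal \<bar>ln (\<epsilon> / dist x y)\<bar> * ennreal (F y) * ennreal (F x)"
        by (simp add: ennreal_mult mult.assoc)
    qed
    also have "\<dots> = (\<integral>\<^sup>+x. (\<integral>\<^sup>+y. ennreal \<bar>ln (\<epsilon> / dist x y)\<bar> * ennreal (F y) \<partial>lborel) * ennreal (F x) \<partial>lborel)"
      by (intro nn_integral_cong nn_integral_multc) measurable
    finally show ?thesis using V by simp
  qed
  have G_int: "integrable ?P G"
    using G_bound by (intro integrableI_bounded) (auto intro: le_less_trans)
  have f_int: "integrable lborel f" by (rule test_function_integrable[OF f])
  have E_int: "integrable ?P E"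
  proof (rule lborel_pair.Fubini_integrable)
    show "integrable lborel (\<lambda>x. \<integral>y. norm (E (x, y)) \<partial>lborel)"
      unfolding E_def using f_int by (simp add: abs_mult)
    show "AE x in lborel. integrable lborel (\<lambda>y. E (x, y))"
      unfolding E_def using f_int by simp
  qed measurable
  have E_0: "integral\<^sup>L ?P E = 0"
    unfolding lborel_pair.integral_fst'[OF E_int, symmetric] by (simp add: E_def f0)
  have split: "AE p in ?P. (case p of (x, y) \<Rightarrow> ln (1 / dist x y) * f x * f y) = G p + ln (1 / \<epsilon>) * E p"
  proof (rule lborel_pair.AE_pair_measure)
    have [measurable]: "Measurable.pred ?P (\<lambda>(x, y). ln (1 / dist x y) * f x * f y = G (x, y) + ln (1 / \<epsilon>) * E (x, y))"
      by measurable
    show "{p \<in> space ?P. (case p of (x, y) \<Rightarrow> ln (1 / dist x y) * f x * f y) = G p + ln (1 / \<epsilon>) * E p} \<in> sets ?P"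
      by measurable
    show "AE x in lborel. AE y in lborel. (case (x, y) of (x, y) \<Rightarrow> ln (1 / dist x y) * f x * f y)
        = G (x, y) + ln (1 / \<epsilon>) * E (x, y)"
    proof (rule AE_I2)
      fix x :: 'a
      show "AE y in lborel. (case (x, y) of (x, y) \<Rightarrow> ln (1 / dist x y) * f x * f y)
        = G (x, y) + ln (1 / \<epsilon>) * E (x, y)"
        using AE_lborel_singleton[of x]
      proof eventually_elim
        case (elim y)
        then have "ln (1 / dist x y) = ln (\<epsilon> / dist x y) + ln (1 / \<epsilon>)"
          using \<epsilon> by (simp add: ln_div)
        then show ?case unfolding G_def E_def by (simp add: algebra_simps)
      qed
    qed
  qed
  have "(\<integral>\<omega>. (h \<omega> f)\<^sup>2 \<partial>M) = (\<integral>(x, y). ln (1 / dist x y) * f x * f y \<partial>?P)"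
    using h f f0 test_function_schwartz[OF f] unfolding LGF_def schwartz0_def by (simp add: power2_eq_square)
  also have "\<dots> = (\<integral>p. G p + ln (1 / \<epsilon>) * E p \<partial>?P)"
    by (rule integral_cong_AE[OF _ _ split]) measurable
  also have "\<dots> = integral\<^sup>L ?P G"
    using G_int E_int by (simp add: E_0)
  also have "\<dots> \<le> (\<integral>p. norm (G p) \<partial>?P)"
    by (intro integral_mono integrable_norm G_int) simp
  also have "\<dots> \<le> V"
  proof -
    have "ennreal (\<integral>p. norm (G p) \<partial>?P) = (\<integral>\<^sup>+p. ennreal (norm (G p)) \<partial>?P)"
      by (intro nn_integral_eq_integral[symmetric] integrable_norm G_int) simp
    also note G_bound
    finally show ?thesis using \<open>V \<ge> 0\<close> by simp
  qed
  finally show ?thesis .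
qed

context
  fixes \<psi> :: "'a::euclidean_space \<Rightarrow> real"
  assumes kernel: "smoothing_kernel \<psi>"
begin

lemma prob_space_rescale:
  assumes "prob_space \<mu>" "sets \<mu> = sets borel"
  shows "prob_space (rescale \<mu> z \<epsilon>)" "sets (rescale \<mu> z \<epsilon>) = sets borel"
proof -
  interpret prob_space \<mu> by fact
  note [measurable_cong] = assms(2)
  show "prob_space (rescale \<mu> z \<epsilon>)" unfolding rescale_def by (rule prob_space_distr) measurable
  show "sets (rescale \<mu> z \<epsilon>) = sets borel" unfolding rescale_def by simp
qed

lemma convolve_nonneg: "convolve \<mu> (scaled_kernel \<psi> n) x \<ge> 0"
  unfolding convolve_def by (intro Bochner_Integration.integral_nonneg scaled_kernel_nonneg[OF kernel])

lemma convolve_rescale_test_function: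
  assumes \<mu>: "prob_space \<mu>" "sets \<mu> = sets borel" "AE a in \<mu>. norm a \<le> 1" and n: "n > 0"
  shows "test_function (convolve (rescale \<mu> z \<epsilon>) (scaled_kernel \<psi> n))"
    and "integral\<^sup>L lborel (convolve (rescale \<mu> z \<epsilon>) (scaled_kernel \<psi> n)) = 1"
proof -
  note [measurable_cong] = \<mu>(2)
  note p = prob_space_rescale[OF \<mu>(1,2), of z \<epsilon>]
  have "AE y in rescale \<mu> z \<epsilon>. norm y \<le> norm z + \<bar>\<epsilon>\<bar>"
    unfolding rescale_def
  proof (subst AE_distr_iff)
    show "AE y in \<mu>. norm (z + \<epsilon> *\<^sub>R y) \<le> norm z + \<bar>\<epsilon>\<bar>"
      using \<mu>(3)
    proof eventually_elim
      case (elim a)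
      have "norm (z + \<epsilon> *\<^sub>R a) \<le> norm z + \<bar>\<epsilon>\<bar> * norm a"
        using norm_triangle_ineq[of z "\<epsilon> *\<^sub>R a"] by simp
      also have "\<dots> \<le> norm z + \<bar>\<epsilon>\<bar> * 1" using elim by (intro add_left_mono mult_left_mono) auto
      finally show ?case by simp
    qed
  qed measurable
  then show t: "test_function (convolve (rescale \<mu> z \<epsilon>) (scaled_kernel \<psi> n))"
    by (intro test_function_convolve[OF test_function_scaled_kernel[OF kernel n] p])
  have "ennreal (integral\<^sup>L lborel (convolve (rescale \<mu> z \<epsilon>) (scaled_kernel \<psi> n)))
      = (\<integral>\<^sup>+x. ennreal (convolve (rescale \<mu> z \<epsilon>) (scaled_kernel \<psi> n) x) \<partial>lborel)"
    by (intro nn_integral_eq_integral[symmetric] test_function_integrable t) (simp add: convolve_nonneg)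
  \<comment> \<open>Averaging the constant 1 gives the total mass. Unit mass is what makes
    differences of such densities mean-zero.\<close>
  also have "\<dots> = 1"
    using nn_integral_convolve[OF kernel _ p n, of "\<lambda>_. 1"]
    by (simp add: kernel_mass[OF kernel] prob_space.emeasure_space_1[OF p(1)])
  finally show "integral\<^sup>L lborel (convolve (rescale \<mu> z \<epsilon>) (scaled_kernel \<psi> n)) = 1"
    by simp
qed

text \<open>The point mass has infinite logarithmic energy and is not admissible. It enters only
  through these three facts, always mollified at a scale where the macroscopic energy bound
  applies.\<close>

lemma prob_space_return_0:
  "prob_space (return borel (0::'a))" "sets (return borel (0::'a)) = sets borel"
  "AE a in return borel (0::'a). norm a \<le> 1"
  by (auto intro: prob_space_return simp: AE_return)

text \<open>The mollified point mass \<open>return borel 0\<close> at scale \<open>1 / m \<approx> \<epsilon>\<close> serves as an intermediate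
  field: comparing both mollifiers with it avoids the mixed energy of \<open>\<rho>\<close> and \<open>\<sigma>\<close>.\<close>

lemma comparison_energy_bound:
  assumes "admissible_mollifier \<rho>"
  obtains V :: real where "V \<ge> 0" "\<And>z \<epsilon> n m. \<epsilon> > 0 \<Longrightarrow> n > 0 \<Longrightarrow> m > 0 \<Longrightarrow> 1 / (real n * \<epsilon>) \<le> 1 \<Longrightarrow>
    1 / 2 \<le> 1 / (real m * \<epsilon>) \<Longrightarrow> 1 / (real m * \<epsilon>) \<le> 1 \<Longrightarrow>
    (\<integral>\<^sup>+x. (\<integral>\<^sup>+y. ennreal \<bar>ln (\<epsilon> / dist x y)\<bar> *
        ennreal (convolve (rescale \<rho> z \<epsilon>) (scaled_kernel \<psi> n) y
          + convolve (rescale (return borel 0) z \<epsilon>) (scaled_kernel \<psi> m) y) \<partial>lborel) *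
        ennreal (convolve (rescale \<rho> z \<epsilon>) (scaled_kernel \<psi> n) x
          + convolve (rescale (return borel 0) z \<epsilon>) (scaled_kernel \<psi> m) x) \<partial>lborel) \<le> ennreal V"
proof -
  note \<rho> = admissible_mollifierD[OF assms]
  note \<iota> = prob_space_return_0
  obtain C where C: "C \<ge> 0" "\<And>\<mu> \<nu> \<delta> \<eta>. prob_space \<mu> \<Longrightarrow> prob_space \<nu> \<Longrightarrow>
    AE a in \<mu>. norm a \<le> 1 \<Longrightarrow> AE b in \<nu>. norm b \<le> 1 \<Longrightarrow> 0 \<le> \<delta> \<Longrightarrow> \<delta> \<le> 1 \<Longrightarrow> 1 / 2 \<le> \<eta> \<Longrightarrow> \<eta> \<le> 1 \<Longrightarrow>
    mollified_log_energy \<psi> \<mu> \<delta> \<nu> \<eta> \<le> ennreal C"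
    using mollified_log_energy_macroscopic[OF kernel] by metis
  obtain C' where C': "C' \<ge> 0"
    "\<And>\<delta>. 0 < \<delta> \<Longrightarrow> \<delta> \<le> 1 \<Longrightarrow> mollified_log_energy \<psi> \<rho> \<delta> \<rho> \<delta> \<le> ennreal C'"
    using mollified_log_energy_diagonal[OF kernel \<rho>] by metis
  show ?thesis
  \<comment> \<open>Of the four energies in the expansion, \<open>C'\<close> bounds that of \<rho>
    with itself, and \<open>C\<close> each of the three that involve the point mass.\<close>
  proof (rule that[of "C' + 3 * C"])
    show "C' + 3 * C \<ge> 0" using C(1) C'(1) by simp
    fix z \<epsilon> n m
    assume \<epsilon>: "\<epsilon> > 0" and n: "n > (0::nat)" and m: "m > (0::nat)" and n1: "1 / (real n * \<epsilon>) \<le> 1"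
      and m1: "1 / 2 \<le> 1 / (real m * \<epsilon>)" "1 / (real m * \<epsilon>) \<le> 1"
    define f where "f = convolve (rescale \<rho> z \<epsilon>) (scaled_kernel \<psi> n)"
    define g where "g = convolve (rescale (return borel 0) z \<epsilon>) (scaled_kernel \<psi> m)"
    have [measurable]: "f \<in> borel_measurable borel" "g \<in> borel_measurable borel"
      unfolding f_def g_def by (intro convolve_rescale_measurable[OF kernel] \<rho> \<iota> n m)+
    have nonneg: "f x \<ge> 0" "g x \<ge> 0" for x unfolding f_def g_def by (rule convolve_nonneg)+
    define J where "J u v = (\<integral>\<^sup>+x. (\<integral>\<^sup>+y. ennreal \<bar>ln (\<epsilon> / dist x y)\<bar> * ennreal (u y) \<partial>lborel) * ennreal (v x) \<partial>lborel)"
      for u v :: "'a \<Rightarrow> real"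
    have "J (\<lambda>x. f x + g x) (\<lambda>x. f x + g x) = J f f + J f g + (J g f + J g g)"
    proof -
      have "J (\<lambda>x. f x + g x) (\<lambda>x. f x + g x) = (\<integral>\<^sup>+x. 
         (\<integral>\<^sup>+y. ennreal \<bar>ln (\<epsilon> / dist x y)\<bar> * ennreal (f y) \<partial>lborel) * ennreal (f x) +
         (\<integral>\<^sup>+y. ennreal \<bar>ln (\<epsilon> / dist x y)\<bar> * ennreal (f y) \<partial>lborel) * ennreal (g x) +
         ((\<integral>\<^sup>+y. ennreal \<bar>ln (\<epsilon> / dist x y)\<bar> * ennreal (g y) \<partial>lborel) * ennreal (f x) +
         (\<integral>\<^sup>+y. ennreal \<bar>ln (\<epsilon> / dist x y)\<bar> * ennreal (g y) \<partial>lborel) * ennreal (g x)) \<partial>lborel)"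
        unfolding J_def using nonneg
        by (intro nn_integral_cong) (simp add: distrib_left distrib_right nn_integral_add add_ac)
      also have "\<dots> = J f f + J f g + (J g f + J g g)"
        unfolding J_def by (subst nn_integral_add; measurable)+
      finally show ?thesis .
    qed
    \<comment> \<open>The macroscopic bound wants the coarse scale in the inner integral, so both
      mixed terms are written with the point mass there.\<close>
    also have "J f g = J g f"
    proof -
      have "J f g = (\<integral>\<^sup>+x. (\<integral>\<^sup>+y. ennreal \<bar>ln (\<epsilon> / dist x y)\<bar> * ennreal (f y) * ennreal (g x) \<partial>lborel) \<partial>lborel)"
        unfolding J_def by (intro nn_integral_cong nn_integral_multc[symmetric]) measurable
      also have "\<dots> = (\<integral>\<^sup>+y. (\<integral>\<^sup>+x. ennreal \<bar>ln (\<epsilon> / dist x y)\<bar> * ennreal (f y) * ennreal (g x) \<partial>lborel) \<partial>lborel)"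
        by (rule lborel_pair.Fubini'[symmetric]) measurable
      also have "\<dots> = (\<integral>\<^sup>+y. (\<integral>\<^sup>+x. ennreal \<bar>ln (\<epsilon> / dist y x)\<bar> * ennreal (g x) * ennreal (f y) \<partial>lborel) \<partial>lborel)"
        by (simp add: dist_commute mult_ac)
      also have "\<dots> = J g f"
        unfolding J_def by (intro nn_integral_cong nn_integral_multc) measurable
      finally show ?thesis .
    qed
    also have "J f f = mollified_log_energy \<psi> \<rho> (1 / (real n * \<epsilon>)) \<rho> (1 / (real n * \<epsilon>))"
      unfolding J_def f_def by (rule mollified_log_energy_eq[OF kernel \<rho>(1,2) \<rho>(1,2) n n \<epsilon>])
    also have "J g f = mollified_log_energy \<psi> \<rho> (1 / (real n * \<epsilon>)) (return borel 0) (1 / (real m * \<epsilon>))"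
      unfolding J_def f_def g_def by (rule mollified_log_energy_eq[OF kernel \<rho>(1,2) \<iota>(1,2) n m \<epsilon>])
    also have "J g g = mollified_log_energy \<psi> (return borel 0) (1 / (real m * \<epsilon>)) (return borel 0) (1 / (real m * \<epsilon>))"
      unfolding J_def g_def by (rule mollified_log_energy_eq[OF kernel \<iota>(1,2) \<iota>(1,2) m m \<epsilon>])
    also have "mollified_log_energy \<psi> \<rho> (1 / (real n * \<epsilon>)) \<rho> (1 / (real n * \<epsilon>)) +
      mollified_log_energy \<psi> \<rho> (1 / (real n * \<epsilon>)) (return borel 0) (1 / (real m * \<epsilon>)) +
      (mollified_log_energy \<psi> \<rho> (1 / (real n * \<epsilon>)) (return borel 0) (1 / (real m * \<epsilon>)) +
       mollified_log_energy \<psi> (return borel 0) (1 / (real m * \<epsilon>)) (return borel 0) (1 / (real m * \<epsilon>)))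
      \<le> ennreal C' + ennreal C + (ennreal C + ennreal C)"
      using \<epsilon> n m n1 m1 by (intro add_mono C(2) C'(2) \<rho> \<iota>) auto
    also have "\<dots> = ennreal (C' + 3 * C)"
      using C(1) C'(1) by (simp flip: ennreal_plus)
    finally show "(\<integral>\<^sup>+x. (\<integral>\<^sup>+y. ennreal \<bar>ln (\<epsilon> / dist x y)\<bar> *
        ennreal (convolve (rescale \<rho> z \<epsilon>) (scaled_kernel \<psi> n) y
          + convolve (rescale (return borel 0) z \<epsilon>) (scaled_kernel \<psi> m) y) \<partial>lborel) *
        ennreal (convolve (rescale \<rho> z \<epsilon>) (scaled_kernel \<psi> n) x
          + convolve (rescale (return borel 0) z \<epsilon>) (scaled_kernel \<psi> m) x) \<partial>lborel) \<le> ennreal (C' + 3 * C)"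
      unfolding J_def f_def g_def .
  qed
qed

lemma LGF_diff:
  assumes "LGF M h" "test_function f" "test_function g" "\<omega> \<in> space M"
  shows "h \<omega> (\<lambda>x. f x - g x) = h \<omega> f - h \<omega> g"
proof -
  have "tempered_distribution (h \<omega>)" using assms unfolding LGF_def by blast
  then have "h \<omega> (\<lambda>x. 1 * f x + (- 1) * g x) = 1 * h \<omega> f + (- 1) * h \<omega> g"
    using test_function_schwartz assms(2,3) unfolding tempered_distribution_def by blast
  then show ?thesis by simp
qed

lemma LGF_gaussian:
  assumes "LGF M h" "test_function f" "integral\<^sup>L lborel f = 0"
  shows "centered_gaussian M (\<lambda>\<omega>. h \<omega> f)"
  using assms test_function_schwartz unfolding LGF_def schwartz0_def by blast

text \<open>The approximants of both pairings have mass one, so their difference lies where the law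
  of \<open>h\<close> is prescribed. Measures and base points are independent of each other here,
  because the lemma serves twice: for two mollifiers at one point and scale, and for one mollifier
  at two points and scales.\<close>

lemma pairing_diff_gaussian_tail:
  assumes M: "prob_space M" and h: "LGF M h"
    and \<mu>: "prob_space \<mu>" "sets \<mu> = sets borel" "AE a in \<mu>. norm a \<le> 1"
    and \<nu>: "prob_space \<nu>" "sets \<nu> = sets borel" "AE a in \<nu>. norm a \<le> 1"
    and X: "is_pairing M \<psi> h (rescale \<mu> z \<epsilon>) X" and Y: "is_pairing M \<psi> h (rescale \<nu> w r) Y"
    and V: "(\<integral>\<omega>. (X \<omega> - Y \<omega>)\<^sup>2 \<partial>M) \<le> V" "V > 0" and t: "t > 0"
  shows "measure M {\<omega> \<in> space M. t \<le> \<bar>X \<omega> - Y \<omega>\<bar>} \<le> 2 * exp (- t\<^sup>2 / (64 * V))"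
proof -
  define f where "f n = convolve (rescale \<mu> z \<epsilon>) (scaled_kernel \<psi> (Suc n))" for n
  define g where "g n = convolve (rescale \<nu> w r) (scaled_kernel \<psi> (Suc n))" for n
  have f: "test_function (f n)" "integral\<^sup>L lborel (f n) = 1" for n
    unfolding f_def by (rule convolve_rescale_test_function[OF \<mu>]; simp)+
  have g: "test_function (g n)" "integral\<^sup>L lborel (g n) = 1" for n
    unfolding g_def by (rule convolve_rescale_test_function[OF \<nu>]; simp)+
  have "L2_limit M (\<lambda>n \<omega>. h \<omega> (f n) - h \<omega> (g n)) (\<lambda>\<omega>. X \<omega> - Y \<omega>)"
    using L2_limit_diff[OF X[unfolded is_pairing_def] Y[unfolded is_pairing_def]]
    unfolding f_def g_def .
  then have lim: "L2_limit M (\<lambda>n \<omega>. h \<omega> (\<lambda>x. f n x - g n x)) (\<lambda>\<omega>. X \<omega> - Y \<omega>)"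
    by (rule L2_limit_cong) (simp add: LGF_diff[OF h] f g)
  have "centered_gaussian M (\<lambda>\<omega>. h \<omega> (\<lambda>x. f n x - g n x))" for n
    by (intro LGF_gaussian[OF h] test_function_diff f g) (simp add: f g test_function_integrable)
  from L2_limit_gaussian_tail[OF M lim this V t] show ?thesis .
qed

text \<open>Inserting the intermediate density \<open>g\<close> turns the difference of the
  approximants into \<open>(f n - g) - (k n - g)\<close>. Both brackets are mean-zero, and each
  involves one mollifier only.\<close>

lemma pairing_diff_variance_bound:
  assumes h: "LGF M h" and "admissible_mollifier \<rho>" "admissible_mollifier \<sigma>"
  obtains V :: real where "V > 0" "\<And>z \<epsilon> X Y. 0 < \<epsilon> \<Longrightarrow> \<epsilon> \<le> 1 \<Longrightarrow> is_pairing M \<psi> h (rescale \<rho> z \<epsilon>) X \<Longrightarrow>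
    is_pairing M \<psi> h (rescale \<sigma> z \<epsilon>) Y \<Longrightarrow> (\<integral>\<omega>. (X \<omega> - Y \<omega>)\<^sup>2 \<partial>M) \<le> V"
proof -
  \<comment> \<open>For \<epsilon> at most 1, rounding \<open>1 / \<epsilon>\<close> up to
    \<open>m\<close> puts \<open>1 / (m * \<epsilon>)\<close> between 1/2 and 1.\<close>
  define g where "g z \<epsilon> = convolve (rescale (return borel 0) z \<epsilon>) (scaled_kernel \<psi> (nat \<lceil>1 / \<epsilon>\<rceil>))" for z \<epsilon>
  have "\<exists>V\<ge>0. \<forall>z \<epsilon> n. 0 < \<epsilon> \<longrightarrow> \<epsilon> \<le> 1 \<longrightarrow> 1 / \<epsilon> \<le> real n \<longrightarrow>
      L2_rv M (\<lambda>\<omega>. h \<omega> (\<lambda>x. convolve (rescale \<mu> z \<epsilon>) (scaled_kernel \<psi> n) x - g z \<epsilon> x)) \<and>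
      (\<integral>\<omega>. (h \<omega> (\<lambda>x. convolve (rescale \<mu> z \<epsilon>) (scaled_kernel \<psi> n) x - g z \<epsilon> x))\<^sup>2 \<partial>M) \<le> V"
    if \<mu>: "admissible_mollifier \<mu>" for \<mu>
  proof -
    note \<mu>' = admissible_mollifierD[OF \<mu>]
    show ?thesis
    proof (rule comparison_energy_bound[OF \<mu>], goal_cases)
      case V: (1 V)
      show ?case
      proof (intro exI[of _ V] conjI V(1) allI impI)
        fix z :: 'a and \<epsilon> :: real and n :: nat
        assume \<epsilon>: "0 < \<epsilon>" "\<epsilon> \<le> 1" and n: "1 / \<epsilon> \<le> real n"
        define m where "m = nat \<lceil>1 / \<epsilon>\<rceil>"
        have "1 / \<epsilon> \<ge> 1" using \<epsilon> by simp
        then have m: "1 / \<epsilon> \<le> real m" "real m \<le> 1 / \<epsilon> + 1" "m > 0"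
          unfolding m_def by linarith+
        have "real n \<ge> 1" using n \<open>1 / \<epsilon> \<ge> 1\<close> by linarith
        then have n0: "n > 0" by simp
        have n1: "1 / (real n * \<epsilon>) \<le> 1" "1 / (real m * \<epsilon>) \<le> 1" using n m(1,3) n0 \<epsilon> by (auto simp: field_simps)
        have "real m * \<epsilon> \<le> (1 / \<epsilon> + 1) * \<epsilon>" using m(2) \<epsilon> by (intro mult_right_mono) auto
        also have "\<dots> \<le> 2" using \<epsilon> by (simp add: algebra_simps)
        finally have m1: "1 / 2 \<le> 1 / (real m * \<epsilon>)" using m(3) \<epsilon> by (intro divide_left_mono) auto
        let ?f = "convolve (rescale \<mu> z \<epsilon>) (scaled_kernel \<psi> n)"
        let ?g = "convolve (rescale (return borel 0) z \<epsilon>) (scaled_kernel \<psi> m)"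
        note f = convolve_rescale_test_function[OF \<mu>'(1,2,3) n0, of z \<epsilon>]
        note g = convolve_rescale_test_function[OF prob_space_return_0 m(3), of z \<epsilon>]
        have d: "test_function (\<lambda>x. ?f x - ?g x)" "(\<integral>x. ?f x - ?g x \<partial>lborel) = 0"
          by (intro test_function_diff f g) (simp add: f g test_function_integrable)
        have g_eq: "g z \<epsilon> = ?g" unfolding g_def m_def ..
        have "centered_gaussian M (\<lambda>\<omega>. h \<omega> (\<lambda>x. ?f x - ?g x))"
          by (rule LGF_gaussian[OF h d])
        then show "L2_rv M (\<lambda>\<omega>. h \<omega> (\<lambda>x. ?f x - g z \<epsilon> x))"
          unfolding g_eq by (rule centered_gaussian_L2_rv)
        have "(\<integral>\<omega>. (h \<omega> (\<lambda>x. ?f x - ?g x))\<^sup>2 \<partial>M) \<le> V"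
        proof (rule LGF_variance_le[OF h d _ _ \<epsilon>(1) V(2)[OF \<epsilon>(1) n0 m(3) n1(1) m1 n1(2)] V(1)])
          show "(\<lambda>x. ?f x + ?g x) \<in> borel_measurable borel"
            by (intro borel_measurable_add convolve_rescale_measurable[OF kernel] \<mu>' prob_space_return_0 n0 m)
          show "\<bar>?f x - ?g x\<bar> \<le> ?f x + ?g x" for x
            using convolve_nonneg[of "rescale \<mu> z \<epsilon>" n x] convolve_nonneg[of "rescale (return borel 0) z \<epsilon>" m x] by linarith
        qed
        then show "(\<integral>\<omega>. (h \<omega> (\<lambda>x. ?f x - g z \<epsilon> x))\<^sup>2 \<partial>M) \<le> V" unfolding g_eq .
      qed
    qed
  qed
  note ex = this
  obtain V where V: "V \<ge> 0" "\<And>z \<epsilon> n. 0 < \<epsilon> \<Longrightarrow> \<epsilon> \<le> 1 \<Longrightarrow> 1 / \<epsilon> \<le> real n \<Longrightarrow>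
      L2_rv M (\<lambda>\<omega>. h \<omega> (\<lambda>x. convolve (rescale \<rho> z \<epsilon>) (scaled_kernel \<psi> n) x - g z \<epsilon> x)) \<and>
      (\<integral>\<omega>. (h \<omega> (\<lambda>x. convolve (rescale \<rho> z \<epsilon>) (scaled_kernel \<psi> n) x - g z \<epsilon> x))\<^sup>2 \<partial>M) \<le> V"
    using ex[OF assms(2)] by blast
  obtain W where W: "W \<ge> 0" "\<And>z \<epsilon> n. 0 < \<epsilon> \<Longrightarrow> \<epsilon> \<le> 1 \<Longrightarrow> 1 / \<epsilon> \<le> real n \<Longrightarrow>
      L2_rv M (\<lambda>\<omega>. h \<omega> (\<lambda>x. convolve (rescale \<sigma> z \<epsilon>) (scaled_kernel \<psi> n) x - g z \<epsilon> x)) \<and>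
      (\<integral>\<omega>. (h \<omega> (\<lambda>x. convolve (rescale \<sigma> z \<epsilon>) (scaled_kernel \<psi> n) x - g z \<epsilon> x))\<^sup>2 \<partial>M) \<le> W"
    using ex[OF assms(3)] by blast
  show ?thesis
  \<comment> \<open>The inner factors 2 come from splitting through \<open>g\<close>, the outer one
    from \<open>L2_limit_norm_le\<close>, and the 1 makes the bound strictly positive.\<close>
  proof (rule that[of "2 * (2 * V + 2 * W) + 1"])
    show "2 * (2 * V + 2 * W) + 1 > 0" using V(1) W(1) by simp
    fix z \<epsilon> X Y
    assume \<epsilon>: "0 < \<epsilon>" "\<epsilon> \<le> 1" and X: "is_pairing M \<psi> h (rescale \<rho> z \<epsilon>) X" and Y: "is_pairing M \<psi> h (rescale \<sigma> z \<epsilon>) Y"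
    define f where "f n = convolve (rescale \<rho> z \<epsilon>) (scaled_kernel \<psi> (Suc n))" for n
    define k where "k n = convolve (rescale \<sigma> z \<epsilon>) (scaled_kernel \<psi> (Suc n))" for n
    have test: "test_function (f n)" "test_function (k n)" "test_function (g z \<epsilon>)" for n
      unfolding f_def k_def g_def
      using admissible_mollifierD[OF assms(2)] admissible_mollifierD[OF assms(3)] prob_space_return_0 \<epsilon>
      by (auto intro!: convolve_rescale_test_function)
    have lim: "L2_limit M (\<lambda>n \<omega>. h \<omega> (f n) - h \<omega> (k n)) (\<lambda>\<omega>. X \<omega> - Y \<omega>)"
      using L2_limit_diff[OF X[unfolded is_pairing_def] Y[unfolded is_pairing_def]]
      unfolding f_def k_def .
    \<comment> \<open>The energy bound holds once the mollification is finer than \<epsilon>; how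
      late this happens depends on \<epsilon>, but the resulting bound does not.\<close>
    have "\<forall>\<^sub>F n in sequentially. 1 / \<epsilon> \<le> real (Suc n)"
      by real_asymp
    then have "\<forall>\<^sub>F n in sequentially. (\<integral>\<omega>. (h \<omega> (f n) - h \<omega> (k n))\<^sup>2 \<partial>M) \<le> 2 * V + 2 * W"
    proof eventually_elim
      case (elim n)
      note v = V(2)[OF \<epsilon> elim, of z, folded f_def] and w = W(2)[OF \<epsilon> elim, of z, folded k_def]
      have "(\<integral>\<omega>. (h \<omega> (f n) - h \<omega> (k n))\<^sup>2 \<partial>M)
          = (\<integral>\<omega>. (h \<omega> (\<lambda>x. f n x - g z \<epsilon> x) - h \<omega> (\<lambda>x. k n x - g z \<epsilon> x))\<^sup>2 \<partial>M)"
        by (intro Bochner_Integration.integral_cong refl) (simp add: LGF_diff[OF h] test)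
      also have "\<dots> \<le> 2 * (\<integral>\<omega>. (h \<omega> (\<lambda>x. f n x - g z \<epsilon> x))\<^sup>2 \<partial>M) + 2 * (\<integral>\<omega>. (h \<omega> (\<lambda>x. k n x - g z \<epsilon> x))\<^sup>2 \<partial>M)"
        using v w by (intro L2_norm_diff_le) auto
      also have "\<dots> \<le> 2 * V + 2 * W"
        using v w by simp
      finally show ?case .
    qed
    from L2_limit_norm_le[OF lim this]
    show "(\<integral>\<omega>. (X \<omega> - Y \<omega>)\<^sup>2 \<partial>M) \<le> 2 * (2 * V + 2 * W) + 1" by simp
  qed
qed

end

section \<open>Almost sure comparison of mollified fields\<close>

text \<open>\<open>pairing\<close> is a Hilbert choice. Any known version \<open>X\<close> shows
  that the choice succeeds and agrees with it almost surely, which allows Condition (A_p), stated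
  for \<open>pairing\<close>, to be used for the continuous modifications.\<close>

lemma pairing_is_pairing:
  assumes "is_pairing M \<psi> h \<mu> X"
  shows "is_pairing M \<psi> h \<mu> (pairing M \<psi> h \<mu>)" "AE \<omega> in M. pairing M \<psi> h \<mu> \<omega> = X \<omega>"
proof -
  show p: "is_pairing M \<psi> h \<mu> (pairing M \<psi> h \<mu>)"
    unfolding pairing_def by (rule someI[of "is_pairing M \<psi> h \<mu>", OF assms])
  show "AE \<omega> in M. pairing M \<psi> h \<mu> \<omega> = X \<omega>"
    using p assms unfolding is_pairing_def by (rule L2_limit_unique)
qed

lemma condition_A_variance:
  fixes \<rho> :: "'a::euclidean_space measure"
  assumes A: "condition_A M \<psi> h p \<rho>" and H: "continuous_mollified_field M \<psi> h \<rho> H"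
  obtains C :: real where "C > 0" "\<And>z w \<epsilon> r. \<epsilon> \<in> {0<..1} \<Longrightarrow> r \<in> {0<..1} \<Longrightarrow> 1/2 \<le> \<epsilon> / r \<Longrightarrow> \<epsilon> / r \<le> 2 \<Longrightarrow>
    (\<integral>\<omega>. (H \<epsilon> z \<omega> - H r w \<omega>)\<^sup>2 \<partial>M) \<le> C * (norm ((z, \<epsilon>) - (w, r)) / min \<epsilon> r) powr p"
proof -
  obtain C where C: "\<And>z w \<epsilon> r. \<epsilon> \<in> {0<..1} \<Longrightarrow> r \<in> {0<..1} \<Longrightarrow> 1/2 \<le> \<epsilon> / r \<and> \<epsilon> / r \<le> 2 \<Longrightarrow>
        (\<integral>\<omega>. (pairing M \<psi> h (rescale \<rho> z \<epsilon>) \<omega> - pairing M \<psi> h (rescale \<rho> w r) \<omega>)\<^sup>2 \<partial>M)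
          \<le> C * (norm ((z, \<epsilon>) - (w, r)) / min \<epsilon> r) powr p"
    using A unfolding condition_A_def by blast
  show ?thesis
  \<comment> \<open>The constant is made positive because the Gaussian tail bound divides by the
    variance bound.\<close>
  proof (rule that[of "max C 1"])
    fix z w :: 'a and \<epsilon> r :: real assume *: "\<epsilon> \<in> {0<..1}" "r \<in> {0<..1}" "1/2 \<le> \<epsilon> / r" "\<epsilon> / r \<le> 2"
    have P: "is_pairing M \<psi> h (rescale \<rho> z \<epsilon>) (H \<epsilon> z)" "is_pairing M \<psi> h (rescale \<rho> w r) (H r w)"
      using H * unfolding continuous_mollified_field_def by auto
    note Q = pairing_is_pairing[OF P(1)] pairing_is_pairing[OF P(2)]
    have [measurable]: "H \<epsilon> z \<in> borel_measurable M" "H r w \<in> borel_measurable M"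
      "pairing M \<psi> h (rescale \<rho> z \<epsilon>) \<in> borel_measurable M" "pairing M \<psi> h (rescale \<rho> w r) \<in> borel_measurable M"
      using P Q(1,3) unfolding is_pairing_def L2_limit_def L2_rv_def by blast+
    have "(\<integral>\<omega>. (H \<epsilon> z \<omega> - H r w \<omega>)\<^sup>2 \<partial>M) =
      (\<integral>\<omega>. (pairing M \<psi> h (rescale \<rho> z \<epsilon>) \<omega> - pairing M \<psi> h (rescale \<rho> w r) \<omega>)\<^sup>2 \<partial>M)"
    proof (rule integral_cong_AE)
      show "AE \<omega> in M. (H \<epsilon> z \<omega> - H r w \<omega>)\<^sup>2 =
          (pairing M \<psi> h (rescale \<rho> z \<epsilon>) \<omega> - pairing M \<psi> h (rescale \<rho> w r) \<omega>)\<^sup>2"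
        using Q(2,4) by eventually_elim simp
    qed measurable
    also have "\<dots> \<le> C * (norm ((z, \<epsilon>) - (w, r)) / min \<epsilon> r) powr p"
      using C * by blast
    also have "\<dots> \<le> max C 1 * (norm ((z, \<epsilon>) - (w, r)) / min \<epsilon> r) powr p"
      by (intro mult_right_mono) auto
    finally show "(\<integral>\<omega>. (H \<epsilon> z \<omega> - H r w \<omega>)\<^sup>2 \<partial>M) \<le> max C 1 * (norm ((z, \<epsilon>) - (w, r)) / min \<epsilon> r) powr p" .
  qed simp
qed

text \<open>An affine chart that maps the unit cube of space times scale onto a spatial cube of side
  \<open>1 / 2 ^ n\<close> with corner \<open>k / 2 ^ n\<close>, times the scales from
  \<open>1 / 2 ^ Suc n\<close> to \<open>1 / 2 ^ n\<close>. Any two of these scales have a ratio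
  between 1/2 and 2.\<close>

definition dyadic_cell :: "nat \<Rightarrow> 'a::euclidean_space \<Rightarrow> 'a \<times> real \<Rightarrow> 'a \<times> real" where
  "dyadic_cell n k x = ((1 / 2 ^ n) *\<^sub>R (k + fst x), (1 + snd x) / 2 ^ Suc n)"

lemma cbox_One_Pair: "x \<in> cbox 0 (One :: 'a::euclidean_space \<times> real) \<longleftrightarrow>
    (\<forall>b\<in>Basis. 0 \<le> fst x \<bullet> b \<and> fst x \<bullet> b \<le> 1) \<and> 0 \<le> snd x \<and> snd x \<le> 1"
proof -
  have "x \<in> cbox 0 One \<longleftrightarrow> (\<forall>b\<in>Basis. 0 \<le> x \<bullet> b \<and> x \<bullet> b \<le> 1)"
    by (simp add: mem_box)
  then show ?thesis by (cases x) (auto simp: Basis_prod_def)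
qed

lemma dyadic_cell_scale:
  assumes "x \<in> cbox 0 One"
  shows "snd (dyadic_cell n k x) \<in> {0<..1}" "1 / 2 ^ Suc n \<le> snd (dyadic_cell n k x)"
    "snd (dyadic_cell n k x) \<le> 1 / 2 ^ n"
proof -
  have s: "0 \<le> snd x" "snd x \<le> 1" using assms unfolding cbox_One_Pair by auto
  show "1 / 2 ^ Suc n \<le> snd (dyadic_cell n k x)" "snd (dyadic_cell n k x) \<le> 1 / 2 ^ n"
    unfolding dyadic_cell_def using s by (auto simp: field_simps)
  moreover have "1 / 2 ^ n \<le> (1::real)" "0 < 1 / (2::real) ^ Suc n" by simp_all
  ultimately show "snd (dyadic_cell n k x) \<in> {0<..1}"
    by (metis greaterThanAtMost_iff le_less_trans less_le_trans order_trans)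
qed

text \<open>The left side is the quantity in Condition (A_p). The chart contracts by at least
  \<open>2 ^ n\<close> and scales are at least \<open>1 / 2 ^ Suc n\<close>, so the dependence on
  \<open>n\<close> cancels and every cell has the same modulus of continuity in the chart.\<close>

lemma dyadic_cell_dist:
  assumes x: "x \<in> cbox 0 One" and y: "y \<in> cbox 0 One"
  shows "norm (dyadic_cell n k x - dyadic_cell n k y) /
    min (snd (dyadic_cell n k x)) (snd (dyadic_cell n k y)) \<le> 2 * dist x y"
proof -
  have "dyadic_cell n k x - dyadic_cell n k y
      = (1 / 2 ^ n) *\<^sub>R (fst x - fst y, (snd x - snd y) / 2)"
    unfolding dyadic_cell_def by (simp add: algebra_simps diff_divide_distrib add_divide_distrib)
  then have "norm (dyadic_cell n k x - dyadic_cell n k y)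
      = (1 / 2 ^ n) * norm (fst x - fst y, (snd x - snd y) / 2)"
    by (simp only: norm_scaleR) simp
  also have "\<dots> \<le> (1 / 2 ^ n) * dist x y"
    unfolding dist_norm norm_prod_def
    by (intro mult_left_mono real_sqrt_le_mono add_left_mono) (auto simp: power_divide)
  finally have num: "norm (dyadic_cell n k x - dyadic_cell n k y) \<le> (1 / 2 ^ n) * dist x y" .
  have den: "1 / 2 ^ Suc n \<le> min (snd (dyadic_cell n k x)) (snd (dyadic_cell n k y))"
    using dyadic_cell_scale(2)[OF x] dyadic_cell_scale(2)[OF y] by simp
  have "norm (dyadic_cell n k x - dyadic_cell n k y) /
      min (snd (dyadic_cell n k x)) (snd (dyadic_cell n k y)) \<le> ((1 / 2 ^ n) * dist x y) / (1 / 2 ^ Suc n)"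
    using num den by (intro frac_le) auto
  then show ?thesis by simp
qed

text \<open>The corner is the integer part of \<open>2 ^ n *\<^sub>R z\<close>, and \<open>x\<close>
  is obtained by inverting the chart. The bound on \<open>j\<close> keeps the corner in a finite box
  when \<open>z\<close> is bounded.\<close>

lemma dyadic_cell_covers:
  fixes z :: "'a::euclidean_space"
  assumes \<epsilon>: "1 / 2 ^ Suc n < \<epsilon>" "\<epsilon> \<le> 1 / 2 ^ n"
  obtains j :: "'a \<Rightarrow> int" and x where "x \<in> cbox 0 One" "\<And>b. b \<in> Basis \<Longrightarrow> \<bar>j b\<bar> \<le> \<lceil>2 ^ n * \<bar>z \<bullet> b\<bar>\<rceil>"
    "dyadic_cell n (\<Sum>b\<in>Basis. of_int (j b) *\<^sub>R b) x = (z, \<epsilon>)"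
proof
  let ?j = "\<lambda>b. \<lfloor>2 ^ n * (z \<bullet> b)\<rfloor>"
  let ?k = "\<Sum>b\<in>(Basis::'a set). of_int (?j b) *\<^sub>R b"
  let ?x = "(2 ^ n *\<^sub>R z - ?k, 2 ^ Suc n * \<epsilon> - 1)"
  show "?x \<in> cbox 0 One"
    unfolding cbox_One_Pair
  proof (intro conjI ballI)
    fix b :: 'a assume b: "b \<in> Basis"
    then have "fst ?x \<bullet> b = 2 ^ n * (z \<bullet> b) - of_int (?j b)" by (simp add: inner_diff_left)
    then show "0 \<le> fst ?x \<bullet> b" "fst ?x \<bullet> b \<le> 1" by linarith+
  next
    show "0 \<le> snd ?x" "snd ?x \<le> 1" using \<epsilon> by (auto simp: field_simps)
  qed
  show "\<bar>?j b\<bar> \<le> \<lceil>2 ^ n * \<bar>z \<bullet> b\<bar>\<rceil>" for b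
  proof (cases "z \<bullet> b \<ge> 0")
    case True
    then show ?thesis by (simp add: floor_le_ceiling)
  next
    case False
    then have "?j b \<le> 0" by (simp add: floor_le_iff mult_less_0_iff mult_pos_neg less_trans[of _ 0 1])
    moreover have "- ?j b = \<lceil>2 ^ n * \<bar>z \<bullet> b\<bar>\<rceil>" using False by (simp add: ceiling_def)
    ultimately show ?thesis by simp
  qed
  show "dyadic_cell n ?k ?x = (z, \<epsilon>)"
    unfolding dyadic_cell_def by simp
qed

lemma dyadic_cell_continuous_on:
  assumes "continuous_on (UNIV \<times> {0<..1}) (\<lambda>(z, \<epsilon>). H \<epsilon> z \<omega>)"
  shows "continuous_on (cbox 0 One) (\<lambda>x. H (snd (dyadic_cell n k x)) (fst (dyadic_cell n k x)) \<omega>)"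
proof -
  have "continuous_on (cbox 0 One) (dyadic_cell n k)"
    unfolding dyadic_cell_def[abs_def] by (intro continuous_intros) auto
  moreover have "dyadic_cell n k ` cbox 0 One \<subseteq> UNIV \<times> {0<..1}"
    using dyadic_cell_scale(1) by (intro image_subsetI) (simp add: mem_Times_iff del: greaterThanAtMost_iff)
  ultimately have "continuous_on (cbox 0 One) (\<lambda>x. (\<lambda>(z, \<epsilon>). H \<epsilon> z \<omega>) (dyadic_cell n k x))"
    by (rule continuous_on_compose2[OF assms])
  then show ?thesis by (simp add: split_beta)
qed

lemma dyadic_cell_increment_tail:
  fixes \<psi> :: "'a::euclidean_space \<Rightarrow> real"
  assumes M: "prob_space M" and kernel: "smoothing_kernel \<psi>" and h: "LGF M h" and \<rho>: "admissible_mollifier \<rho>"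
    and p: "p > 0" and A: "condition_A M \<psi> h p \<rho>" and H: "continuous_mollified_field M \<psi> h \<rho> H"
  obtains c where "c > 0" "\<And>n k x y u r. x \<in> cbox 0 One \<Longrightarrow> y \<in> cbox 0 One \<Longrightarrow> u > 0 \<Longrightarrow> r > 0 \<Longrightarrow> dist x y \<le> r \<Longrightarrow>
    measure M {\<omega> \<in> space M. u \<le> \<bar>H (snd (dyadic_cell n k x)) (fst (dyadic_cell n k x)) \<omega>
      - H (snd (dyadic_cell n k y)) (fst (dyadic_cell n k y)) \<omega>\<bar>} \<le> 2 * exp (- c * u\<^sup>2 / r powr p)"
proof -
  obtain C where C: "C > 0" "\<And>z w \<epsilon> r. \<epsilon> \<in> {0<..1} \<Longrightarrow> r \<in> {0<..1} \<Longrightarrow> 1/2 \<le> \<epsilon> / r \<Longrightarrow> \<epsilon> / r \<le> 2 \<Longrightarrow>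
    (\<integral>\<omega>. (H \<epsilon> z \<omega> - H r w \<omega>)\<^sup>2 \<partial>M) \<le> C * (norm ((z, \<epsilon>) - (w, r)) / min \<epsilon> r) powr p"
    by (rule condition_A_variance[OF A H]) blast
  show ?thesis
  \<comment> \<open>The 64 comes from the Gaussian tail of a mean-square limit, \<open>C\<close>
    from Condition (A_p), and \<open>2 powr p\<close> from the factor 2 in
    \<open>dyadic_cell_dist\<close>.\<close>
  proof (rule that[of "1 / (64 * C * 2 powr p)"])
    show "1 / (64 * C * 2 powr p) > 0" using C(1) by simp
    fix n and k :: 'a and x y :: "'a \<times> real" and u r :: real
    assume x: "x \<in> cbox 0 One" and y: "y \<in> cbox 0 One" and u: "u > 0" and r: "r > 0" and xy: "dist x y \<le> r"
    let ?x = "dyadic_cell n k x" and ?y = "dyadic_cell n k y"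
    note sx = dyadic_cell_scale[OF x, of n k] and sy = dyadic_cell_scale[OF y, of n k]
    have P: "is_pairing M \<psi> h (rescale \<rho> (fst ?x) (snd ?x)) (H (snd ?x) (fst ?x))"
      "is_pairing M \<psi> h (rescale \<rho> (fst ?y) (snd ?y)) (H (snd ?y) (fst ?y))"
      using H sx(1) sy(1) unfolding continuous_mollified_field_def by blast+
    have pos: "snd ?x > 0" "snd ?y > 0" using sx(1) sy(1) by auto
    have "snd ?x \<le> 2 * snd ?y" "snd ?y \<le> 2 * snd ?x" using sx(2,3) sy(2,3) by auto
    then have ratio: "1/2 \<le> snd ?x / snd ?y" "snd ?x / snd ?y \<le> 2"
      using pos by (auto simp: field_simps)
    have "(\<integral>\<omega>. (H (snd ?x) (fst ?x) \<omega> - H (snd ?y) (fst ?y) \<omega>)\<^sup>2 \<partial>M)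
        \<le> C * (norm ((fst ?x, snd ?x) - (fst ?y, snd ?y)) / min (snd ?x) (snd ?y)) powr p"
      by (rule C(2)[OF sx(1) sy(1) ratio])
    also have "\<dots> \<le> C * (2 * r) powr p"
      using C(1) p pos xy dyadic_cell_dist[OF x y, of n k]
      by (intro mult_left_mono powr_mono2) auto
    finally have V: "(\<integral>\<omega>. (H (snd ?x) (fst ?x) \<omega> - H (snd ?y) (fst ?y) \<omega>)\<^sup>2 \<partial>M) \<le> C * (2 * r) powr p" .
    note \<rho>' = admissible_mollifierD(1-3)[OF \<rho>]
    have "measure M {\<omega> \<in> space M. u \<le> \<bar>H (snd ?x) (fst ?x) \<omega> - H (snd ?y) (fst ?y) \<omega>\<bar>}
        \<le> 2 * exp (- u\<^sup>2 / (64 * (C * (2 * r) powr p)))"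
      by (rule pairing_diff_gaussian_tail[OF kernel M h \<rho>' \<rho>' P V _ u]) (use C(1) r in simp)
    also have "- u\<^sup>2 / (64 * (C * (2 * r) powr p)) = - (1 / (64 * C * 2 powr p)) * u\<^sup>2 / r powr p"
      using r by (simp add: powr_mult)
    finally show "measure M {\<omega> \<in> space M. u \<le> \<bar>H (snd ?x) (fst ?x) \<omega> - H (snd ?y) (fst ?y) \<omega>\<bar>}
        \<le> 2 * exp (- (1 / (64 * C * 2 powr p)) * u\<^sup>2 / r powr p)" .
  qed
qed

section \<open>Counting cells and summing their tails\<close>

lemma card_integer_box:
  fixes N :: nat
  defines "L \<equiv> (\<lambda>j. \<Sum>b\<in>Basis. of_int (j b) *\<^sub>R b) ` (PiE (Basis :: 'a::euclidean_space set) (\<lambda>_. {- int N..int N}))"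
  shows "finite L" "card L \<le> (2 * N + 1) ^ DIM('a)"
proof -
  have fin: "finite (PiE (Basis :: 'a set) (\<lambda>_. {- int N..int N}))" by (intro finite_PiE) auto
  then show "finite L" unfolding L_def by (rule finite_imageI)
  have "card L \<le> card (PiE (Basis :: 'a set) (\<lambda>_. {- int N..int N}))"
    unfolding L_def by (rule card_image_le[OF fin])
  also have "\<dots> = (2 * N + 1) ^ DIM('a)"
  proof -
    have "nat (1 + int N + int N) = 2 * N + 1" by simp
    then show ?thesis by (subst card_PiE) (auto simp: algebra_simps)
  qed
  finally show "card L \<le> (2 * N + 1) ^ DIM('a)" .
qed

text \<open>The number of corners in a box is at most \<open>exp (2 * d * n)\<close> for large
  \<open>n\<close>, while the tail exponent is of order \<open>n powr (3/2)\<close>, hence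
  eventually exceeds any multiple of \<open>n\<close>.\<close>

lemma summable_box_tails:
  assumes "b > (0::real)" "K \<ge> 0"
  shows "summable (\<lambda>n. real (2 * (n * 2 ^ n + 1) + 1) ^ d * (K * exp (- b * (real (Suc n) powr (3/4))\<^sup>2)))"
proof (rule summable_comparison_test_ev)
  show "summable (\<lambda>n. K * exp (- 1) ^ n :: real)"
    by (intro summable_mult summable_geometric) simp
  have "\<forall>\<^sub>F n in sequentially. real (2 * (n * 2 ^ n + 1) + 1) \<le> exp (2 * real n)"
    by real_asymp
  moreover have "\<forall>\<^sub>F n in sequentially. 2 * real d * real n - b * (real (Suc n) powr (3/4))\<^sup>2 \<le> - real n"
    using assms(1) by real_asymp
  ultimately show "\<forall>\<^sub>F n in sequentially. norm (real (2 * (n * 2 ^ n + 1) + 1) ^ d *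
      (K * exp (- b * (real (Suc n) powr (3/4))\<^sup>2))) \<le> K * exp (- 1) ^ n"
  proof eventually_elim
    case (elim n)
    have "real (2 * (n * 2 ^ n + 1) + 1) ^ d * (K * exp (- b * (real (Suc n) powr (3/4))\<^sup>2))
        \<le> exp (2 * real n) ^ d * (K * exp (- b * (real (Suc n) powr (3/4))\<^sup>2))"
      using elim(1) assms(2) by (intro mult_right_mono power_mono) auto
    also have "\<dots> = K * exp (2 * real d * real n - b * (real (Suc n) powr (3/4))\<^sup>2)"
    proof -
      have "exp (2 * real n) ^ d = exp (2 * real d * real n)"
        by (metis exp_of_nat_mult mult.assoc mult.commute)
      moreover have "exp x * (K * exp (- b * y)) = K * exp (x - b * y)" for x y
        by (simp add: exp_diff exp_minus divide_inverse)
      ultimately show ?thesis by (simp only:)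
    qed
    also have "\<dots> \<le> K * exp (- real n)"
      using elim(2) assms(2) by (intro mult_left_mono) auto
    also have "exp (- real n) = exp (- 1) ^ n"
      by (simp flip: exp_of_nat_mult)
    finally show ?case using assms(2) by (simp add: abs_mult)
  qed
qed

lemma ex_dyadic_scale:
  assumes "0 < \<epsilon>" "\<epsilon> \<le> 1" "\<epsilon> < 1 / 2 ^ N"
  obtains n where "n \<ge> N" "1 / 2 ^ Suc n < \<epsilon>" "\<epsilon> \<le> 1 / 2 ^ n" "real n \<le> log 2 (1 / \<epsilon>)"
proof -
  obtain m where m: "1 / \<epsilon> < 2 ^ m"
    using real_arch_pow[of 2 "1 / \<epsilon>"] by auto
  \<comment> \<open>The least power exceeding \<open>1 / \<epsilon>\<close> is not the zeroth, as
    \<epsilon> is at most 1; its predecessor is the level sought.\<close>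
  define m0 where "m0 = (LEAST m. 1 / \<epsilon> < 2 ^ m)"
  have m0: "1 / \<epsilon> < 2 ^ m0" unfolding m0_def using m by (rule LeastI)
  have "m0 \<noteq> 0" using m0 assms by (intro notI) (auto simp: field_simps)
  then obtain n where n: "m0 = Suc n" by (cases m0) auto
  have "\<not> 1 / \<epsilon> < 2 ^ n"
    using not_less_Least[of n "\<lambda>m. 1 / \<epsilon> < 2 ^ m"] n unfolding m0_def by auto
  then have n2: "2 ^ n \<le> 1 / \<epsilon>" by simp
  then have "log 2 (2 ^ n) \<le> log 2 (1 / \<epsilon>)" using assms by (subst log_le_cancel_iff) auto
  then have 1: "real n \<le> log 2 (1 / \<epsilon>)" by (simp add: log_nat_power)
  have 2: "1 / 2 ^ Suc n < \<epsilon>" "\<epsilon> \<le> 1 / 2 ^ n"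
    using m0 n2 assms unfolding n by (auto simp: field_simps)
  have "(2::real) ^ N < 1 / \<epsilon>" using assms by (simp add: field_simps)
  also have "\<dots> < 2 ^ Suc n" using m0 n by simp
  finally have "N < Suc n" by (subst (asm) power_strict_increasing_iff) auto
  then show ?thesis by (intro that[OF _ 2 1]) simp
qed

section \<open>Stability of thick points under vanishing perturbations\<close>

lemma Liminf_ereal_le:
  fixes f g :: "'b \<Rightarrow> real"
  assumes "((\<lambda>x. f x - g x) \<longlongrightarrow> 0) F" "F \<noteq> bot"
  shows "Liminf F (\<lambda>x. ereal (f x)) \<le> Liminf F (\<lambda>x. ereal (g x))"
    "Limsup F (\<lambda>x. ereal (f x)) \<le> Limsup F (\<lambda>x. ereal (g x))"
proof -
  have ev: "\<forall>\<^sub>F x in F. ereal (f x) \<le> ereal (g x) + ereal e" if "e > 0" for e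
    using order_tendstoD(2)[OF assms(1) that] by eventually_elim simp
  show "Liminf F (\<lambda>x. ereal (f x)) \<le> Liminf F (\<lambda>x. ereal (g x))"
  \<comment> \<open>The extended limits may be infinite, where subtracting them makes no sense, so
    they are compared up to an additive margin \<open>e\<close>.\<close>
  proof (rule ereal_le_epsilon2)
    fix e :: real assume "e > 0"
    moreover have "Liminf F (\<lambda>x. ereal (g x) + ereal e) = Liminf F (\<lambda>x. ereal (g x)) + ereal e"
      using assms(2) by (intro Liminf_add_ereal_right) auto
    ultimately
    show "Liminf F (\<lambda>x. ereal (f x)) \<le> Liminf F (\<lambda>x. ereal (g x)) + ereal e"
      using Liminf_mono[OF ev] by metis
  qed
  show "Limsup F (\<lambda>x. ereal (f x)) \<le> Limsup F (\<lambda>x. ereal (g x))"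
  proof (rule ereal_le_epsilon2)
    fix e :: real assume "e > 0"
    moreover have "Limsup F (\<lambda>x. ereal (g x) + ereal e) = Limsup F (\<lambda>x. ereal (g x)) + ereal e"
      using assms(2) by (intro Limsup_add_ereal_right) auto
    ultimately
    show "Limsup F (\<lambda>x. ereal (f x)) \<le> Limsup F (\<lambda>x. ereal (g x)) + ereal e"
      using Limsup_mono[OF ev] by metis
  qed
qed

text \<open>The hypothesis mentions neither the level nor the mode, so a single null set serves all
  of them.\<close>

lemma thick_points_eqI:
  assumes "\<And>z. ((\<lambda>\<epsilon>. (u \<epsilon> z - v \<epsilon> z) / ln (1 / \<epsilon>)) \<longlongrightarrow> 0) (at_right 0)"
  shows "thick_points mode \<alpha> u = thick_points mode \<alpha> v"
proof -
  have d: "((\<lambda>\<epsilon>. u \<epsilon> z / ln (1 / \<epsilon>) - v \<epsilon> z / ln (1 / \<epsilon>)) \<longlongrightarrow> 0) (at_right 0)" for z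
    using assms[of z] by (simp add: diff_divide_distrib)
  then have d': "((\<lambda>\<epsilon>. v \<epsilon> z / ln (1 / \<epsilon>) - u \<epsilon> z / ln (1 / \<epsilon>)) \<longlongrightarrow> 0) (at_right 0)" for z
    using tendsto_minus[OF d[of z]] by simp
  show ?thesis
  proof (cases mode)
    case Lim_inf
    have "Liminf (at_right 0) (\<lambda>\<epsilon>. ereal (u \<epsilon> z / ln (1 / \<epsilon>))) = Liminf (at_right 0) (\<lambda>\<epsilon>. ereal (v \<epsilon> z / ln (1 / \<epsilon>)))" for z
      by (intro antisym Liminf_ereal_le(1) d d' trivial_limit_at_right_real)
    then show ?thesis using Lim_inf by simp
  next
    case Lim_sup
    have "Limsup (at_right 0) (\<lambda>\<epsilon>. ereal (u \<epsilon> z / ln (1 / \<epsilon>))) = Limsup (at_right 0) (\<lambda>\<epsilon>. ereal (v \<epsilon> z / ln (1 / \<epsilon>)))" for z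
      by (intro antisym Liminf_ereal_le(2) d d' trivial_limit_at_right_real)
    then show ?thesis using Lim_sup by simp
  next
    case Lim_full
    have "((\<lambda>\<epsilon>. u \<epsilon> z / ln (1 / \<epsilon>)) \<longlongrightarrow> \<alpha>) (at_right 0) \<longleftrightarrow> ((\<lambda>\<epsilon>. v \<epsilon> z / ln (1 / \<epsilon>)) \<longlongrightarrow> \<alpha>) (at_right 0)" for z
      using Lim_transform[OF _ d[of z]] Lim_transform[OF _ d'[of z]] by blast
    then show ?thesis using Lim_full by simp
  qed
qed

text \<open>Continuity of the two paths is a premise inside the conclusion and not part of
  \<open>B\<close>: it holds almost surely, but the set of continuous paths need not be measurable.
  The constants do not depend on the cell, which the union bound over cells requires.\<close>

lemma mollified_fields_difference_tail:
  fixes \<psi> :: "'a::euclidean_space \<Rightarrow> real" and M :: "'w measure"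
  assumes M: "prob_space M" and kernel: "smoothing_kernel \<psi>" and h: "LGF M h"
    and \<rho>: "admissible_mollifier \<rho>" and \<sigma>: "admissible_mollifier \<sigma>"
    and p: "p > 0" and A\<rho>: "condition_A M \<psi> h p \<rho>" and A\<sigma>: "condition_A M \<psi> h p \<sigma>"
    and H\<rho>: "continuous_mollified_field M \<psi> h \<rho> H\<rho>" and H\<sigma>: "continuous_mollified_field M \<psi> h \<sigma> H\<sigma>"
  obtains K b S where "K \<ge> 0" "b > 0" "S > 0"
    "\<And>n k t. t \<ge> 1 \<Longrightarrow> \<exists>B\<in>sets M. measure M B \<le> K * exp (- b * t\<^sup>2) \<and>
      (\<forall>\<omega>\<in>space M - B. continuous_on (UNIV \<times> {0<..1}) (\<lambda>(z, \<epsilon>). H\<rho> \<epsilon> z \<omega>) \<longrightarrow>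
         continuous_on (UNIV \<times> {0<..1}) (\<lambda>(z, \<epsilon>). H\<sigma> \<epsilon> z \<omega>) \<longrightarrow>
         (\<forall>x\<in>cbox 0 One. \<bar>H\<rho> (snd (dyadic_cell n k x)) (fst (dyadic_cell n k x)) \<omega>
            - H\<sigma> (snd (dyadic_cell n k x)) (fst (dyadic_cell n k x)) \<omega>\<bar> \<le> S * t))"
proof -
  interpret prob_space M by fact
  obtain V where V: "V > 0" "\<And>z \<epsilon> X Y. 0 < \<epsilon> \<Longrightarrow> \<epsilon> \<le> 1 \<Longrightarrow> is_pairing M \<psi> h (rescale \<rho> z \<epsilon>) X \<Longrightarrow>
    is_pairing M \<psi> h (rescale \<sigma> z \<epsilon>) Y \<Longrightarrow> (\<integral>\<omega>. (X \<omega> - Y \<omega>)\<^sup>2 \<partial>M) \<le> V"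
    by (rule pairing_diff_variance_bound[OF kernel h \<rho> \<sigma>]) blast
  define R where "R n k x \<omega> = H\<rho> (snd (dyadic_cell n k x)) (fst (dyadic_cell n k x)) \<omega>" for n k x \<omega>
  define T where "T n k x \<omega> = H\<sigma> (snd (dyadic_cell n k x)) (fst (dyadic_cell n k x)) \<omega>" for n k x \<omega>
  obtain c1 where c1: "c1 > 0" "\<And>n k x y u r. x \<in> cbox 0 One \<Longrightarrow> y \<in> cbox 0 One \<Longrightarrow> u > 0 \<Longrightarrow> r > 0 \<Longrightarrow> dist x y \<le> r \<Longrightarrow>
    prob {\<omega> \<in> space M. u \<le> \<bar>R n k x \<omega> - R n k y \<omega>\<bar>} \<le> 2 * exp (- c1 * u\<^sup>2 / r powr p)"
    unfolding R_def by (rule dyadic_cell_increment_tail[OF M kernel h \<rho> p A\<rho> H\<rho>]) blast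
  obtain c2 where c2: "c2 > 0" "\<And>n k x y u r. x \<in> cbox 0 One \<Longrightarrow> y \<in> cbox 0 One \<Longrightarrow> u > 0 \<Longrightarrow> r > 0 \<Longrightarrow> dist x y \<le> r \<Longrightarrow>
    prob {\<omega> \<in> space M. u \<le> \<bar>T n k x \<omega> - T n k y \<omega>\<bar>} \<le> 2 * exp (- c2 * u\<^sup>2 / r powr p)"
    unfolding T_def by (rule dyadic_cell_increment_tail[OF M kernel h \<sigma> p A\<sigma> H\<sigma>]) blast
  \<comment> \<open>\<open>1 / (64 * V)\<close> belongs to the tail at one point. In the increments
    the threshold \<open>u\<close> is shared equally between the two fields, and halving it divides
    \<open>c1\<close> and \<open>c2\<close> by 4.\<close>
  define c where "c = min (1 / (64 * V)) (min (c1 / 4) (c2 / 4))"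
  have c: "c > 0" "c \<le> 1 / (64 * V)" "c \<le> c1 / 4" "c \<le> c2 / 4"
    unfolding c_def using V(1) c1(1) c2(1) by auto
  have meas: "R n k x \<in> borel_measurable M" "T n k x \<in> borel_measurable M"
    and pair: "is_pairing M \<psi> h (rescale \<rho> (fst (dyadic_cell n k x)) (snd (dyadic_cell n k x))) (R n k x)"
      "is_pairing M \<psi> h (rescale \<sigma> (fst (dyadic_cell n k x)) (snd (dyadic_cell n k x))) (T n k x)"
    if "x \<in> cbox 0 One" for n k x
  proof -
    show *: "is_pairing M \<psi> h (rescale \<rho> (fst (dyadic_cell n k x)) (snd (dyadic_cell n k x))) (R n k x)"
      "is_pairing M \<psi> h (rescale \<sigma> (fst (dyadic_cell n k x)) (snd (dyadic_cell n k x))) (T n k x)"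
      using H\<rho> H\<sigma> dyadic_cell_scale(1)[OF that, of n k]
      unfolding continuous_mollified_field_def R_def[abs_def] T_def[abs_def] by blast+
    show "R n k x \<in> borel_measurable M" "T n k x \<in> borel_measurable M"
      using * unfolding is_pairing_def L2_limit_def L2_rv_def by blast+
  qed
  have tail: "prob {\<omega> \<in> space M. u \<le> \<bar>R n k x \<omega> - T n k x \<omega>\<bar>} \<le> 4 * exp (- c * u\<^sup>2)"
    if x: "x \<in> cbox 0 One" and u: "u > 0" for n k x u
  proof -
    note \<rho>' = admissible_mollifierD(1-3)[OF \<rho>] and \<sigma>' = admissible_mollifierD(1-3)[OF \<sigma>]
    have "(\<integral>\<omega>. (R n k x \<omega> - T n k x \<omega>)\<^sup>2 \<partial>M) \<le> V"
      using dyadic_cell_scale(1)[OF x, of n k] by (intro V(2)[OF _ _ pair[OF x]]) auto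
    from pairing_diff_gaussian_tail[OF kernel M h \<rho>' \<sigma>' pair[OF x] this V(1) u]
    have "prob {\<omega> \<in> space M. u \<le> \<bar>R n k x \<omega> - T n k x \<omega>\<bar>} \<le> 2 * exp (- u\<^sup>2 / (64 * V))" .
    also have "\<dots> \<le> 4 * exp (- c * u\<^sup>2)"
    proof (rule mult_mono)
      have "c * u\<^sup>2 \<le> 1 / (64 * V) * u\<^sup>2" using c by (intro mult_right_mono) auto
      then show "exp (- u\<^sup>2 / (64 * V)) \<le> exp (- c * u\<^sup>2)" by simp
    qed auto
    finally show ?thesis .
  qed
  have incr: "prob {\<omega> \<in> space M. u \<le> \<bar>(R n k x \<omega> - T n k x \<omega>) - (R n k y \<omega> - T n k y \<omega>)\<bar>} \<le> 4 * exp (- c * u\<^sup>2 / r powr p)"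
    if x: "x \<in> cbox 0 One" and y: "y \<in> cbox 0 One" and u: "u > 0" and r: "r > 0" and xy: "dist x y \<le> r" for n k x y u r
  proof -
    note [measurable] = meas[OF x, of n k] meas[OF y, of n k]
    have exp_le: "exp (- c' * (u / 2)\<^sup>2 / r powr p) \<le> exp (- c * u\<^sup>2 / r powr p)" if "c \<le> c' / 4" for c'
    proof -
      have "c * u\<^sup>2 \<le> c' / 4 * u\<^sup>2" using that by (intro mult_right_mono) auto
      then have "c * u\<^sup>2 / r powr p \<le> (c' / 4 * u\<^sup>2) / r powr p" by (intro divide_right_mono) auto
      then show ?thesis by (simp add: power_divide)
    qed
    have "prob {\<omega> \<in> space M. u \<le> \<bar>(R n k x \<omega> - T n k x \<omega>) - (R n k y \<omega> - T n k y \<omega>)\<bar>}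
      \<le> prob ({\<omega> \<in> space M. u / 2 \<le> \<bar>R n k x \<omega> - R n k y \<omega>\<bar>} \<union> {\<omega> \<in> space M. u / 2 \<le> \<bar>T n k x \<omega> - T n k y \<omega>\<bar>})"
    proof (intro finite_measure_mono subsetI)
      fix \<omega> assume *: "\<omega> \<in> {\<omega> \<in> space M. u \<le> \<bar>(R n k x \<omega> - T n k x \<omega>) - (R n k y \<omega> - T n k y \<omega>)\<bar>}"
      then have "u / 2 \<le> \<bar>R n k x \<omega> - R n k y \<omega>\<bar> \<or> u / 2 \<le> \<bar>T n k x \<omega> - T n k y \<omega>\<bar>"
        by (smt (verit) field_sum_of_halves mem_Collect_eq)
      then show "\<omega> \<in> {\<omega> \<in> space M. u / 2 \<le> \<bar>R n k x \<omega> - R n k y \<omega>\<bar>} \<union> {\<omega> \<in> space M. u / 2 \<le> \<bar>T n k x \<omega> - T n k y \<omega>\<bar>}"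
        using * by blast
    qed measurable
    also have "\<dots> \<le> prob {\<omega> \<in> space M. u / 2 \<le> \<bar>R n k x \<omega> - R n k y \<omega>\<bar>} + prob {\<omega> \<in> space M. u / 2 \<le> \<bar>T n k x \<omega> - T n k y \<omega>\<bar>}"
      by (intro measure_Un_le) measurable
    also have "\<dots> \<le> 2 * exp (- c1 * (u / 2)\<^sup>2 / r powr p) + 2 * exp (- c2 * (u / 2)\<^sup>2 / r powr p)"
      using u by (intro add_mono c1(2) c2(2) x y r xy) auto
    also have "\<dots> \<le> 2 * exp (- c * u\<^sup>2 / r powr p) + 2 * exp (- c * u\<^sup>2 / r powr p)"
      using c by (intro add_mono mult_left_mono exp_le) auto
    finally show ?thesis by simp
  qed
  show ?thesis
  \<comment> \<open>The prefactor 4 is 2 + 2, one tail for the increment of each field. The chaining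
    takes place in space times scale.\<close>
  proof (rule chaining_tail[of 4 c p, where 'e = "'a \<times> real"], goal_cases)
    case chain: (4 K b S)
    show ?case
    proof (rule that[OF chain(1-3)])
      fix n k and t :: real assume t: "t \<ge> 1"
      have "\<exists>B\<in>events. prob B \<le> K * exp (- b * t\<^sup>2) \<and>
          (\<forall>\<omega>\<in>space M - B. continuous_on (cbox 0 One) (\<lambda>x. R n k x \<omega> - T n k x \<omega>) \<longrightarrow>
            (\<forall>x\<in>cbox 0 One. \<bar>R n k x \<omega> - T n k x \<omega>\<bar> \<le> S * t))"
        by (rule chain(4)[OF t, of "\<lambda>x \<omega>. R n k x \<omega> - T n k x \<omega>"])
          (rule borel_measurable_diff meas tail incr | assumption)+
      then obtain B where B: "B \<in> events" "prob B \<le> K * exp (- b * t\<^sup>2)"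
        "\<And>\<omega>. \<omega> \<in> space M - B \<Longrightarrow> continuous_on (cbox 0 One) (\<lambda>x. R n k x \<omega> - T n k x \<omega>) \<Longrightarrow>
           (\<forall>x\<in>cbox 0 One. \<bar>R n k x \<omega> - T n k x \<omega>\<bar> \<le> S * t)"
        by blast
      have "\<forall>x\<in>cbox 0 One. \<bar>R n k x \<omega> - T n k x \<omega>\<bar> \<le> S * t"
        if "\<omega> \<in> space M - B" "continuous_on (UNIV \<times> {0<..1}) (\<lambda>(z, \<epsilon>). H\<rho> \<epsilon> z \<omega>)"
          "continuous_on (UNIV \<times> {0<..1}) (\<lambda>(z, \<epsilon>). H\<sigma> \<epsilon> z \<omega>)" for \<omega>
      proof (rule B(3)[OF that(1)])
        show "continuous_on (cbox 0 One) (\<lambda>x. R n k x \<omega> - T n k x \<omega>)"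
          unfolding R_def T_def by (intro continuous_on_diff dyadic_cell_continuous_on that)
      qed
      then show "\<exists>B\<in>sets M. measure M B \<le> K * exp (- b * t\<^sup>2) \<and>
      (\<forall>\<omega>\<in>space M - B. continuous_on (UNIV \<times> {0<..1}) (\<lambda>(z, \<epsilon>). H\<rho> \<epsilon> z \<omega>) \<longrightarrow>
         continuous_on (UNIV \<times> {0<..1}) (\<lambda>(z, \<epsilon>). H\<sigma> \<epsilon> z \<omega>) \<longrightarrow>
         (\<forall>x\<in>cbox 0 One. \<bar>H\<rho> (snd (dyadic_cell n k x)) (fst (dyadic_cell n k x)) \<omega>
            - H\<sigma> (snd (dyadic_cell n k x)) (fst (dyadic_cell n k x)) \<omega>\<bar> \<le> S * t))"
        using B(1,2) unfolding R_def T_def by blast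
    qed
  qed (use c(1) p in auto)
qed

lemma mollified_fields_difference_sublogarithmic:
  fixes \<psi> :: "'a::euclidean_space \<Rightarrow> real" and M :: "'w measure"
  assumes M: "prob_space M" and kernel: "smoothing_kernel \<psi>" and h: "LGF M h"
    and \<rho>: "admissible_mollifier \<rho>" and \<sigma>: "admissible_mollifier \<sigma>"
    and p: "p > 0" and A\<rho>: "condition_A M \<psi> h p \<rho>" and A\<sigma>: "condition_A M \<psi> h p \<sigma>"
    and H\<rho>: "continuous_mollified_field M \<psi> h \<rho> H\<rho>" and H\<sigma>: "continuous_mollified_field M \<psi> h \<sigma> H\<sigma>"
  shows "AE \<omega> in M. \<forall>z. ((\<lambda>\<epsilon>. (H\<rho> \<epsilon> z \<omega> - H\<sigma> \<epsilon> z \<omega>) / ln (1 / \<epsilon>)) \<longlongrightarrow> 0) (at_right 0)"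
proof -
  interpret prob_space M by fact
  show ?thesis
  proof (rule mollified_fields_difference_tail[OF assms], goal_cases)
    case tail: (1 K b S)
    \<comment> \<open>Any exponent strictly between 1/2 and 1 would do: above 1/2 the square of
      \<open>t n\<close> outgrows the logarithm of the number of cells, below 1 the height is
      negligible against \<open>ln (1 / \<epsilon>)\<close>, which is of order
      \<open>n\<close>.\<close>
    define t where "t n = real (Suc n) powr (3/4)" for n
    have t1: "t n \<ge> 1" for n unfolding t_def by (intro ge_one_powr_ge_zero) auto
    \<comment> \<open>A point of norm at most \<open>n\<close> has a level-\<open>n\<close> corner
      with coordinates at most \<open>n * 2 ^ n\<close> in absolute value; the 1 is slack.\<close>
    define L where "L n = (\<lambda>j. \<Sum>b\<in>Basis. of_int (j b) *\<^sub>R b) `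
        (PiE (Basis :: 'a set) (\<lambda>_. {- int (n * 2 ^ n + 1)..int (n * 2 ^ n + 1)}))" for n
    have L: "finite (L n)" "card (L n) \<le> (2 * (n * 2 ^ n + 1) + 1) ^ DIM('a)" for n
      unfolding L_def by (rule card_integer_box)+
    have "\<exists>B. \<forall>n k. B n k \<in> events \<and> prob (B n k) \<le> K * exp (- b * (t n)\<^sup>2) \<and>
      (\<forall>\<omega>\<in>space M - B n k. continuous_on (UNIV \<times> {0<..1}) (\<lambda>(z, \<epsilon>). H\<rho> \<epsilon> z \<omega>) \<longrightarrow>
         continuous_on (UNIV \<times> {0<..1}) (\<lambda>(z, \<epsilon>). H\<sigma> \<epsilon> z \<omega>) \<longrightarrow>
         (\<forall>x\<in>cbox 0 One. \<bar>H\<rho> (snd (dyadic_cell n k x)) (fst (dyadic_cell n k x)) \<omega>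
            - H\<sigma> (snd (dyadic_cell n k x)) (fst (dyadic_cell n k x)) \<omega>\<bar> \<le> S * t n))"
      using tail(4)[OF t1] by (intro choice allI) blast
    then obtain B where B: "\<And>n k. B n k \<in> events" "\<And>n k. prob (B n k) \<le> K * exp (- b * (t n)\<^sup>2)"
      "\<And>n k \<omega> x. \<omega> \<in> space M - B n k \<Longrightarrow> continuous_on (UNIV \<times> {0<..1}) (\<lambda>(z, \<epsilon>). H\<rho> \<epsilon> z \<omega>) \<Longrightarrow>
         continuous_on (UNIV \<times> {0<..1}) (\<lambda>(z, \<epsilon>). H\<sigma> \<epsilon> z \<omega>) \<Longrightarrow> x \<in> cbox 0 One \<Longrightarrow>
         \<bar>H\<rho> (snd (dyadic_cell n k x)) (fst (dyadic_cell n k x)) \<omega>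
            - H\<sigma> (snd (dyadic_cell n k x)) (fst (dyadic_cell n k x)) \<omega>\<bar> \<le> S * t n"
      by blast
    define U where "U n = (\<Union>k\<in>L n. B n k)" for n
    have U: "U n \<in> events" for n unfolding U_def using L(1) B(1) by (intro sets.finite_UN) auto
    have "prob (U n) \<le> real (2 * (n * 2 ^ n + 1) + 1) ^ DIM('a) * (K * exp (- b * (t n)\<^sup>2))" for n
    proof -
      have "prob (U n) \<le> (\<Sum>k\<in>L n. prob (B n k))"
        unfolding U_def using B(1) by (intro finite_measure_subadditive_finite L(1)) auto
      also have "\<dots> \<le> (\<Sum>k\<in>L n. K * exp (- b * (t n)\<^sup>2))" by (intro sum_mono B(2))
      also have "\<dots> = real (card (L n)) * (K * exp (- b * (t n)\<^sup>2))" by simp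
      also have "\<dots> \<le> real (2 * (n * 2 ^ n + 1) + 1) ^ DIM('a) * (K * exp (- b * (t n)\<^sup>2))"
      proof (rule mult_right_mono)
        show "real (card (L n)) \<le> real (2 * (n * 2 ^ n + 1) + 1) ^ DIM('a)"
          using L(2)[of n] by (metis of_nat_le_iff of_nat_power)
      qed (use tail(1) in simp)
      finally show ?thesis .
    qed
    then have "summable (\<lambda>n. prob (U n))"
      by (intro summable_comparison_test'[OF summable_box_tails[OF tail(2,1), of "DIM('a)"]])
        (simp add: t_def)
    then have "AE \<omega> in M. \<forall>\<^sub>F n in sequentially. \<omega> \<in> space M - U n"
      using U by (intro borel_cantelli_AE1) (auto simp: emeasure_eq_measure)
    moreover have "AE \<omega> in M. continuous_on (UNIV \<times> {0<..1}) (\<lambda>(z, \<epsilon>). H\<rho> \<epsilon> z \<omega>)"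
      "AE \<omega> in M. continuous_on (UNIV \<times> {0<..1}) (\<lambda>(z, \<epsilon>). H\<sigma> \<epsilon> z \<omega>)"
      using H\<rho> H\<sigma> unfolding continuous_mollified_field_def by blast+
    ultimately show ?case
    proof eventually_elim
      case (elim \<omega>)
      show ?case
      proof
        fix z :: 'a
        obtain N where N: "\<And>n. n \<ge> N \<Longrightarrow> \<omega> \<in> space M - U n"
          using elim(1) unfolding eventually_sequentially by blast
        \<comment> \<open>From \<open>N\<close> on, \<omega> avoids the exceptional sets; from
          \<open>norm z\<close> on, \<open>z\<close> lies in the region covered by
          \<open>L n\<close>. Only this threshold depends on \<open>z\<close>, the null set of
          exceptional \<omega> does not.\<close>
        define N' where "N' = max N (nat \<lceil>norm z\<rceil>)"
        have bound: "norm ((H\<rho> \<epsilon> z \<omega> - H\<sigma> \<epsilon> z \<omega>) / ln (1 / \<epsilon>)) \<le> S * (log 2 (1 / \<epsilon>) + 1) powr (3/4) / ln (1 / \<epsilon>)"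
          if \<epsilon>: "0 < \<epsilon>" "\<epsilon> < 1 / 2 ^ N'" for \<epsilon>
        proof -
          have "1 / 2 ^ N' \<le> (1::real)" by simp
          then have \<epsilon>1: "\<epsilon> < 1" using \<epsilon>(2) by linarith
          obtain n where n: "n \<ge> N'" "1 / 2 ^ Suc n < \<epsilon>" "\<epsilon> \<le> 1 / 2 ^ n" "real n \<le> log 2 (1 / \<epsilon>)"
            by (rule ex_dyadic_scale[OF \<epsilon>(1) less_imp_le[OF \<epsilon>1] \<epsilon>(2)])
          obtain j x where jx: "x \<in> cbox 0 One" "\<And>b. b \<in> Basis \<Longrightarrow> \<bar>j b\<bar> \<le> \<lceil>2 ^ n * \<bar>z \<bullet> b\<bar>\<rceil>"
            "dyadic_cell n (\<Sum>b\<in>Basis. of_int (j b) *\<^sub>R b) x = (z, \<epsilon>)"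
            by (rule dyadic_cell_covers[OF n(2,3), of z]) blast
          have nz: "norm z \<le> real n" using n(1) unfolding N'_def by linarith
          have "j b \<in> {- int (n * 2 ^ n + 1)..int (n * 2 ^ n + 1)}" if b: "b \<in> Basis" for b
          proof -
            have "2 ^ n * \<bar>z \<bullet> b\<bar> \<le> 2 ^ n * real n"
              using Basis_le_norm[OF b, of z] nz by (intro mult_left_mono) auto
            then have "\<lceil>2 ^ n * \<bar>z \<bullet> b\<bar>\<rceil> \<le> \<lceil>real_of_int (2 ^ n * int n)\<rceil>"
              by (intro ceiling_mono) simp
            then have "\<lceil>2 ^ n * \<bar>z \<bullet> b\<bar>\<rceil> \<le> int (n * 2 ^ n + 1)"
              by (simp only: ceiling_of_int) (simp add: mult.commute)
            then show ?thesis using jx(2)[OF b] unfolding atLeastAtMost_iff by linarith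
          qed
          \<comment> \<open>Members of \<open>PiE\<close> are \<open>undefined\<close> off
            \<open>Basis\<close>, hence the restriction; the sum over \<open>Basis\<close> does not
            notice it.\<close>
          then have "restrict j Basis \<in> PiE (Basis :: 'a set) (\<lambda>_. {- int (n * 2 ^ n + 1)..int (n * 2 ^ n + 1)})"
            by (intro restrict_PiE_iff[THEN iffD2] ballI)
          then have "(\<Sum>b\<in>Basis. of_int (restrict j Basis b) *\<^sub>R b) \<in> L n"
            unfolding L_def by blast
          also have "(\<Sum>b\<in>(Basis :: 'a set). of_int (restrict j Basis b) *\<^sub>R b) = (\<Sum>b\<in>Basis. of_int (j b) *\<^sub>R b)"
            by (intro sum.cong) auto
          finally have k: "(\<Sum>b\<in>Basis. of_int (j b) *\<^sub>R b) \<in> L n" .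
          have "\<omega> \<in> space M - U n" using n(1) unfolding N'_def by (intro N) simp
          then have "\<omega> \<in> space M - B n (\<Sum>b\<in>Basis. of_int (j b) *\<^sub>R b)" using k unfolding U_def by blast
          from B(3)[OF this elim(2,3) jx(1)]
          have "\<bar>H\<rho> \<epsilon> z \<omega> - H\<sigma> \<epsilon> z \<omega>\<bar> \<le> S * t n" unfolding jx(3) by simp
          also have "\<dots> \<le> S * (log 2 (1 / \<epsilon>) + 1) powr (3/4)"
            unfolding t_def using n(4) tail(3) by (intro mult_left_mono powr_mono2) auto
          finally have "\<bar>H\<rho> \<epsilon> z \<omega> - H\<sigma> \<epsilon> z \<omega>\<bar> / ln (1 / \<epsilon>) \<le> S * (log 2 (1 / \<epsilon>) + 1) powr (3/4) / ln (1 / \<epsilon>)"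
            using \<epsilon>(1) \<epsilon>1 by (intro divide_right_mono) auto
          moreover have "ln (1 / \<epsilon>) > 0" using \<epsilon>(1) \<epsilon>1 by simp
          ultimately show ?thesis by (simp only: real_norm_def abs_divide abs_of_pos)
        qed
        show "((\<lambda>\<epsilon>. (H\<rho> \<epsilon> z \<omega> - H\<sigma> \<epsilon> z \<omega>) / ln (1 / \<epsilon>)) \<longlongrightarrow> 0) (at_right 0)"
        proof (rule Lim_null_comparison)
          show "((\<lambda>\<epsilon>. S * (log 2 (1 / \<epsilon>) + 1) powr (3/4) / ln (1 / \<epsilon>)) \<longlongrightarrow> 0) (at_right 0)"
            by real_asymp
          have "\<forall>\<^sub>F \<epsilon> in at_right 0. \<epsilon> < (1 / 2 ^ N' :: real)"
            by (intro eventually_at_right_real[THEN eventually_mono, of 0 "1 / 2 ^ N'"]) auto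
          moreover have "\<forall>\<^sub>F \<epsilon> in at_right 0. \<epsilon> > (0::real)" by (rule eventually_at_right_less)
          ultimately show "\<forall>\<^sub>F \<epsilon> in at_right 0. norm ((H\<rho> \<epsilon> z \<omega> - H\<sigma> \<epsilon> z \<omega>) / ln (1 / \<epsilon>))
              \<le> S * (log 2 (1 / \<epsilon>) + 1) powr (3/4) / ln (1 / \<epsilon>)"
            by eventually_elim (intro bound; simp)
        qed
      qed
    qed
  qed
qed

theorem theorem1p6:
  fixes M :: "'w measure"
    and \<psi> :: "'a::euclidean_space \<Rightarrow> real"
    and h :: "'w \<Rightarrow> ('a \<Rightarrow> real) \<Rightarrow> real"
    and \<rho> \<sigma> :: "'a measure"
    and H\<rho> H\<sigma> :: "real \<Rightarrow> 'a \<Rightarrow> 'w \<Rightarrow> real"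
  assumes dim: "DIM('a) \<ge> 2"
    and prob: "prob_space M"
    and kernel: "smoothing_kernel \<psi>"
    and field_h: "normalized_LGF M \<psi> h"
    and adm_\<rho>: "admissible_mollifier \<rho>"
    and adm_\<sigma>: "admissible_mollifier \<sigma>"
    and cond_A: "\<exists>p \<in> {0<..1}. condition_A M \<psi> h p \<rho> \<and> condition_A M \<psi> h p \<sigma>"
    and field_\<rho>: "continuous_mollified_field M \<psi> h \<rho> H\<rho>"
    and field_\<sigma>: "continuous_mollified_field M \<psi> h \<sigma> H\<sigma>"
  shows "AE \<omega> in M. \<forall>\<alpha> mode.
           thick_points mode \<alpha> (\<lambda>\<epsilon> z. H\<rho> \<epsilon> z \<omega>) = thick_points mode \<alpha> (\<lambda>\<epsilon> z. H\<sigma> \<epsilon> z \<omega>)"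
proof -
  have h: "LGF M h" using field_h unfolding normalized_LGF_def by blast
  obtain p where p: "p > 0" "condition_A M \<psi> h p \<rho>" "condition_A M \<psi> h p \<sigma>"
    using cond_A by auto
  have "AE \<omega> in M. \<forall>z. ((\<lambda>\<epsilon>. (H\<rho> \<epsilon> z \<omega> - H\<sigma> \<epsilon> z \<omega>) / ln (1 / \<epsilon>)) \<longlongrightarrow> 0) (at_right 0)"
    by (rule mollified_fields_difference_sublogarithmic[OF prob kernel h adm_\<rho> adm_\<sigma> p field_\<rho> field_\<sigma>])
  then show ?thesis
    by eventually_elim (auto intro!: thick_points_eqI)
qed

end
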